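(* Let $X(\mathbb{R})$ be a reflexive Banach function space such that the Hardy-Littlewood maximal operator $M$ is bounded on $X(\mathbb{R})$ and on its associate space $X'(\mathbb{R})$. Then the ideal $\mathcal{K}(X(\mathbb{R}))$ of compact operators on $X(\mathbb{R})$ is contained in the Banach algebra \[ \mathcal{A}_{X(\mathbb{R})}=\operatorname{alg}\{aI,\ W^0(b)\ :\ a\in C(\dot{\mathbb{R}}),\ b\in C_X(\dot{\mathbb{R}})\}, \] the smallest closed subalgebra of $\mathcal{B}(X(\mathbb{R}))$ containing all multiplication operators $aI$ with $a\in C(\dot{\mathbb{R}})$ and all Fourier convolution operators $W^0(b)$ with $b\in C_X(\dot{\mathbb{R}})$.
   Context: A Banach function norm is a map $\rho$ from nonnegative measurable functions on $\mathbb{R}$ to $[0,\infty]$ that is a norm-like functional ($\rho(f)=0\iff f=0$ a.e., positive homogeneous, subadditive), has the lattice property ($0\le g\le f$ a.e. implies $\rho(g)\le\rho(f)$), the Fatou property ($0\le f_n\uparrow f$ a.e. implies $\rho(f_n)\uparrow\rho(f)$), satisfies $\rho(\chi_E)<\infty$ and $\int_E f\,dx\le C_E\rho(f)$ for every measurable $E$ with $|E|<\infty$. The Banach function space $X(\mathbb{R})$ is the set of measurable $f$ with $\|f\|_{X(\mathbb{R})}:=\rho(|f|)<\infty$. Its associate space $X'(\mathbb{R})$ is the Banach function space given by the norm $\rho'(g)=\sup\{\int_\mathbb{R} fg\,dx: f\ge0,\ \rho(f)\le1\}$. The Hardy-Littlewood maximal operator is $(Mf)(x)=\sup_{Q\ni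 x}\frac1{|Q|}\int_Q|f(y)|dy$, the supremum over bounded intervals $Q$ containing $x$. The Fourier transform is $(Ff)(x)=\int_\mathbb{R} f(t)e^{itx}dt$ and for $a\in L^\infty(\mathbb{R})$, $W^0(a)=F^{-1}aF$ on $L^2(\mathbb{R})$. A function $a\in L^\infty(\mathbb{R})$ is a Fourier multiplier on $X(\mathbb{R})$ if $W^0(a)$ maps $L^2(\mathbb{R})\cap X(\mathbb{R})$ into $X(\mathbb{R})$ and extends to a bounded operator on $X(\mathbb{R})$; the set $\mathcal{M}_{X(\mathbb{R})}$ of such multipliers is normed by $\|a\|_{\mathcal{M}_{X(\mathbb{R})}}=\|W^0(a)\|_{\mathcal{B}(X(\mathbb{R}))}$. $\dot{\mathbb{R}}=\mathbb{R}\cup\{\infty\}$ is the one-point compactification, $C(\dot{\mathbb{R}})$ the continuous functions on it, $V(\mathbb{R})$ the functions of finite total variation on $\mathbb{R}$, and $C_X(\dot{\mathbb{R}})$ is the closure of $C(\dot{\mathbb{R}})\cap V(\mathbb{R})$ in the norm of $\mathcal{M}_{X(\mathbb{R})}$. $\mathcal{B}(X(\mathbb{R}))$ denotes bounded linear operators on $X(\mathbb{R})$. *)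

theory Defs
  imports "HOL-Analysis.Analysis"
begin

definition banach_function_norm :: "((real \<Rightarrow> ennreal) \<Rightarrow> ennreal) \<Rightarrow> bool" where
  "banach_function_norm \<rho> \<longleftrightarrow>
     (\<forall>f \<in> borel_measurable lebesgue. \<rho> f = 0 \<longleftrightarrow> (AE x in lebesgue. f x = 0)) \<and>
     (\<forall>f \<in> borel_measurable lebesgue. \<forall>c::real. c \<ge> 0 \<longrightarrow>
         \<rho> (\<lambda>x. ennreal c * f x) = ennreal c * \<rho> f) \<and>
     (\<forall>f \<in> borel_measurable lebesgue. \<forall>g \<in> borel_measurable lebesgue.
         \<rho> (\<lambda>x. f x + g x) \<le> \<rho> f + \<rho> g) \<and>
     (\<forall>f \<in> borel_measurable lebesgue. \<forall>g \<in> borel_measurable lebesgue.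
         (AE x in lebesgue. g x \<le> f x) \<longrightarrow> \<rho> g \<le> \<rho> f) \<and>
     (\<forall>F f. (\<forall>n. F n \<in> borel_measurable lebesgue) \<longrightarrow> f \<in> borel_measurable lebesgue \<longrightarrow>
         (AE x in lebesgue. incseq (\<lambda>n. F n x)) \<longrightarrow>
         (AE x in lebesgue. (\<lambda>n. F n x) \<longlonglongrightarrow> f x) \<longrightarrow>
         incseq (\<lambda>n. \<rho> (F n)) \<and> (\<lambda>n. \<rho> (F n)) \<longlonglongrightarrow> \<rho> f) \<and>
     (\<forall>E \<in> sets lebesgue. emeasure lebesgue E < \<infinity> \<longrightarrow>
         \<rho> (indicator E) < \<infinity> \<and>
         (\<exists>C::real. \<forall>f \<in> borel_measurable lebesgue.
             (\<integral>\<^sup>+x. f x * indicator E x \<partial>lebesgue) \<le> ennreal C * \<rho> f))"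

text \<open>The space \<open>X(\<real>)\<close> (complex-valued functions; elements are identified
  when they agree almost everywhere) and its norm.\<close>

definition bfs :: "((real \<Rightarrow> ennreal) \<Rightarrow> ennreal) \<Rightarrow> (real \<Rightarrow> complex) set" where
  "bfs \<rho> = {f. f \<in> borel_measurable lebesgue \<and> \<rho> (\<lambda>x. ennreal (cmod (f x))) < \<infinity>}"

definition normX :: "((real \<Rightarrow> ennreal) \<Rightarrow> ennreal) \<Rightarrow> (real \<Rightarrow> complex) \<Rightarrow> real" where
  "normX \<rho> f = enn2real (\<rho> (\<lambda>x. ennreal (cmod (f x))))"

definition assoc_norm :: "((real \<Rightarrow> ennreal) \<Rightarrow> ennreal) \<Rightarrow> (real \<Rightarrow> ennreal) \<Rightarrow> ennreal" where
  "assoc_norm \<rho> g = (SUP f \<in> {f \<in> borel_measurable lebesgue. \<rho> f \<le> 1}.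
                        \<integral>\<^sup>+x. f x * g x \<partial>lebesgue)"

definition maximal_fun :: "(real \<Rightarrow> complex) \<Rightarrow> real \<Rightarrow> ennreal" where
  "maximal_fun f x = (SUP Q \<in> {(a, b). a \<le> x \<and> x \<le> b \<and> a < b}.
       ennreal (1 / (snd Q - fst Q)) *
       (\<integral>\<^sup>+y. ennreal (cmod (f y)) * indicator {fst Q..snd Q} y \<partial>lebesgue))"

definition maximal_bounded :: "((real \<Rightarrow> ennreal) \<Rightarrow> ennreal) \<Rightarrow> bool" where
  "maximal_bounded \<rho> \<longleftrightarrow> (\<exists>C::real. \<forall>f \<in> bfs \<rho>.
      \<rho> (maximal_fun f) \<le> ennreal C * \<rho> (\<lambda>x. ennreal (cmod (f x))))"

definition dual_space :: "((real \<Rightarrow> ennreal) \<Rightarrow> ennreal) \<Rightarrow> ((real \<Rightarrow> complex) \<Rightarrow> complex) set" where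
  "dual_space \<rho> = {\<phi>.
     (\<forall>f \<in> bfs \<rho>. \<forall>g \<in> bfs \<rho>. \<forall>c. \<phi> (\<lambda>x. f x + c * g x) = \<phi> f + c * \<phi> g) \<and>
     (\<forall>f \<in> bfs \<rho>. \<forall>g \<in> bfs \<rho>. (AE x in lebesgue. f x = g x) \<longrightarrow> \<phi> f = \<phi> g) \<and>
     (\<exists>C. \<forall>f \<in> bfs \<rho>. cmod (\<phi> f) \<le> C * normX \<rho> f)}"

definition dual_norm :: "((real \<Rightarrow> ennreal) \<Rightarrow> ennreal) \<Rightarrow> ((real \<Rightarrow> complex) \<Rightarrow> complex) \<Rightarrow> real" where
  "dual_norm \<rho> \<phi> = Sup {cmod (\<phi> f) | f. f \<in> bfs \<rho> \<and> normX \<rho> f \<le> 1}"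

definition reflexive_bfs :: "((real \<Rightarrow> ennreal) \<Rightarrow> ennreal) \<Rightarrow> bool" where
  "reflexive_bfs \<rho> \<longleftrightarrow>
     (\<forall>\<Phi> :: ((real \<Rightarrow> complex) \<Rightarrow> complex) \<Rightarrow> complex.
        (\<forall>\<phi> \<in> dual_space \<rho>. \<forall>\<psi> \<in> dual_space \<rho>. \<forall>c.
            \<Phi> (\<lambda>f. \<phi> f + c * \<psi> f) = \<Phi> \<phi> + c * \<Phi> \<psi>) \<longrightarrow>
        (\<exists>C. \<forall>\<phi> \<in> dual_space \<rho>. cmod (\<Phi> \<phi>) \<le> C * dual_norm \<rho> \<phi>) \<longrightarrow>
        (\<exists>f \<in> bfs \<rho>. \<forall>\<phi> \<in> dual_space \<rho>. \<Phi> \<phi> = \<phi> f))"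

definition bounded_op :: "((real \<Rightarrow> ennreal) \<Rightarrow> ennreal) \<Rightarrow>
    ((real \<Rightarrow> complex) \<Rightarrow> (real \<Rightarrow> complex)) \<Rightarrow> bool" where
  "bounded_op \<rho> T \<longleftrightarrow>
     (\<forall>f \<in> bfs \<rho>. T f \<in> bfs \<rho>) \<and>
     (\<forall>f \<in> bfs \<rho>. \<forall>g \<in> bfs \<rho>. \<forall>c.
        AE x in lebesgue. T (\<lambda>y. f y + c * g y) x = T f x + c * T g x) \<and>
     (\<forall>f \<in> bfs \<rho>. \<forall>g \<in> bfs \<rho>. (AE x in lebesgue. f x = g x) \<longrightarrow>
        (AE x in lebesgue. T f x = T g x)) \<and>
     (\<exists>C. \<forall>f \<in> bfs \<rho>. normX \<rho> (T f) \<le> C * normX \<rho> f)"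

definition opdist :: "((real \<Rightarrow> ennreal) \<Rightarrow> ennreal) \<Rightarrow>
    ((real \<Rightarrow> complex) \<Rightarrow> (real \<Rightarrow> complex)) \<Rightarrow>
    ((real \<Rightarrow> complex) \<Rightarrow> (real \<Rightarrow> complex)) \<Rightarrow> real" where
  "opdist \<rho> T S = Sup {normX \<rho> (\<lambda>x. T f x - S f x) | f. f \<in> bfs \<rho> \<and> normX \<rho> f \<le> 1}"

definition opnorm :: "((real \<Rightarrow> ennreal) \<Rightarrow> ennreal) \<Rightarrow>
    ((real \<Rightarrow> complex) \<Rightarrow> (real \<Rightarrow> complex)) \<Rightarrow> real" where
  "opnorm \<rho> T = opdist \<rho> T (\<lambda>f x. 0)"

text \<open>Compact operators: images of bounded sequences have Cauchy subsequences
  (equivalently, relatively compact images, as X is complete).\<close>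

definition compact_op :: "((real \<Rightarrow> ennreal) \<Rightarrow> ennreal) \<Rightarrow>
    ((real \<Rightarrow> complex) \<Rightarrow> (real \<Rightarrow> complex)) \<Rightarrow> bool" where
  "compact_op \<rho> T \<longleftrightarrow> bounded_op \<rho> T \<and>
     (\<forall>F :: nat \<Rightarrow> real \<Rightarrow> complex. (\<forall>n. F n \<in> bfs \<rho>) \<longrightarrow> (\<exists>B. \<forall>n. normX \<rho> (F n) \<le> B) \<longrightarrow>
        (\<exists>r::nat \<Rightarrow> nat. strict_mono r \<and> (\<forall>\<epsilon>>0. \<exists>N. \<forall>m\<ge>N. \<forall>n\<ge>N.
             normX \<rho> (\<lambda>x. T (F (r m)) x - T (F (r n)) x) < \<epsilon>)))"

definition L2 :: "(real \<Rightarrow> complex) set" where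
  "L2 = {f. f \<in> borel_measurable lebesgue \<and> integrable lebesgue (\<lambda>x. (cmod (f x))\<^sup>2)}"

definition Linf :: "(real \<Rightarrow> complex) set" where
  "Linf = {a. a \<in> borel_measurable lebesgue \<and> (\<exists>C. AE x in lebesgue. cmod (a x) \<le> C)}"

definition FT1 :: "real \<Rightarrow> (real \<Rightarrow> complex) \<Rightarrow> real \<Rightarrow> complex" where
  "FT1 \<sigma> \<psi> x = (\<integral>t. \<psi> t * exp (\<i> * complex_of_real (\<sigma> * t * x)) \<partial>lebesgue)"

text \<open>Plancherel transform on \<open>L^2\<close>: \<open>h\<close> is the transform of \<open>f \<in> L^2\<close> iff
  \<open>h \<in> L^2\<close> and \<open>\<integral> h \<psi> = \<integral> f (F \<psi>)\<close> for all \<open>\<psi> \<in> L^1 \<inter> L^2\<close>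
  (this determines \<open>h\<close> uniquely a.e.).\<close>

definition FT2_rel :: "real \<Rightarrow> (real \<Rightarrow> complex) \<Rightarrow> (real \<Rightarrow> complex) \<Rightarrow> bool" where
  "FT2_rel \<sigma> f h \<longleftrightarrow> h \<in> L2 \<and>
     (\<forall>\<psi>. \<psi> \<in> L2 \<longrightarrow> integrable lebesgue \<psi> \<longrightarrow>
        (\<integral>x. h x * \<psi> x \<partial>lebesgue) = (\<integral>x. f x * FT1 \<sigma> \<psi> x \<partial>lebesgue))"

text \<open>\<open>W^0(a) f = F^{-1} (a \<cdot> F f)\<close> with \<open>F^{-1} u = (2\<pi>)^{-1} \<cdot> (transform with sign -1)\<close>.\<close>

definition W0_rel :: "(real \<Rightarrow> complex) \<Rightarrow> (real \<Rightarrow> complex) \<Rightarrow> (real \<Rightarrow> complex) \<Rightarrow> bool" where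
  "W0_rel a f g \<longleftrightarrow> (\<exists>h. FT2_rel 1 f h \<and>
      FT2_rel (-1) (\<lambda>x. a x * h x) (\<lambda>x. complex_of_real (2 * pi) * g x))"

definition W0 :: "(real \<Rightarrow> complex) \<Rightarrow> (real \<Rightarrow> complex) \<Rightarrow> (real \<Rightarrow> complex)" where
  "W0 a f = (SOME g. W0_rel a f g)"

definition is_multiplier :: "((real \<Rightarrow> ennreal) \<Rightarrow> ennreal) \<Rightarrow> (real \<Rightarrow> complex) \<Rightarrow> bool" where
  "is_multiplier \<rho> a \<longleftrightarrow> a \<in> Linf \<and>
     (\<forall>f \<in> L2 \<inter> bfs \<rho>. W0 a f \<in> bfs \<rho>) \<and>
     (\<exists>T. bounded_op \<rho> T \<and> (\<forall>f \<in> L2 \<inter> bfs \<rho>. AE x in lebesgue. T f x = W0 a f x))"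

definition W0X :: "((real \<Rightarrow> ennreal) \<Rightarrow> ennreal) \<Rightarrow> (real \<Rightarrow> complex) \<Rightarrow>
    ((real \<Rightarrow> complex) \<Rightarrow> (real \<Rightarrow> complex))" where
  "W0X \<rho> a = (SOME T. bounded_op \<rho> T \<and> (\<forall>f \<in> L2 \<inter> bfs \<rho>. AE x in lebesgue. T f x = W0 a f x))"

definition mult_norm :: "((real \<Rightarrow> ennreal) \<Rightarrow> ennreal) \<Rightarrow> (real \<Rightarrow> complex) \<Rightarrow> real" where
  "mult_norm \<rho> a = opnorm \<rho> (W0X \<rho> a)"

definition C_dot :: "(real \<Rightarrow> complex) set" where
  "C_dot = {a. continuous_on UNIV a \<and> (\<exists>L. (a \<longlongrightarrow> L) at_top \<and> (a \<longlongrightarrow> L) at_bot)}"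

definition BV :: "(real \<Rightarrow> complex) set" where
  "BV = {a. \<exists>B. \<forall>(n::nat) (x::nat \<Rightarrow> real). (\<forall>i<n. x i \<le> x (Suc i)) \<longrightarrow>
            (\<Sum>i<n. cmod (a (x (Suc i)) - a (x i))) \<le> B}"

definition C_X :: "((real \<Rightarrow> ennreal) \<Rightarrow> ennreal) \<Rightarrow> (real \<Rightarrow> complex) set" where
  "C_X \<rho> = {b. is_multiplier \<rho> b \<and>
     (\<forall>\<epsilon>>0. \<exists>c \<in> C_dot \<inter> BV. is_multiplier \<rho> c \<and> mult_norm \<rho> (\<lambda>x. b x - c x) < \<epsilon>)}"

inductive_set alg_A :: "((real \<Rightarrow> ennreal) \<Rightarrow> ennreal) \<Rightarrow>
    ((real \<Rightarrow> complex) \<Rightarrow> (real \<Rightarrow> complex)) set" for \<rho> where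
  gen_mult: "a \<in> C_dot \<Longrightarrow> (\<lambda>f x. a x * f x) \<in> alg_A \<rho>"
| gen_conv: "b \<in> C_X \<rho> \<Longrightarrow> W0X \<rho> b \<in> alg_A \<rho>"
| add: "T \<in> alg_A \<rho> \<Longrightarrow> S \<in> alg_A \<rho> \<Longrightarrow> (\<lambda>f x. T f x + S f x) \<in> alg_A \<rho>"
| smult: "T \<in> alg_A \<rho> \<Longrightarrow> (\<lambda>f x. c * T f x) \<in> alg_A \<rho>"
| comp: "T \<in> alg_A \<rho> \<Longrightarrow> S \<in> alg_A \<rho> \<Longrightarrow> (\<lambda>f. T (S f)) \<in> alg_A \<rho>"
| lim: "(\<And>n. Tn n \<in> alg_A \<rho>) \<Longrightarrow> bounded_op \<rho> S \<Longrightarrow>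
        (\<lambda>n. opdist \<rho> (Tn n) S) \<longlonglongrightarrow> 0 \<Longrightarrow> S \<in> alg_A \<rho>"

end

theory Submission
  imports Defs "HOL-Probability.Characteristic_Functions" "HOL-Real_Asymp.Real_Asymp"
begin

text \<open>
  By reflexivity the norm of \<open>X\<close> is absolutely continuous: otherwise a Hahn--Banach functional
  detects a sequence of restrictions \<open>1\<^bsub>E n\<^esub> f\<close>, \<open>E n \<down> \<emptyset>\<close>, whose limit in the bidual would be represented
  by \<open>0\<close>. Hence the continuous functions with compact support are dense in \<open>X\<close>, and a second use of
  Hahn--Banach and reflexivity shows that the functionals \<open>f \<mapsto> \<integral> f b\<close> with such \<open>b\<close> are dense in
  the dual.
  Boundedness of the maximal operator makes convolution with a Gaussian bounded on \<open>X\<close>, so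
  \<open>a W\<^sup>0(g\<^sub>n) b\<close>, with the Gaussian \<open>g\<^sub>n\<close> whose convolution kernel is \<open>exp(-x\<^sup>2/(2n\<^sup>2))\<close>, lies in the
  algebra. For continuous \<open>a\<close>, \<open>b\<close> with compact support it converges in norm to \<open>a \<otimes> b\<close>, so by
  density all operators of rank one belong to the algebra. Finally the averaging
  operators over the intervals \<open>[j/n, (j+1)/n)\<close> in \<open>[-n, n)\<close> have finite rank, are dominated by the maximal
  operator and converge strongly to the identity, so a compact \<open>T\<close> is a norm limit of operators
  of finite rank.
\<close>

section \<open>The Hahn--Banach theorem for seminorms on function spaces\<close>

text \<open>Elements of the space are functions rather than classes, and both the space and its dual
  are sets of functions carrying a seminorm. Hahn-Banach is therefore set up for such sets, and it
  is applied with seminorms that measure exactly what should vanish: on the space, the limit of the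
  norms of restrictions; on the dual, the distance to the functionals with kernel in
  \<open>C_comp\<close>. In both cases reflexivity turns a functional on the dual into a function,
  and testing shows that this function is zero almost everywhere. The Gaussian kernel is
  deliberately not normalised: its value at 0 is 1, so for large n it is close to the constant 1 on
  compact sets, and only the operators cut off by a and b are asked to converge. Being its own
  transform up to scale, it gives an explicit symbol and an explicit kernel at once.
  \<open>W0\<close> and \<open>W0X\<close> are defined by choice. What is known about their values
  holds almost everywhere and rests on two uniqueness facts: test functions determine the L^2
  transform, and a dense set determines the bounded extension.\<close>

locale function_space =
  fixes V :: "('i \<Rightarrow> complex) set"
  assumes zero_mem: "(\<lambda>x. 0) \<in> V"
    and lin_mem: "\<And>f g c. f \<in> V \<Longrightarrow> g \<in> V \<Longrightarrow> (\<lambda>x. f x + c * g x) \<in> V"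
begin

lemma add_mem: "f \<in> V \<Longrightarrow> g \<in> V \<Longrightarrow> (\<lambda>x. f x + g x) \<in> V"
  using lin_mem[of f g 1] by simp

lemma scale_mem: "f \<in> V \<Longrightarrow> (\<lambda>x. c * f x) \<in> V"
  using lin_mem[OF zero_mem, of f c] by simp

definition sublinear :: "(('i \<Rightarrow> complex) \<Rightarrow> real) \<Rightarrow> bool" where
  "sublinear q \<longleftrightarrow>
     (\<forall>f\<in>V. \<forall>g\<in>V. q (\<lambda>x. f x + g x) \<le> q f + q g) \<and>
     (\<forall>f\<in>V. \<forall>r\<ge>0. q (\<lambda>x. complex_of_real r * f x) = r * q f)"

lemma sublinearD:
  assumes "sublinear q"
  shows "f \<in> V \<Longrightarrow> g \<in> V \<Longrightarrow> q (\<lambda>x. f x + g x) \<le> q f + q g"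
    and "f \<in> V \<Longrightarrow> r \<ge> 0 \<Longrightarrow> q (\<lambda>x. complex_of_real r * f x) = r * q f"
  using assms by (auto simp: sublinear_def)

lemma sublinear_zero: "sublinear q \<Longrightarrow> q (\<lambda>x. 0) = 0"
  using sublinearD(2)[of q "\<lambda>x. 0" 0] zero_mem by simp

lemma sublinear_neg:
  assumes "sublinear q" "f \<in> V"
  shows "- q (\<lambda>x. - f x) \<le> q f"
  using sublinearD(1)[OF assms(1,2), of "\<lambda>x. - f x"] sublinear_zero[OF assms(1)]
    scale_mem[OF assms(2), of "-1"] by simp

text \<open>The classical auxiliary functional of Hahn-Banach: it stays below q, and t = 1 shows
  that its value at -g is at most -q(g). A minimal sublinear q must coincide with it, which forces q
  to be odd.\<close>

definition lower :: "(('i \<Rightarrow> complex) \<Rightarrow> real) \<Rightarrow> ('i \<Rightarrow> complex) \<Rightarrow> ('i \<Rightarrow> complex) \<Rightarrow> real" where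
  "lower q g f = (INF t\<in>{0..}. q (\<lambda>x. f x + complex_of_real t * g x) - t * q g)"

lemma lower_bdd:
  assumes q: "sublinear q" and f: "f \<in> V" and g: "g \<in> V"
  shows "bdd_below ((\<lambda>t. q (\<lambda>x. f x + complex_of_real t * g x) - t * q g) ` {0..})"
proof (rule bdd_belowI2)
  fix t :: real assume t: "t \<in> {0..}"
  have "t * q g = q (\<lambda>x. complex_of_real t * g x)"
    using sublinearD(2)[OF q g] t by simp
  also have "\<dots> = q (\<lambda>x. (f x + complex_of_real t * g x) + (- f x))"
    by (rule arg_cong[of _ _ q]) auto
  also have "\<dots> \<le> q (\<lambda>x. f x + complex_of_real t * g x) + q (\<lambda>x. - f x)"
    using scale_mem[OF f, of "-1"] by (intro sublinearD(1)[OF q lin_mem[OF f g]]) simp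
  finally show "- q (\<lambda>x. - f x) \<le> q (\<lambda>x. f x + complex_of_real t * g x) - t * q g"
    by simp
qed

lemma lower_le:
  assumes "sublinear q" "f \<in> V" "g \<in> V" "t \<ge> 0"
  shows "lower q g f \<le> q (\<lambda>x. f x + complex_of_real t * g x) - t * q g"
  unfolding lower_def using assms by (intro cINF_lower lower_bdd) auto

lemma lower_le_self:
  assumes "sublinear q" "f \<in> V" "g \<in> V"
  shows "lower q g f \<le> q f"
  using lower_le[OF assms, of 0] by simp

lemma sublinear_lower:
  assumes q: "sublinear q" and g: "g \<in> V"
  shows "sublinear (lower q g)"
  unfolding sublinear_def
proof (intro conjI ballI allI impI)
  fix f h assume f: "f \<in> V" and h: "h \<in> V"
  let ?F = "\<lambda>f t. q (\<lambda>x. f x + complex_of_real t * g x) - t * q g"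
  have fh: "(\<lambda>x. f x + h x) \<in> V" by (rule add_mem[OF f h])
  \<comment> \<open>Parameters add: s for f and t for h give s + t for f + h. The infima over t and
    over s are then taken one after the other.\<close>
  have *: "lower q g (\<lambda>x. f x + h x) - ?F f s \<le> ?F h t" if "s \<ge> 0" "t \<ge> 0" for s t
  proof -
    have "lower q g (\<lambda>x. f x + h x) \<le> ?F (\<lambda>x. f x + h x) (s + t)"
      using that by (intro lower_le[OF q fh g]) simp
    also have "(\<lambda>x. (f x + h x) + complex_of_real (s + t) * g x)
       = (\<lambda>x. (f x + complex_of_real s * g x) + (h x + complex_of_real t * g x))"
      by (auto simp: algebra_simps)
    also have "q \<dots> \<le> q (\<lambda>x. f x + complex_of_real s * g x) + q (\<lambda>x. h x + complex_of_real t * g x)"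
      by (rule sublinearD(1)[OF q lin_mem[OF f g] lin_mem[OF h g]])
    finally show ?thesis by (simp add: algebra_simps)
  qed
  have "lower q g (\<lambda>x. f x + h x) - ?F f s \<le> lower q g h" if "s \<ge> 0" for s
    unfolding lower_def[of q g h] using *[OF that] by (intro cINF_greatest) auto
  then have "lower q g (\<lambda>x. f x + h x) - lower q g h \<le> ?F f s" if "s \<ge> 0" for s
    using that by (auto simp: algebra_simps)
  then have "lower q g (\<lambda>x. f x + h x) - lower q g h \<le> lower q g f"
    unfolding lower_def[of q g f] by (intro cINF_greatest) auto
  then show "lower q g (\<lambda>x. f x + h x) \<le> lower q g f + lower q g h" by simp
next
  fix f and r :: real assume f: "f \<in> V" and r: "0 \<le> r"
  let ?F = "\<lambda>f t. q (\<lambda>x. f x + complex_of_real t * g x) - t * q g"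
  have scale: "?F (\<lambda>x. complex_of_real s * h x) (s * t) = s * ?F h t"
    if "s \<ge> 0" "h \<in> V" for s t h
  proof -
    have "(\<lambda>x. complex_of_real s * h x + complex_of_real (s * t) * g x)
        = (\<lambda>x. complex_of_real s * (h x + complex_of_real t * g x))"
      by (auto simp: algebra_simps)
    then show ?thesis
      using sublinearD(2)[OF q lin_mem[OF that(2) g, of t] that(1)] by (simp add: algebra_simps)
  qed
  have le: "lower q g (\<lambda>x. complex_of_real s * h x) \<le> s * lower q g h" if "s > 0" "h \<in> V" for s h
  proof -
    have "lower q g (\<lambda>x. complex_of_real s * h x) / s \<le> ?F h t" if "t \<ge> 0" for t
    proof -
      have "lower q g (\<lambda>x. complex_of_real s * h x) \<le> ?F (\<lambda>x. complex_of_real s * h x) (s * t)"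
        using \<open>s > 0\<close> that \<open>h \<in> V\<close> by (intro lower_le[OF q scale_mem g]) auto
      also have "\<dots> = s * ?F h t" using scale \<open>s > 0\<close> \<open>h \<in> V\<close> by auto
      finally show ?thesis using \<open>s > 0\<close> by (simp add: field_simps)
    qed
    then have "lower q g (\<lambda>x. complex_of_real s * h x) / s \<le> lower q g h"
      unfolding lower_def[of q g h] by (intro cINF_greatest) auto
    then show ?thesis using \<open>s > 0\<close> by (simp add: field_simps)
  qed
  show "lower q g (\<lambda>x. complex_of_real r * f x) = r * lower q g f"
  proof (cases "r = 0")
    case True
    have "0 \<le> lower q g (\<lambda>x. 0)"
      unfolding lower_def using sublinearD(2)[OF q g] by (intro cINF_greatest) auto
    moreover have "lower q g (\<lambda>x. 0) \<le> 0"
      using lower_le_self[OF q zero_mem g] sublinear_zero[OF q] by simp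
    ultimately show ?thesis using True by simp
  next
    case False
    with r have r: "r > 0" by simp
    have "lower q g f = lower q g (\<lambda>x. complex_of_real (1/r) * (complex_of_real r * f x))"
      using r by simp
    also have "\<dots> \<le> (1/r) * lower q g (\<lambda>x. complex_of_real r * f x)"
      using r f by (intro le scale_mem) auto
    finally have "r * lower q g f \<le> lower q g (\<lambda>x. complex_of_real r * f x)"
      using r by (simp add: field_simps)
    with le[OF r f] show ?thesis by simp
  qed
qed

text \<open>Subadditivity fails for infima of arbitrary families. In a chain, q at f and r at g can
  both be replaced by the smaller of the two functionals. The common lower bound -p(-f) makes every
  infimum a genuine one.\<close>

lemma chain_inf_sublinear:
  assumes C: "C \<noteq> {}" "\<And>q. q \<in> C \<Longrightarrow> sublinear q"
    and p: "\<And>q f. q \<in> C \<Longrightarrow> f \<in> V \<Longrightarrow> q f \<le> p f"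
    and chain: "\<And>q r. q \<in> C \<Longrightarrow> r \<in> C \<Longrightarrow> (\<forall>f\<in>V. q f \<le> r f) \<or> (\<forall>f\<in>V. r f \<le> q f)"
  shows "sublinear (\<lambda>f. INF q\<in>C. q f)" "\<And>q f. q \<in> C \<Longrightarrow> f \<in> V \<Longrightarrow> (INF q\<in>C. q f) \<le> q f"
proof -
  have bdd: "bdd_below ((\<lambda>q. q f) ` C)" if f: "f \<in> V" for f
  proof (rule bdd_belowI2)
    fix q assume q: "q \<in> C"
    have "(\<lambda>x. - f x) \<in> V" using scale_mem[OF f, of "-1"] by simp
    from p[OF q this] sublinear_neg[OF C(2)[OF q] f] show "- p (\<lambda>x. - f x) \<le> q f" by simp
  qed
  show le: "\<And>q f. q \<in> C \<Longrightarrow> f \<in> V \<Longrightarrow> (INF q\<in>C. q f) \<le> q f"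
    using bdd by (intro cINF_lower) auto
  show "sublinear (\<lambda>f. INF q\<in>C. q f)"
    unfolding sublinear_def
  proof (intro conjI ballI allI impI)
    fix f g assume f: "f \<in> V" and g: "g \<in> V"
    let ?L = "INF q\<in>C. q (\<lambda>x. f x + g x)"
    have "?L - q f \<le> r g" if qr: "q \<in> C" "r \<in> C" for q r
    proof -
      obtain s where s: "s \<in> C" "s f \<le> q f" "s g \<le> r g"
      proof (cases "\<forall>f\<in>V. q f \<le> r f")
        case True with that[of q] qr f g show ?thesis by simp
      next
        case False with that[of r] chain[OF qr] qr f g show ?thesis by simp
      qed
      have "?L \<le> s (\<lambda>x. f x + g x)" using le[OF s(1) add_mem[OF f g]] .
      also have "\<dots> \<le> s f + s g" by (rule sublinearD(1)[OF C(2)[OF s(1)] f g])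
      finally show ?thesis using s by simp
    qed
    then have "?L - q f \<le> (INF r\<in>C. r g)" if "q \<in> C" for q
      using that C by (intro cINF_greatest) auto
    then have "?L - (INF r\<in>C. r g) \<le> q f" if "q \<in> C" for q
      using that by (auto simp: algebra_simps)
    then have "?L - (INF r\<in>C. r g) \<le> (INF q\<in>C. q f)"
      using C by (intro cINF_greatest) auto
    then show "?L \<le> (INF q\<in>C. q f) + (INF q\<in>C. q g)" by simp
  next
    fix f and r :: real assume f: "f \<in> V" and r: "0 \<le> r"
    have eq: "(INF q\<in>C. q (\<lambda>x. complex_of_real r * f x)) = (INF q\<in>C. r * q f)"
      using sublinearD(2)[OF C(2) f r] by (intro INF_cong) auto
    show "(INF q\<in>C. q (\<lambda>x. complex_of_real r * f x)) = r * (INF q\<in>C. q f)"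
    proof (cases "r = 0")
      case True then show ?thesis using eq C by simp
    next
      case False
      with r have r: "r > 0" by simp
      have "bdd_below ((\<lambda>q. r * q f) ` C)"
      proof -
        obtain m where "\<And>q. q \<in> C \<Longrightarrow> m \<le> q f" using bdd[OF f] by (auto simp: bdd_below_def)
        then show ?thesis using r by (intro bdd_belowI2[of _ "r * m"]) (simp add: mult_left_mono)
      qed
      then have "(INF q\<in>C. r * q f) \<le> r * q f" if "q \<in> C" for q
        using that by (rule cINF_lower)
      then have "(INF q\<in>C. r * q f) / r \<le> (INF q\<in>C. q f)"
        using r C by (intro cINF_greatest) (simp_all add: divide_le_eq mult.commute)
      moreover have "r * (INF q\<in>C. q f) \<le> (INF q\<in>C. r * q f)"
        using r C le[OF _ f] by (intro cINF_greatest) auto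
      ultimately show ?thesis using eq r by (simp add: field_simps)
    qed
  qed
qed

text \<open>Zorn's lemma for the reversed pointwise order, so that a maximal element is a minimal
  sublinear functional.\<close>

lemma sublinear_minimal_below:
  assumes p: "sublinear p"
  obtains q where "sublinear q" "\<And>f. f \<in> V \<Longrightarrow> q f \<le> p f"
    "\<And>r f. sublinear r \<Longrightarrow> (\<And>f. f \<in> V \<Longrightarrow> r f \<le> q f) \<Longrightarrow> f \<in> V \<Longrightarrow> r f = q f"
proof -
  \<comment> \<open>Competitors are 0 outside V: the order compares values on V only and would
    otherwise fail to be antisymmetric.\<close>
  define A where "A = {q. sublinear q \<and> (\<forall>f\<in>V. q f \<le> p f) \<and> (\<forall>f. f \<notin> V \<longrightarrow> q f = 0)}"
  define P where "P = (\<lambda>q r :: ('i \<Rightarrow> complex) \<Rightarrow> real. \<forall>f\<in>V. r f \<le> q f)"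
  let ?r = "\<lambda>q f. if f \<in> V then q f else (0::real)"
  have restr: "sublinear (?r q)" if "sublinear q" for q
    using that by (auto simp: sublinear_def add_mem scale_mem)
  have "\<exists>m\<in>A. \<forall>a\<in>A. P m a \<longrightarrow> a = m"
  proof (rule predicate_Zorn)
    show "partial_order_on A (relation_of P A)"
    proof (rule partial_order_on_relation_ofI)
      show "P a a" for a by (auto simp: P_def)
      show "P a b \<Longrightarrow> P b c \<Longrightarrow> P a c" for a b c unfolding P_def by (meson order_trans)
      show "a = b" if "a \<in> A" "b \<in> A" "P a b" "P b a" for a b
      proof
        fix f
        have "f \<in> V \<Longrightarrow> a f \<le> b f" "f \<in> V \<Longrightarrow> b f \<le> a f" using that(3,4) unfolding P_def by blast+
        moreover have "f \<notin> V \<Longrightarrow> a f = 0" "f \<notin> V \<Longrightarrow> b f = 0" using that(1,2) unfolding A_def by blast+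
        ultimately show "a f = b f" by (cases "f \<in> V") simp_all
      qed
    qed
  next
    fix C assume C: "C \<in> Chains (relation_of P A)"
    show "\<exists>u\<in>A. \<forall>a\<in>C. P a u"
    proof (cases "C = {}")
      case True
      have "?r p \<in> A" using restr[OF p] by (auto simp: A_def)
      then show ?thesis using True by auto
    next
      case False
      have CA: "C \<subseteq> A" using C unfolding Chains_def relation_of_def by blast
      have ch: "(\<forall>f\<in>V. q f \<le> r f) \<or> (\<forall>f\<in>V. r f \<le> q f)" if "q \<in> C" "r \<in> C" for q r
      proof -
        have "(q, r) \<in> relation_of P A \<or> (r, q) \<in> relation_of P A"
          using C that unfolding Chains_def by blast
        then show ?thesis unfolding relation_of_def P_def by blast
      qed
      have sub: "sublinear q" "\<And>f. f \<in> V \<Longrightarrow> q f \<le> p f" if "q \<in> C" for q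
        using CA that unfolding A_def by blast+
      let ?u = "\<lambda>f. INF q\<in>C. q f"
      have inf1: "sublinear ?u"
        using False sub ch by (rule chain_inf_sublinear(1))
      have inf2: "?u f \<le> q f" if "q \<in> C" "f \<in> V" for q f
        using False sub ch that by (rule chain_inf_sublinear(2))
      obtain q0 where q0: "q0 \<in> C" using False by auto
      have "?r ?u \<in> A"
        using restr[OF inf1] order_trans[OF inf2[OF q0] sub(2)[OF q0]] by (simp add: A_def)
      moreover have "\<forall>a\<in>C. P a (?r ?u)" using inf2 by (auto simp: P_def)
      ultimately show ?thesis by blast
    qed
  qed
  then obtain m where m: "m \<in> A" "\<And>a. a \<in> A \<Longrightarrow> P m a \<Longrightarrow> a = m" by blast
  show ?thesis
  proof
    show "sublinear m" "\<And>f. f \<in> V \<Longrightarrow> m f \<le> p f" using m(1) by (auto simp: A_def)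
    fix r f assume r: "sublinear r" "\<And>f. f \<in> V \<Longrightarrow> r f \<le> m f" and f: "f \<in> V"
    have "?r r \<in> A" using restr[OF r(1)] order_trans[OF r(2)] m(1) by (simp add: A_def)
    then have "?r r = m" using r(2) by (intro m(2)) (auto simp: P_def)
    then show "r f = m f" using f by (auto dest: fun_cong[of _ _ f])
  qed
qed

text \<open>A minimal sublinear q is linear: \<open>lower q f\<close> is sublinear and below q,
  hence equal to it, and its value at -f is at most -q(f). Minimising below
  \<open>lower p f0\<close> instead of p pins the value at f0 to \<open>p f0\<close>.\<close>

lemma hahn_banach_real:
  assumes p: "sublinear p" and f0: "f0 \<in> V"
  obtains u where "\<And>f g. f \<in> V \<Longrightarrow> g \<in> V \<Longrightarrow> u (\<lambda>x. f x + g x) = u f + u g"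
    "\<And>f r. f \<in> V \<Longrightarrow> u (\<lambda>x. complex_of_real r * f x) = r * u f"
    "\<And>f. f \<in> V \<Longrightarrow> u f \<le> p f" "u f0 = p f0"
proof -
  obtain q where q: "sublinear q" "\<And>f. f \<in> V \<Longrightarrow> q f \<le> lower p f0 f"
    and min: "\<And>r f. sublinear r \<Longrightarrow> (\<And>f. f \<in> V \<Longrightarrow> r f \<le> q f) \<Longrightarrow> f \<in> V \<Longrightarrow> r f = q f"
    using sublinear_minimal_below[OF sublinear_lower[OF p f0]] by blast
  have neg: "q (\<lambda>x. - f x) = - q f" if f: "f \<in> V" for f
  proof -
    have nf: "(\<lambda>x. - f x) \<in> V" using scale_mem[OF f, of "-1"] by simp
    have "lower q f (\<lambda>x. - f x) = q (\<lambda>x. - f x)"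
      by (rule min[OF sublinear_lower[OF q(1) f] lower_le_self[OF q(1) _ f] nf])
    moreover have "lower q f (\<lambda>x. - f x) \<le> - q f"
      using lower_le[OF q(1) nf f, of 1] sublinear_zero[OF q(1)] by simp
    moreover have "- q f \<le> q (\<lambda>x. - f x)" using sublinear_neg[OF q(1) nf] by simp
    ultimately show ?thesis by simp
  qed
  show ?thesis
  proof
    fix f assume f: "f \<in> V"
    fix r :: real
    show "q (\<lambda>x. complex_of_real r * f x) = r * q f"
    proof (cases "r \<ge> 0")
      case True then show ?thesis using sublinearD(2)[OF q(1) f] by simp
    next
      case False
      then have "q (\<lambda>x. complex_of_real (-r) * f x) = (-r) * q f"
        by (intro sublinearD(2)[OF q(1) f]) simp
      then show ?thesis using neg[OF scale_mem[OF f, of "complex_of_real (-r)"]] by simp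
    qed
  next
    fix f g assume f: "f \<in> V" and g: "g \<in> V"
    have nf: "(\<lambda>x. - f x) \<in> V" using scale_mem[OF f, of "-1"] by simp
    have "q g = q (\<lambda>x. (f x + g x) + (- f x))" by (rule arg_cong[of _ _ q]) auto
    also have "\<dots> \<le> q (\<lambda>x. f x + g x) + q (\<lambda>x. - f x)"
      by (rule sublinearD(1)[OF q(1) add_mem[OF f g] nf])
    finally show "q (\<lambda>x. f x + g x) = q f + q g"
      using sublinearD(1)[OF q(1) f g] neg[OF f] by simp
  next
    fix f assume "f \<in> V" then show "q f \<le> p f"
      using q(2) lower_le_self[OF p _ f0] by (meson order_trans)
  next
    have nf: "(\<lambda>x. - f0 x) \<in> V" using scale_mem[OF f0, of "-1"] by simp
    have "q (\<lambda>x. - f0 x) \<le> - p f0"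
      using q(2)[OF nf] lower_le[OF p nf f0, of 1] sublinear_zero[OF p] by simp
    moreover have "q f0 \<le> p f0" using q(2)[OF f0] lower_le_self[OF p f0 f0] by simp
    ultimately show "q f0 = p f0" using neg[OF f0] by simp
  qed
qed

text \<open>Only an inequality is asked for scalars, since scaling back by 1/c gives equality; an
  inequality is what passes most easily to the limits and infima that p will be. The index type is
  arbitrary, so the theorem serves for functions and for functionals.\<close>

theorem hahn_banach:
  assumes tri: "\<And>f g. f \<in> V \<Longrightarrow> g \<in> V \<Longrightarrow> p (\<lambda>x. f x + g x) \<le> p f + p g"
    and scale_le: "\<And>f c. f \<in> V \<Longrightarrow> p (\<lambda>x. c * f x) \<le> cmod c * p f"
    and f0: "f0 \<in> V"
  obtains \<Phi> :: "('i \<Rightarrow> complex) \<Rightarrow> complex"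
  where "\<And>f g c. f \<in> V \<Longrightarrow> g \<in> V \<Longrightarrow> \<Phi> (\<lambda>x. f x + c * g x) = \<Phi> f + c * \<Phi> g"
    "\<And>f. f \<in> V \<Longrightarrow> cmod (\<Phi> f) \<le> p f" "cmod (\<Phi> f0) = p f0"
proof -
  have scale: "p (\<lambda>x. c * f x) = cmod c * p f" if f: "f \<in> V" for f c
  proof (cases "c = 0")
    case True
    then show ?thesis using scale_le[OF f, of 0] tri[OF zero_mem zero_mem] by simp
  next
    case False
    have "p f \<le> cmod (1 / c) * p (\<lambda>x. c * f x)"
      using scale_le[OF scale_mem[OF f, of c], of "1 / c"] False by simp
    then have "cmod c * p f \<le> p (\<lambda>x. c * f x)"
      using False by (simp add: norm_divide field_simps)
    with scale_le[OF f, of c] show ?thesis by simp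
  qed
  have "sublinear p" using tri scale by (auto simp: sublinear_def)
  then obtain u where add: "\<And>f g. f \<in> V \<Longrightarrow> g \<in> V \<Longrightarrow> u (\<lambda>x. f x + g x) = u f + u g"
    and sc: "\<And>f r. f \<in> V \<Longrightarrow> u (\<lambda>x. complex_of_real r * f x) = r * u f"
    and le: "\<And>f. f \<in> V \<Longrightarrow> u f \<le> p f" and u0: "u f0 = p f0"
    using hahn_banach_real[OF _ f0] by blast
  \<comment> \<open>Complex homogeneity forces this imaginary part once the real part is u.\<close>
  define \<Phi> where "\<Phi> f = Complex (u f) (- u (\<lambda>x. \<i> * f x))" for f
  have add': "\<Phi> (\<lambda>x. f x + g x) = \<Phi> f + \<Phi> g" if "f \<in> V" "g \<in> V" for f g
    using add[OF that] add[OF scale_mem scale_mem, OF that, of \<i> \<i>]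
    by (simp add: \<Phi>_def complex_eq_iff algebra_simps)
  have mul: "\<Phi> (\<lambda>x. c * f x) = c * \<Phi> f" if f: "f \<in> V" for f c
  proof -
    have split: "u (\<lambda>x. (complex_of_real a + \<i> * complex_of_real b) * f x) = a * u f + b * u (\<lambda>x. \<i> * f x)" for a b
    proof -
      have "(\<lambda>x. (complex_of_real a + \<i> * complex_of_real b) * f x)
          = (\<lambda>x. complex_of_real a * f x + complex_of_real b * (\<i> * f x))"
        by (auto simp: algebra_simps)
      then show ?thesis
        using add[OF scale_mem[OF f, of "complex_of_real a"] scale_mem[OF scale_mem[OF f, of \<i>], of "complex_of_real b"]]
          sc[OF f] sc[OF scale_mem[OF f, of \<i>]] by simp
    qed
    have 1: "u (\<lambda>x. c * f x) = Re c * u f + Im c * u (\<lambda>x. \<i> * f x)"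
      using split[of "Re c" "Im c"] by (simp add: complex_eq[symmetric])
    have "\<i> * c = complex_of_real (- Im c) + \<i> * complex_of_real (Re c)"
      by (simp add: complex_eq_iff)
    then have 2: "u (\<lambda>x. \<i> * (c * f x)) = - Im c * u f + Re c * u (\<lambda>x. \<i> * f x)"
      using split[of "- Im c" "Re c"] by (simp add: mult.assoc[symmetric])
    show ?thesis unfolding \<Phi>_def 1 2 by (simp add: complex_eq_iff algebra_simps)
  qed
  have bound: "cmod (\<Phi> f) \<le> p f" if f: "f \<in> V" for f
  proof (cases "\<Phi> f = 0")
    case True
    have "p f + p (\<lambda>x. (-1) * f x) \<ge> p (\<lambda>x. 0 * f x)"
      using tri[OF f scale_mem[OF f, of "-1"]] by simp
    then have "0 \<le> p f" using scale[OF f, of "-1"] scale[OF f, of 0] by simp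
    then show ?thesis using True by simp
  next
    case False
    let ?c = "cnj (\<Phi> f) / complex_of_real (cmod (\<Phi> f))"
    have "?c * \<Phi> f = complex_of_real (cmod (\<Phi> f))"
      using False by (simp add: field_simps complex_norm_square[symmetric] power2_eq_square)
    then have "u (\<lambda>x. ?c * f x) = cmod (\<Phi> f)"
      using mul[OF f, of ?c] by (simp add: \<Phi>_def complex_eq_iff)
    moreover have "u (\<lambda>x. ?c * f x) \<le> p f"
      using le[OF scale_mem[OF f, of ?c]] scale[OF f, of ?c] False by (simp add: norm_divide)
    ultimately show ?thesis by simp
  qed
  have "cmod (\<Phi> f0) = p f0"
    using bound[OF f0] abs_Re_le_cmod[of "\<Phi> f0"] u0 by (simp add: \<Phi>_def)
  with bound add' mul scale_mem show ?thesis by (intro that[of \<Phi>]) auto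
qed

end

section \<open>Banach function spaces and their duals\<close>

locale banach_function_space =
  fixes \<rho> :: "(real \<Rightarrow> ennreal) \<Rightarrow> ennreal"
  assumes bfn: "banach_function_norm \<rho>"
begin

lemma rho_eq_0_iff:
  "f \<in> borel_measurable lebesgue \<Longrightarrow> \<rho> f = 0 \<longleftrightarrow> (AE x in lebesgue. f x = 0)"
  using bfn unfolding banach_function_norm_def by blast

lemma rho_scale:
  "f \<in> borel_measurable lebesgue \<Longrightarrow> c \<ge> 0 \<Longrightarrow> \<rho> (\<lambda>x. ennreal c * f x) = ennreal c * \<rho> f"
  using bfn unfolding banach_function_norm_def by blast

lemma rho_add:
  "f \<in> borel_measurable lebesgue \<Longrightarrow> g \<in> borel_measurable lebesgue \<Longrightarrow>
    \<rho> (\<lambda>x. f x + g x) \<le> \<rho> f + \<rho> g"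
  using bfn unfolding banach_function_norm_def by blast

lemma rho_mono:
  "f \<in> borel_measurable lebesgue \<Longrightarrow> g \<in> borel_measurable lebesgue \<Longrightarrow>
    AE x in lebesgue. g x \<le> f x \<Longrightarrow> \<rho> g \<le> \<rho> f"
  using bfn unfolding banach_function_norm_def by blast

lemma rho_indicator:
  "E \<in> sets lebesgue \<Longrightarrow> emeasure lebesgue E < \<infinity> \<Longrightarrow> \<rho> (indicator E) < \<infinity>"
  using bfn unfolding banach_function_norm_def by blast

text \<open>The constant in the axiom is any real number, truncated at 0 by \<open>ennreal\<close>.
  A nonnegative one is needed to move it into products of reals.\<close>

lemma rho_local_integral:
  assumes "E \<in> sets lebesgue" "emeasure lebesgue E < \<infinity>"
  obtains C where "C \<ge> 0" "\<And>f. f \<in> borel_measurable lebesgue \<Longrightarrow>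
    (\<integral>\<^sup>+x. f x * indicator E x \<partial>lebesgue) \<le> ennreal C * \<rho> f"
proof -
  have "\<forall>E \<in> sets lebesgue. emeasure lebesgue E < \<infinity> \<longrightarrow> \<rho> (indicator E) < \<infinity> \<and>
      (\<exists>C::real. \<forall>f \<in> borel_measurable lebesgue.
        (\<integral>\<^sup>+x. f x * indicator E x \<partial>lebesgue) \<le> ennreal C * \<rho> f)"
    using bfn unfolding banach_function_norm_def by (elim conjE)
  then obtain C where C: "\<forall>f \<in> borel_measurable lebesgue.
      (\<integral>\<^sup>+x. f x * indicator E x \<partial>lebesgue) \<le> ennreal C * \<rho> f"
    using assms by auto
  have "ennreal C * \<rho> f \<le> ennreal (max C 0) * \<rho> f" for f
    by (intro mult_right_mono ennreal_leI) auto
  with C show ?thesis by (intro that[of "max C 0"]) (auto intro: order_trans)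
qed

abbreviation X where "X \<equiv> bfs \<rho>"
abbreviation nrm where "nrm \<equiv> normX \<rho>"

lemma bfs_measurable [measurable_dest]: "f \<in> X \<Longrightarrow> f \<in> borel_measurable lebesgue"
  by (simp add: bfs_def)

lemma ennreal_normX: "f \<in> X \<Longrightarrow> ennreal (nrm f) = \<rho> (\<lambda>x. ennreal (cmod (f x)))"
  by (auto simp: bfs_def normX_def less_top intro!: ennreal_enn2real)

lemma normX_nonneg [simp]: "0 \<le> nrm f"
  by (simp add: normX_def)

lemma bfsI_rho:
  assumes "f \<in> borel_measurable lebesgue" "\<rho> (\<lambda>x. ennreal (cmod (f x))) \<le> ennreal c" "c \<ge> 0"
  shows "f \<in> X" "nrm f \<le> c"
proof -
  have "\<rho> (\<lambda>x. ennreal (cmod (f x))) < \<infinity>"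
    using assms(2) by (rule le_less_trans) simp
  then show f: "f \<in> X" using assms by (simp add: bfs_def)
  have "ennreal (nrm f) \<le> ennreal c" using assms(2) unfolding ennreal_normX[OF f] .
  then show "nrm f \<le> c" using assms(3) by (simp add: ennreal_le_iff)
qed

lemma bfs_dominated:
  assumes [measurable]: "g \<in> borel_measurable lebesgue" and f: "f \<in> X" and c: "c \<ge> 0"
    and le: "AE x in lebesgue. cmod (g x) \<le> c * cmod (f x)"
  shows "g \<in> X" "nrm g \<le> c * nrm f"
proof -
  have [measurable]: "f \<in> borel_measurable lebesgue" using f by (rule bfs_measurable)
  have "\<rho> (\<lambda>x. ennreal (cmod (g x))) \<le> \<rho> (\<lambda>x. ennreal c * ennreal (cmod (f x)))"
    using le c by (intro rho_mono) (auto simp: ennreal_mult[symmetric] intro: ennreal_leI)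
  also have "\<dots> = ennreal (c * nrm f)"
    using c by (simp add: rho_scale ennreal_normX[OF f] ennreal_mult)
  finally have *: "\<rho> (\<lambda>x. ennreal (cmod (g x))) \<le> ennreal (c * nrm f)" .
  show "g \<in> X" "nrm g \<le> c * nrm f" using bfsI_rho[OF assms(1) *] c by simp_all
qed

lemma normX_mono:
  assumes "g \<in> borel_measurable lebesgue" "f \<in> X" "AE x in lebesgue. cmod (g x) \<le> cmod (f x)"
  shows "g \<in> X" "nrm g \<le> nrm f"
  using bfs_dominated[OF assms(1,2), of 1] assms(3) by simp_all

lemma normX_cong_AE:
  assumes "f \<in> X" "AE x in lebesgue. f x = g x"
  shows "g \<in> X" "nrm g = nrm f"
proof -
  have g: "g \<in> borel_measurable lebesgue"
    using borel_measurable_AE[OF bfs_measurable[OF assms(1)] assms(2)] .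
  have "AE x in lebesgue. cmod (g x) \<le> cmod (f x)" "AE x in lebesgue. cmod (f x) \<le> cmod (g x)"
    using assms(2) by auto
  with normX_mono[OF g assms(1)] normX_mono[OF bfs_measurable[OF assms(1)]]
  show "g \<in> X" "nrm g = nrm f" by (blast, meson order_antisym)
qed

lemma zero_bfs [simp]: "(\<lambda>x. 0) \<in> X"
  using rho_eq_0_iff[of "\<lambda>x. 0"] by (simp add: bfs_def)

lemma normX_zero [simp]: "nrm (\<lambda>x. 0) = 0"
  using rho_eq_0_iff[of "\<lambda>x. 0"] by (simp add: normX_def)

lemma normX_triangle:
  assumes f: "f \<in> X" and g: "g \<in> X"
  shows "(\<lambda>x. f x + g x) \<in> X" "nrm (\<lambda>x. f x + g x) \<le> nrm f + nrm g"
proof -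
  have [measurable]: "f \<in> borel_measurable lebesgue" "g \<in> borel_measurable lebesgue"
    using f g by (auto dest: bfs_measurable)
  have "\<rho> (\<lambda>x. ennreal (cmod (f x + g x))) \<le> \<rho> (\<lambda>x. ennreal (cmod (f x)) + ennreal (cmod (g x)))"
    by (intro rho_mono) (auto simp: ennreal_plus[symmetric] norm_triangle_ineq simp del: ennreal_plus)
  also have "\<dots> \<le> ennreal (nrm f + nrm g)"
    using f g by (simp add: ennreal_normX rho_add)
  finally have *: "\<rho> (\<lambda>x. ennreal (cmod (f x + g x))) \<le> ennreal (nrm f + nrm g)" .
  show "(\<lambda>x. f x + g x) \<in> X" "nrm (\<lambda>x. f x + g x) \<le> nrm f + nrm g"
    using bfsI_rho[OF _ *] by simp_all
qed

lemma scale_bfs [simp]: "f \<in> X \<Longrightarrow> (\<lambda>x. c * f x) \<in> X"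
  by (rule bfs_dominated(1)[of _ f "cmod c"]) (auto simp: norm_mult dest: bfs_measurable)

lemma normX_scale:
  assumes f: "f \<in> X"
  shows "nrm (\<lambda>x. c * f x) = cmod c * nrm f"
proof -
  have [measurable]: "f \<in> borel_measurable lebesgue" using f by (rule bfs_measurable)
  have "(\<lambda>x. ennreal (cmod (c * f x))) = (\<lambda>x. ennreal (cmod c) * ennreal (cmod (f x)))"
    by (simp add: norm_mult ennreal_mult)
  then show ?thesis by (simp add: normX_def rho_scale enn2real_mult)
qed

sublocale X: function_space "bfs \<rho>"
  by unfold_locales (auto intro: normX_triangle(1))

lemma diff_bfs: "f \<in> X \<Longrightarrow> g \<in> X \<Longrightarrow> (\<lambda>x. f x - g x) \<in> X"
  using X.lin_mem[of f g "-1"] by simp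

lemma normX_minus_commute: "f \<in> X \<Longrightarrow> g \<in> X \<Longrightarrow> nrm (\<lambda>x. f x - g x) = nrm (\<lambda>x. g x - f x)"
  by (simp add: normX_def norm_minus_commute)

lemma normX_triangle_diff:
  assumes "f \<in> X" "g \<in> X" "h \<in> X"
  shows "nrm (\<lambda>x. f x - h x) \<le> nrm (\<lambda>x. f x - g x) + nrm (\<lambda>x. g x - h x)"
  using normX_triangle(2)[OF diff_bfs[OF assms(1,2)] diff_bfs[OF assms(2,3)]] by simp

lemma sum_bfs:
  assumes "finite I" "\<And>i. i \<in> I \<Longrightarrow> f i \<in> X"
  shows "(\<lambda>x. \<Sum>i\<in>I. f i x) \<in> X"
  using assms by (induction I rule: finite_induct) (auto intro: normX_triangle(1))

lemma normX_eq_0_AE: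
  assumes f: "f \<in> X" "nrm f = 0"
  shows "AE x in lebesgue. f x = 0"
proof -
  have [measurable]: "f \<in> borel_measurable lebesgue" using f by (auto dest: bfs_measurable)
  have "\<rho> (\<lambda>x. ennreal (cmod (f x))) = 0" using ennreal_normX[OF f(1)] f(2) by simp
  then show ?thesis by (subst (asm) rho_eq_0_iff) (auto simp: ennreal_eq_0_iff)
qed

lemma indicator_bfs:
  assumes "E \<in> sets lebesgue" "emeasure lebesgue E < \<infinity>"
  shows "(indicator E :: real \<Rightarrow> complex) \<in> X"
proof -
  have "(\<lambda>x. ennreal (cmod (indicator E x))) = indicator E" by (auto simp: indicator_def)
  then show ?thesis using rho_indicator[OF assms] assms by (simp add: bfs_def)
qed

lemma bounded_support_bfs:
  assumes "E \<in> sets lebesgue" "emeasure lebesgue E < \<infinity>" "g \<in> borel_measurable lebesgue" "c \<ge> 0"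
    and "AE x in lebesgue. cmod (g x) \<le> c * indicator E x"
  shows "g \<in> X" "nrm g \<le> c * nrm (indicator E)"
proof -
  have eq: "cmod (indicator E x) = indicator E x" for x by (auto simp: indicator_def)
  show "g \<in> X" "nrm g \<le> c * nrm (indicator E)"
    using bfs_dominated[OF assms(3) indicator_bfs[OF assms(1,2)] assms(4)] assms(5) by (auto simp: eq)
qed

lemma local_integral:
  assumes "E \<in> sets lebesgue" "emeasure lebesgue E < \<infinity>"
  obtains C where "C \<ge> 0"
    "\<And>f. f \<in> X \<Longrightarrow> (\<integral>\<^sup>+x. ennreal (cmod (f x)) * indicator E x \<partial>lebesgue) \<le> ennreal (C * nrm f)"
proof -
  obtain C where C: "C \<ge> 0" "\<And>f. f \<in> borel_measurable lebesgue \<Longrightarrow>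
    (\<integral>\<^sup>+x. f x * indicator E x \<partial>lebesgue) \<le> ennreal C * \<rho> f"
    using rho_local_integral[OF assms] by blast
  show ?thesis
  proof (rule that[OF C(1)])
    fix f assume f: "f \<in> X"
    then have [measurable]: "f \<in> borel_measurable lebesgue" by (rule bfs_measurable)
    have "(\<integral>\<^sup>+x. ennreal (cmod (f x)) * indicator E x \<partial>lebesgue) \<le> ennreal C * \<rho> (\<lambda>x. ennreal (cmod (f x)))"
      by (rule C(2)) measurable
    also have "\<dots> = ennreal (C * nrm f)"
      using C(1) by (simp add: ennreal_normX[OF f, symmetric] ennreal_mult)
    finally show "(\<integral>\<^sup>+x. ennreal (cmod (f x)) * indicator E x \<partial>lebesgue) \<le> ennreal (C * nrm f)" .
  qed
qed

text \<open>Bilinear, without conjugation, and with the kernel first so that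
  \<open>pairing h\<close> is the functional. Where the product is not integrable the value is 0 by
  convention.\<close>

definition pairing :: "(real \<Rightarrow> complex) \<Rightarrow> (real \<Rightarrow> complex) \<Rightarrow> complex" where
  "pairing h = (\<lambda>f. \<integral>x. f x * h x \<partial>lebesgue)"

text \<open>The constant depends on E alone. Uniformity in h matters later, when the kernel is a
  Gaussian section that varies with the point x.\<close>

lemma pairing_bound:
  assumes E: "E \<in> sets lebesgue" "emeasure lebesgue E < \<infinity>"
  obtains C where "C \<ge> 0"
    "\<And>f h c. f \<in> X \<Longrightarrow> h \<in> borel_measurable lebesgue \<Longrightarrow> c \<ge> 0 \<Longrightarrow>
       (\<And>x. cmod (h x) \<le> c * indicator E x) \<Longrightarrow>
       integrable lebesgue (\<lambda>x. f x * h x) \<and> cmod (pairing h f) \<le> c * C * nrm f"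
proof -
  obtain C where C: "C \<ge> 0"
    "\<And>f. f \<in> X \<Longrightarrow> (\<integral>\<^sup>+x. ennreal (cmod (f x)) * indicator E x \<partial>lebesgue) \<le> ennreal (C * nrm f)"
    using local_integral[OF E] by blast
  show ?thesis
  proof (rule that[OF C(1)])
    fix f h and c :: real assume f: "f \<in> X" and h[measurable]: "h \<in> borel_measurable lebesgue"
      and c: "c \<ge> 0" and le: "\<And>x. cmod (h x) \<le> c * indicator E x"
    have [measurable]: "f \<in> borel_measurable lebesgue" using f by (rule bfs_measurable)
    note E(1)[measurable]
    have "(\<integral>\<^sup>+x. ennreal (cmod (f x * h x)) \<partial>lebesgue)
      \<le> (\<integral>\<^sup>+x. ennreal c * (ennreal (cmod (f x)) * indicator E x) \<partial>lebesgue)"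
    proof (rule nn_integral_mono)
      fix x
      have "cmod (f x * h x) \<le> c * (cmod (f x) * indicator E x)"
        using mult_left_mono[OF le[of x], of "cmod (f x)"] by (simp add: norm_mult mult_ac)
      then have "ennreal (cmod (f x * h x)) \<le> ennreal (c * (cmod (f x) * indicator E x))"
        by (rule ennreal_leI)
      also have "\<dots> = ennreal c * (ennreal (cmod (f x)) * indicator E x)"
        using c by (auto simp: indicator_def ennreal_mult)
      finally show "ennreal (cmod (f x * h x)) \<le> ennreal c * (ennreal (cmod (f x)) * indicator E x)" .
    qed
    also have "\<dots> = ennreal c * (\<integral>\<^sup>+x. ennreal (cmod (f x)) * indicator E x \<partial>lebesgue)"
      by (rule nn_integral_cmult) measurable
    also have "\<dots> \<le> ennreal c * ennreal (C * nrm f)"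
      by (rule mult_left_mono[OF C(2)[OF f]]) simp
    also have "\<dots> = ennreal (c * C * nrm f)" using c C(1) by (simp add: ennreal_mult mult.assoc)
    finally have *: "(\<integral>\<^sup>+x. ennreal (cmod (f x * h x)) \<partial>lebesgue) \<le> ennreal (c * C * nrm f)" .
    then have int: "integrable lebesgue (\<lambda>x. f x * h x)"
      by (intro integrableI_bounded) (auto intro: le_less_trans)
    have "ennreal (cmod (pairing h f)) \<le> ennreal (c * C * nrm f)"
      unfolding pairing_def using order_trans[OF integral_norm_bound_ennreal[OF int] *] by simp
    then show "integrable lebesgue (\<lambda>x. f x * h x) \<and> cmod (pairing h f) \<le> c * C * nrm f"
      using int c C(1) by simp
  qed
qed

lemma pairing_dual:
  assumes E: "E \<in> sets lebesgue" "emeasure lebesgue E < \<infinity>"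
    and h: "h \<in> borel_measurable lebesgue" "\<And>x. cmod (h x) \<le> c * indicator E x"
  shows "pairing h \<in> dual_space \<rho>"
proof -
  obtain C where C: "C \<ge> 0"
    "\<And>f h c. f \<in> X \<Longrightarrow> h \<in> borel_measurable lebesgue \<Longrightarrow> c \<ge> 0 \<Longrightarrow>
       (\<And>x. cmod (h x) \<le> c * indicator E x) \<Longrightarrow>
       integrable lebesgue (\<lambda>x. f x * h x) \<and> cmod (pairing h f) \<le> c * C * nrm f"
    using pairing_bound[OF E] by blast
  have "cmod (h x) \<le> \<bar>c\<bar> * indicator E x" for x
    using h(2)[of x] by (auto simp: indicator_def split: if_splits)
  then have int: "integrable lebesgue (\<lambda>x. f x * h x)" "cmod (pairing h f) \<le> \<bar>c\<bar> * C * nrm f" if "f \<in> X" for f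
    using C(2)[OF that h(1), of "\<bar>c\<bar>"] by auto
  show ?thesis
    unfolding dual_space_def
  proof (intro CollectI conjI ballI allI impI exI)
    fix f g d assume fg: "f \<in> X" "g \<in> X"
    show "pairing h (\<lambda>x. f x + d * g x) = pairing h f + d * pairing h g"
      using int(1)[OF fg(1)] int(1)[OF fg(2)] by (simp add: pairing_def ring_distribs mult.assoc)
  next
    fix f g assume fg: "f \<in> X" "g \<in> X" and eq: "AE x in lebesgue. f x = g x"
    show "pairing h f = pairing h g"
      unfolding pairing_def using fg eq h(1)
      by (intro integral_cong_AE) (auto intro!: borel_measurable_times dest: bfs_measurable)
  qed (use int(2) in auto)
qed

lemma dual_lin: "\<phi> \<in> dual_space \<rho> \<Longrightarrow> f \<in> X \<Longrightarrow> g \<in> X \<Longrightarrow> \<phi> (\<lambda>x. f x + c * g x) = \<phi> f + c * \<phi> g"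
  unfolding dual_space_def by blast

lemma dual_cong: "\<phi> \<in> dual_space \<rho> \<Longrightarrow> f \<in> X \<Longrightarrow> g \<in> X \<Longrightarrow> AE x in lebesgue. f x = g x \<Longrightarrow> \<phi> f = \<phi> g"
  unfolding dual_space_def by blast

lemma dual_add: "\<phi> \<in> dual_space \<rho> \<Longrightarrow> f \<in> X \<Longrightarrow> g \<in> X \<Longrightarrow> \<phi> (\<lambda>x. f x + g x) = \<phi> f + \<phi> g"
  using dual_lin[of \<phi> f g 1] by simp

lemma dual_diff: "\<phi> \<in> dual_space \<rho> \<Longrightarrow> f \<in> X \<Longrightarrow> g \<in> X \<Longrightarrow> \<phi> (\<lambda>x. f x - g x) = \<phi> f - \<phi> g"
  using dual_lin[of \<phi> f g "-1"] by simp

lemma dual_zero: "\<phi> \<in> dual_space \<rho> \<Longrightarrow> \<phi> (\<lambda>x. 0) = 0"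
  using dual_diff[of \<phi> "\<lambda>x. 0" "\<lambda>x. 0"] by simp

lemma dual_scale: "\<phi> \<in> dual_space \<rho> \<Longrightarrow> f \<in> X \<Longrightarrow> \<phi> (\<lambda>x. c * f x) = c * \<phi> f"
  using dual_lin[of \<phi> "\<lambda>x. 0" f c] by (simp add: dual_zero)

lemma dual_sum:
  assumes "\<phi> \<in> dual_space \<rho>" "finite I" "\<And>i. i \<in> I \<Longrightarrow> f i \<in> X"
  shows "\<phi> (\<lambda>x. \<Sum>i\<in>I. f i x) = (\<Sum>i\<in>I. \<phi> (f i))"
  using assms(2,3)
proof (induction I rule: finite_induct)
  case (insert i I)
  then show ?case using dual_add[OF assms(1), of "f i" "\<lambda>x. \<Sum>i\<in>I. f i x"] by (simp add: sum_bfs)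
qed (simp add: dual_zero[OF assms(1)])

lemma dual_bdd:
  assumes "\<phi> \<in> dual_space \<rho>"
  shows "bdd_above {cmod (\<phi> f) | f. f \<in> X \<and> nrm f \<le> 1}"
proof -
  obtain C where C: "\<forall>f\<in>X. cmod (\<phi> f) \<le> C * nrm f" using assms unfolding dual_space_def by blast
  show ?thesis
  proof (rule bdd_aboveI)
    fix y assume "y \<in> {cmod (\<phi> f) | f. f \<in> X \<and> nrm f \<le> 1}"
    then obtain f where f: "f \<in> X" "nrm f \<le> 1" "y = cmod (\<phi> f)" by auto
    have "y \<le> C * nrm f" using C f by auto
    also have "\<dots> \<le> \<bar>C\<bar> * 1" by (intro mult_mono) (auto simp: f)
    finally show "y \<le> \<bar>C\<bar>" by simp
  qed
qed

lemma dual_norm_nonneg: "\<phi> \<in> dual_space \<rho> \<Longrightarrow> 0 \<le> dual_norm \<rho> \<phi>"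
  unfolding dual_norm_def
  by (rule order_trans[OF norm_ge_zero[of "\<phi> (\<lambda>x. 0)"]], rule cSup_upper[OF _ dual_bdd])
     (auto intro!: exI[of _ "\<lambda>x. 0"])

lemma dual_norm_bound:
  assumes \<phi>: "\<phi> \<in> dual_space \<rho>" and f: "f \<in> X"
  shows "cmod (\<phi> f) \<le> dual_norm \<rho> \<phi> * nrm f"
proof (cases "nrm f = 0")
  case True
  then have "AE x in lebesgue. f x = 0" using normX_eq_0_AE f by blast
  then have "\<phi> f = \<phi> (\<lambda>x. 0)" by (intro dual_cong[OF \<phi> f]) auto
  then show ?thesis using True dual_zero[OF \<phi>] by simp
next
  case False
  then have pos: "0 < nrm f" using normX_nonneg[of f] by linarith
  let ?g = "\<lambda>x. complex_of_real (1 / nrm f) * f x"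
  have "nrm ?g = 1" using normX_scale[OF f, of "complex_of_real (1 / nrm f)"] False by (simp add: norm_divide)
  then have "cmod (\<phi> ?g) \<le> dual_norm \<rho> \<phi>"
    unfolding dual_norm_def using scale_bfs[OF f, of "complex_of_real (1 / nrm f)"]
    by (intro cSup_upper[OF _ dual_bdd[OF \<phi>]] CollectI exI[of _ ?g]) auto
  then show ?thesis
    using False dual_scale[OF \<phi> f, of "complex_of_real (1 / nrm f)"]
    by (simp add: norm_mult norm_divide pos_divide_le_eq pos)
qed

lemma dual_norm_le:
  assumes "\<And>f. f \<in> X \<Longrightarrow> cmod (\<phi> f) \<le> C * nrm f" "C \<ge> 0"
  shows "dual_norm \<rho> \<phi> \<le> C"
  unfolding dual_norm_def
proof (rule cSup_least)
  show "{cmod (\<phi> f) |f. f \<in> X \<and> nrm f \<le> 1} \<noteq> {}"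
    by (auto intro!: exI[of _ "\<lambda>x. 0"])
  fix y assume "y \<in> {cmod (\<phi> f) |f. f \<in> X \<and> nrm f \<le> 1}"
  then obtain f where f: "f \<in> X" "nrm f \<le> 1" "y = cmod (\<phi> f)" by auto
  have "y \<le> C * nrm f" using assms f by auto
  also have "\<dots> \<le> C * 1" using assms f by (intro mult_left_mono) auto
  finally show "y \<le> C" by simp
qed

text \<open>Makes \<open>hahn_banach\<close> available on the dual, with functionals as vectors and
  functions as indices; this produces elements of the bidual.\<close>

sublocale X': function_space "dual_space \<rho>"
proof
  show "(\<lambda>f. 0) \<in> dual_space \<rho>" by (auto simp: dual_space_def intro!: exI[of _ 0])
  fix \<phi> \<psi> c assume p: "\<phi> \<in> dual_space \<rho>" "\<psi> \<in> dual_space \<rho>"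
  show "(\<lambda>f. \<phi> f + c * \<psi> f) \<in> dual_space \<rho>"
    unfolding dual_space_def
  proof (intro CollectI conjI ballI allI impI exI)
    fix f g d assume fg: "f \<in> X" "g \<in> X"
    show "\<phi> (\<lambda>x. f x + d * g x) + c * \<psi> (\<lambda>x. f x + d * g x) = \<phi> f + c * \<psi> f + d * (\<phi> g + c * \<psi> g)"
      using dual_lin[OF p(1) fg] dual_lin[OF p(2) fg] by (simp add: algebra_simps)
  next
    fix f g assume "f \<in> X" "g \<in> X" "AE x in lebesgue. f x = g x"
    with dual_cong[OF p(1)] dual_cong[OF p(2)]
    have "\<phi> f = \<phi> g" "\<psi> f = \<psi> g" by blast+
    then show "\<phi> f + c * \<psi> f = \<phi> g + c * \<psi> g" by simp
  next
    fix f assume f: "f \<in> X"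
    have "cmod (\<phi> f + c * \<psi> f) \<le> cmod (\<phi> f) + cmod c * cmod (\<psi> f)"
      by (metis norm_mult norm_triangle_ineq)
    also have "\<dots> \<le> dual_norm \<rho> \<phi> * nrm f + cmod c * (dual_norm \<rho> \<psi> * nrm f)"
      by (intro add_mono mult_left_mono dual_norm_bound p f) simp
    finally show "cmod (\<phi> f + c * \<psi> f) \<le> (dual_norm \<rho> \<phi> + cmod c * dual_norm \<rho> \<psi>) * nrm f"
      by (simp add: algebra_simps)
  qed
qed

end

section \<open>Reflexivity, absolute continuity and density\<close>

text \<open>Compact support is expressed by a multiple of an indicator as majorant, the form in
  which the pairing bounds and the dominated convergence results take their hypotheses.\<close>

definition C_comp :: "(real \<Rightarrow> complex) set" where
  "C_comp = {g. continuous_on UNIV g \<and> (\<exists>c\<ge>0. \<exists>R. \<forall>x. cmod (g x) \<le> c * indicator {-R..R} x)}"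

lemma continuous_imp_lebesgue_measurable:
  fixes g :: "real \<Rightarrow> complex"
  shows "continuous_on UNIV g \<Longrightarrow> g \<in> borel_measurable lebesgue"
  by (rule measurable_completion) (simp add: borel_measurable_continuous_onI)

lemma C_compI:
  "continuous_on UNIV g \<Longrightarrow> c \<ge> 0 \<Longrightarrow> (\<And>x. cmod (g x) \<le> c * indicator {-R..R} x) \<Longrightarrow> g \<in> C_comp"
  unfolding C_comp_def by blast

lemma C_comp_lin:
  assumes "f \<in> C_comp" "g \<in> C_comp"
  shows "(\<lambda>x. f x + c * g x) \<in> C_comp"
proof -
  obtain d1 R1 where 1: "d1 \<ge> 0" "\<And>x. cmod (f x) \<le> d1 * indicator {-R1..R1} x" "continuous_on UNIV f"
    using assms(1) by (auto simp: C_comp_def)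
  obtain d2 R2 where 2: "d2 \<ge> 0" "\<And>x. cmod (g x) \<le> d2 * indicator {-R2..R2} x" "continuous_on UNIV g"
    using assms(2) by (auto simp: C_comp_def)
  have "cmod (f x + c * g x) \<le> (d1 + cmod c * d2) * indicator {- max R1 R2..max R1 R2} x" for x
  proof -
    have "cmod (f x + c * g x) \<le> d1 * indicator {-R1..R1} x + cmod c * (d2 * indicator {-R2..R2} x)"
      by (rule order_trans[OF norm_triangle_ineq])
         (auto simp: norm_mult intro!: add_mono mult_left_mono 1 2)
    also have "\<dots> \<le> d1 * indicator {- max R1 R2..max R1 R2} x + cmod c * (d2 * indicator {- max R1 R2..max R1 R2} x)"
      by (intro add_mono mult_left_mono 1 2) (auto simp: indicator_def)
    finally show ?thesis by (simp add: algebra_simps)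
  qed
  then show ?thesis
    using 1 2 by (intro C_compI[of _ "d1 + cmod c * d2" "max R1 R2"]) (auto intro!: continuous_intros)
qed

lemma zero_C_comp: "(\<lambda>x. 0) \<in> C_comp"
  by (rule C_compI[of _ 0]) auto

text \<open>Lebesgue's definition of measurability by almost everywhere limits of continuous functions,
  followed by the nearest-point projection onto the disc of radius \<open>c\<close> and a trapezoidal cutoff.\<close>

lemma continuous_approximation:
  assumes h: "h \<in> borel_measurable lebesgue" and c: "c \<ge> 0"
    and le: "\<And>x. cmod (h x) \<le> c * indicator {-R..R} x"
  obtains H :: "nat \<Rightarrow> real \<Rightarrow> complex"
  where "\<And>n. continuous_on UNIV (H n)"
    "\<And>n x. cmod (H n x) \<le> c * indicator {-(R+1)..R+1} x"
    "AE x in lebesgue. (\<lambda>n. H n x) \<longlonglongrightarrow> h x"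
proof -
  obtain N g where N: "negligible N" and g: "\<And>n. continuous_on UNIV (g n)"
    "\<And>x. x \<notin> N \<Longrightarrow> (\<lambda>n. g n x :: complex) \<longlonglongrightarrow> h x"
    using lebesgue_measurable_imp_measurable_on[OF h, of UNIV]
    by (auto simp: measurable_on_def)
  let ?B = "cball 0 c :: complex set"
  let ?P = "closest_point ?B"
  define k where "k x = complex_of_real (max 0 (min 1 (R + 1 - \<bar>x\<bar>)))" for x
  define H where "H n x = k x * ?P (g n x)" for n x
  have P: "continuous_on UNIV ?P" by (rule continuous_on_closest_point) (use c in auto)
  have PB: "cmod (?P z) \<le> c" for z
    using closest_point_in_set[of ?B z] c by auto
  show ?thesis
  proof
    show "continuous_on UNIV (H n)" for n
      unfolding H_def k_def
      by (intro continuous_intros continuous_on_compose2[OF P g(1)]) auto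
    fix n x
    have "cmod (H n x) \<le> 1 * c" if "\<bar>x\<bar> \<le> R + 1"
      unfolding H_def norm_mult using PB c by (intro mult_mono) (auto simp: k_def)
    moreover have "H n x = 0" if "\<not> \<bar>x\<bar> \<le> R + 1" using that by (simp add: H_def k_def)
    ultimately show "cmod (H n x) \<le> c * indicator {-(R+1)..R+1} x"
      by (auto simp: indicator_def abs_le_iff)
  next
    have "(\<lambda>n. H n x) \<longlonglongrightarrow> h x" if x: "x \<notin> N" for x
    proof -
      have "(\<lambda>n. ?P (g n x)) \<longlonglongrightarrow> ?P (h x)"
        using P by (intro isCont_tendsto_compose[OF _ g(2)[OF x]]) (simp add: continuous_on_eq_continuous_at)
      moreover have "?P (h x) = h x"
        using le[of x] c by (intro closest_point_self) (auto simp: indicator_def of_bool_def split: if_splits)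
      ultimately have "(\<lambda>n. H n x) \<longlonglongrightarrow> k x * h x"
        unfolding H_def by (auto intro!: tendsto_intros)
      moreover have "k x * h x = h x"
      proof (cases "x \<in> {-R..R}")
        case True then show ?thesis by (auto simp: k_def min_def max_def)
      next
        case False then show ?thesis using le[of x] by simp
      qed
      ultimately show ?thesis by simp
    qed
    then show "AE x in lebesgue. (\<lambda>n. H n x) \<longlonglongrightarrow> h x"
      using N by (intro AE_I'[of N]) (auto simp: negligible_iff_null_sets)
  qed
qed

lemma lebesgue_measurable_ident: "(\<lambda>x::real. x) \<in> borel_measurable lebesgue"
  by (rule measurable_completion) simp

text \<open>The conjugate sign of g, cut off to [-n, n], is an admissible test function and turns
  the integral into that of |g|. No norm enters, because the lemma is applied both to elements of
  the function space and to elements of \<open>L2\<close>.\<close>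

lemma orthogonal_imp_AE_zero:
  fixes g :: "real \<Rightarrow> complex"
  assumes g[measurable]: "g \<in> borel_measurable lebesgue"
    and zero: "\<And>h R. h \<in> borel_measurable lebesgue \<Longrightarrow> (\<And>x. cmod (h x) \<le> indicator {-R..R} x) \<Longrightarrow>
      integrable lebesgue (\<lambda>x. g x * h x) \<and> (\<integral>x. g x * h x \<partial>lebesgue) = 0"
  shows "AE x in lebesgue. g x = 0"
proof -
  have "AE x in lebesgue. x \<in> {-real n..real n} \<longrightarrow> g x = 0" for n
  proof -
    \<comment> \<open>Division by zero yields 0, so h vanishes where g does and the bound by 1 holds
      everywhere.\<close>
    define h where "h x = indicator {-real n..real n} x * cnj (g x) / complex_of_real (cmod (g x))" for x
    have h[measurable]: "h \<in> borel_measurable lebesgue"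
    proof -
      have "cnj \<in> borel_measurable borel" "complex_of_real \<in> borel_measurable borel"
        by (intro borel_measurable_continuous_onI continuous_intros)+
      from measurable_compose[OF _ this(1), of g lebesgue]
        measurable_compose[OF _ this(2), of "\<lambda>x. cmod (g x)" lebesgue]
      have "(\<lambda>x. cnj (g x)) \<in> borel_measurable lebesgue" "(\<lambda>x. complex_of_real (cmod (g x))) \<in> borel_measurable lebesgue"
        by simp_all
      then show ?thesis
        unfolding h_def by (intro borel_measurable_times borel_measurable_divide borel_measurable_indicator) simp_all
    qed
    have hle: "cmod (h x) \<le> 1 * indicator {-real n..real n} x" for x
      by (auto simp: h_def indicator_def norm_mult norm_divide)
    have C: "integrable lebesgue (\<lambda>x. g x * h x)"
      by (rule zero[OF h, of "real n", THEN conjunct1]) (use hle in simp)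
    have eq: "g x * h x = complex_of_real (cmod (g x) * indicator {-real n..real n} x)" for x
      by (cases "g x = 0") (auto simp: h_def indicator_def complex_norm_square[symmetric] power2_eq_square field_simps)
    have int: "integrable lebesgue (\<lambda>x. cmod (g x) * indicator {-real n..real n} x)"
      using C unfolding eq by (simp only: complex_of_real_integrable_eq)
    have "(\<integral>x. g x * h x \<partial>lebesgue) = complex_of_real (\<integral>x. cmod (g x) * indicator {-real n..real n} x \<partial>lebesgue)"
      unfolding eq by (rule integral_complex_of_real)
    moreover have "(\<integral>x. g x * h x \<partial>lebesgue) = 0" by (rule zero[OF h, of "real n", THEN conjunct2]) (use hle in simp)
    ultimately have "(\<integral>x. cmod (g x) * indicator {-real n..real n} x \<partial>lebesgue) = 0" by simp
    then have "AE x in lebesgue. cmod (g x) * indicator {-real n..real n} x = 0"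
      using integral_nonneg_eq_0_iff_AE[OF int] by simp
    then show ?thesis by eventually_elim (auto simp: indicator_def of_bool_def split: if_splits)
  qed
  then have "AE x in lebesgue. \<forall>n. x \<in> {-real n..real n} \<longrightarrow> g x = 0"
    unfolding AE_all_countable by blast
  then show ?thesis
  proof eventually_elim
    case (elim x)
    obtain n where "\<bar>x\<bar> \<le> real n" using real_arch_simple by blast
    then show ?case using elim by (auto simp: abs_le_iff)
  qed
qed

context banach_function_space
begin

lemma emeasure_segment: "{-R..R::real} \<in> sets lebesgue" "emeasure lebesgue {-R..R::real} < \<infinity>"
  by (auto simp: emeasure_lborel_Icc_eq)

lemma integrable_pairing:
  assumes f: "f \<in> X" and h: "h \<in> borel_measurable lebesgue" "\<And>x. cmod (h x) \<le> c * indicator {-R..R} x"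
  shows "integrable lebesgue (\<lambda>x. f x * h x)"
proof -
  have le: "cmod (h x) \<le> \<bar>c\<bar> * indicator {-R..R} x" for x
    using h(2)[of x] by (auto simp: indicator_def of_bool_def split: if_splits)
  show ?thesis
  proof (rule pairing_bound[OF emeasure_segment, of R])
    fix C assume "\<And>f h c. f \<in> X \<Longrightarrow> h \<in> borel_measurable lebesgue \<Longrightarrow> c \<ge> 0 \<Longrightarrow>
       (\<And>x. cmod (h x) \<le> c * indicator {-R..R} x) \<Longrightarrow>
       integrable lebesgue (\<lambda>x. f x * h x) \<and> cmod (pairing h f) \<le> c * C * nrm f"
    from this[OF f h(1) abs_ge_zero le] show ?thesis by (rule conjunct1)
  qed
qed

lemma C_comp_bfs: "g \<in> C_comp \<Longrightarrow> g \<in> X"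
  by (auto simp: C_comp_def intro!: bounded_support_bfs(1)[OF emeasure_segment] continuous_imp_lebesgue_measurable)

lemma C_comp_dual:
  assumes "g \<in> C_comp" shows "pairing g \<in> dual_space \<rho>"
proof -
  obtain c R where *: "\<And>x. cmod (g x) \<le> c * indicator {-R..R} x" "continuous_on UNIV g"
    using assms by (auto simp: C_comp_def)
  show ?thesis
    by (rule pairing_dual[OF emeasure_segment continuous_imp_lebesgue_measurable[OF *(2)] *(1)])
qed

lemma pairing_zero_imp_AE_zero:
  assumes g: "g \<in> X"
    and zero: "\<And>h R. h \<in> borel_measurable lebesgue \<Longrightarrow> (\<And>x. cmod (h x) \<le> indicator {-R..R} x) \<Longrightarrow> pairing h g = 0"
  shows "AE x in lebesgue. g x = 0"
proof (rule orthogonal_imp_AE_zero[OF bfs_measurable[OF g]])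
  fix h :: "real \<Rightarrow> complex" and R :: real
  assume h: "h \<in> borel_measurable lebesgue" "\<And>x. cmod (h x) \<le> indicator {-R..R} x"
  have "integrable lebesgue (\<lambda>x. g x * h x)"
    by (rule integrable_pairing[OF g h(1), of 1 R]) (use h(2) in simp)
  then show "integrable lebesgue (\<lambda>x. g x * h x) \<and> (\<integral>x. g x * h x \<partial>lebesgue) = 0"
    using zero[OF h] by (simp add: pairing_def)
qed

lemma restrict_bfs:
  assumes "f \<in> X" "A \<in> sets lebesgue"
  shows "(\<lambda>x. indicator A x * f x) \<in> X" "nrm (\<lambda>x. indicator A x * f x) \<le> nrm f"
proof -
  have [measurable]: "f \<in> borel_measurable lebesgue" "A \<in> sets lebesgue"
    using assms by (auto dest: bfs_measurable)
  have m: "(\<lambda>x. indicator A x * f x) \<in> borel_measurable lebesgue" by measurable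
  have "AE x in lebesgue. cmod (indicator A x * f x) \<le> cmod (f x)" by (auto simp: indicator_def)
  with normX_mono[OF m assms(1)] show "(\<lambda>x. indicator A x * f x) \<in> X" "nrm (\<lambda>x. indicator A x * f x) \<le> nrm f"
    by auto
qed

end

locale reflexive_banach_function_space = banach_function_space +
  assumes refl: "reflexive_bfs \<rho>"
begin

lemma reflexive_representation:
  assumes "\<And>\<phi> \<psi> c. \<phi> \<in> dual_space \<rho> \<Longrightarrow> \<psi> \<in> dual_space \<rho> \<Longrightarrow> \<Phi> (\<lambda>f. \<phi> f + c * \<psi> f) = \<Phi> \<phi> + c * \<Phi> \<psi>"
    and "\<And>\<phi>. \<phi> \<in> dual_space \<rho> \<Longrightarrow> cmod (\<Phi> \<phi>) \<le> C * dual_norm \<rho> \<phi>"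
  obtains f where "f \<in> X" "\<And>\<phi>. \<phi> \<in> dual_space \<rho> \<Longrightarrow> \<Phi> \<phi> = \<phi> f"
proof -
  have "\<exists>f \<in> X. \<forall>\<phi> \<in> dual_space \<rho>. \<Phi> \<phi> = \<phi> f"
    using refl[unfolded reflexive_bfs_def, rule_format, of \<Phi>] assms by blast
  then show ?thesis using that by blast
qed

section \<open>Absolute continuity of the norm\<close>

context
  fixes E :: "nat \<Rightarrow> real set" and f :: "real \<Rightarrow> complex"
  assumes dec: "decseq E" and meas: "\<And>n. E n \<in> sets lebesgue" and f: "f \<in> X"
begin

text \<open>Unimodular factors \<open>c i\<close> turn a partial sum of the moduli into the value of
  \<psi> at one function. The sets E i - E (i + 1) are disjoint, so this function is dominated by
  |f|, and all partial sums are at most \<open>dual_norm \<rho> \<psi> * nrm f\<close>.\<close>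

lemma restrictions_summable:
  assumes \<psi>: "\<psi> \<in> dual_space \<rho>"
  shows "summable (\<lambda>i. \<psi> (\<lambda>x. indicator (E i - E (Suc i)) x * f x))"
proof -
  let ?d = "\<lambda>i x. indicator (E i - E (Suc i)) x * f x"
  have d: "?d i \<in> X" for i using restrict_bfs[OF f] meas by auto
  define c where "c i = (if \<psi> (?d i) = 0 then 0 else cnj (\<psi> (?d i)) / complex_of_real (cmod (\<psi> (?d i))))" for i
  have c1: "c i * \<psi> (?d i) = complex_of_real (cmod (\<psi> (?d i)))" for i
    by (simp add: c_def complex_norm_square[symmetric] power2_eq_square field_simps)
  have c2: "cmod (c i) \<le> 1" for i by (simp add: c_def norm_divide)
  have tele: "(\<Sum>i<N. indicator (E i - E (Suc i)) x) \<le> (1::real)" for N x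
  proof -
    have "indicator (E i - E (Suc i)) x = (indicator (E i) x - indicator (E (Suc i)) x :: real)" for i
      using decseq_SucD[OF dec, of i] by (auto simp: indicator_def)
    then have "(\<Sum>i<N. indicator (E i - E (Suc i)) x) = (indicator (E 0) x - indicator (E N) x :: real)"
      using sum_lessThan_telescope'[of "\<lambda>i. indicator (E i) x :: real" N] by simp
    then show ?thesis by (simp add: indicator_def)
  qed
  have "(\<Sum>i<N. cmod (\<psi> (?d i))) \<le> dual_norm \<rho> \<psi> * nrm f" for N
  proof -
    let ?s = "\<lambda>x. \<Sum>i<N. c i * ?d i x"
    have sX: "?s \<in> X" by (intro sum_bfs scale_bfs d) simp
    have "cmod (?s x) \<le> cmod (f x)" for x
    proof -
      have "cmod (?s x) \<le> (\<Sum>i<N. indicator (E i - E (Suc i)) x * cmod (f x))"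
        using c2 by (intro sum_norm_le) (auto simp: norm_mult indicator_def mult_left_le_one_le)
      also have "\<dots> \<le> 1 * cmod (f x)"
        unfolding sum_distrib_right[symmetric] by (intro mult_right_mono tele) simp
      finally show ?thesis by simp
    qed
    then have "nrm ?s \<le> nrm f" by (intro normX_mono(2) f bfs_measurable sX) simp
    have "\<psi> ?s = (\<Sum>i<N. \<psi> (\<lambda>x. c i * ?d i x))"
      by (intro dual_sum[OF \<psi>] scale_bfs d) simp
    also have "\<dots> = complex_of_real (\<Sum>i<N. cmod (\<psi> (?d i)))"
      unfolding dual_scale[OF \<psi> d] c1 by (rule of_real_sum[symmetric])
    finally have "cmod (\<psi> ?s) = \<bar>\<Sum>i<N. cmod (\<psi> (?d i))\<bar>" by (simp only: norm_of_real)
    then have "(\<Sum>i<N. cmod (\<psi> (?d i))) = cmod (\<psi> ?s)"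
      by (simp only: abs_of_nonneg[OF sum_nonneg[OF norm_ge_zero]])
    also have "\<dots> \<le> dual_norm \<rho> \<psi> * nrm ?s" by (rule dual_norm_bound[OF \<psi> sX])
    also have "\<dots> \<le> dual_norm \<rho> \<psi> * nrm f"
      using \<open>nrm ?s \<le> nrm f\<close> dual_norm_nonneg[OF \<psi>] by (rule mult_left_mono)
    finally show ?thesis .
  qed
  then have "summable (\<lambda>i. cmod (\<psi> (?d i)))"
    by (intro summableI_nonneg_bounded) auto
  then show ?thesis by (rule summable_norm_cancel)
qed

text \<open>The terms of the summable series are differences of consecutive restrictions, so
  telescoping gives weak convergence against every functional. The limit exists as a functional on
  the dual before reflexivity is invoked.\<close>

lemma restrictions_convergent:
  assumes \<psi>: "\<psi> \<in> dual_space \<rho>"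
  shows "convergent (\<lambda>n. \<psi> (\<lambda>x. indicator (E n) x * f x))"
proof -
  let ?r = "\<lambda>n x. indicator (E n) x * f x"
  have r: "?r n \<in> X" for n by (rule restrict_bfs(1)[OF f meas])
  have "\<psi> (\<lambda>x. indicator (E i - E (Suc i)) x * f x) = \<psi> (?r i) - \<psi> (?r (Suc i))" for i
  proof -
    have "(\<lambda>x. indicator (E i - E (Suc i)) x * f x) = (\<lambda>x. ?r i x - ?r (Suc i) x)"
      using decseq_SucD[OF dec, of i] by (auto simp: indicator_def fun_eq_iff)
    then show ?thesis using dual_diff[OF \<psi> r r] by simp
  qed
  then have "summable (\<lambda>i. \<psi> (?r i) - \<psi> (?r (Suc i)))"
    using restrictions_summable[OF \<psi>] by simp
  then have "convergent (\<lambda>N. \<Sum>i<N. \<psi> (?r i) - \<psi> (?r (Suc i)))"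
    by (simp add: summable_iff_convergent)
  then have "convergent (\<lambda>N. \<psi> (?r 0) - (\<Sum>i<N. \<psi> (?r i) - \<psi> (?r (Suc i))))"
    by (intro convergent_diff convergent_const)
  then show ?thesis using sum_lessThan_telescope'[of "\<lambda>i. \<psi> (?r i)"] by simp
qed

text \<open>If the norms of the restrictions stayed away from 0, a Hahn--Banach functional dominated
  by the seminorm \<open>lim \<parallel>1\<^bsub>E n\<^esub> g\<parallel>\<close> would not vanish at the weak limit of \<open>1\<^bsub>E n\<^esub> f\<close>,
  which exists by reflexivity and must be 0.\<close>

lemma absolutely_continuous_norm:
  assumes null: "AE x in lebesgue. \<exists>n. x \<notin> E n"
  shows "(\<lambda>n. nrm (\<lambda>x. indicator (E n) x * f x)) \<longlonglongrightarrow> 0"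
proof -
  let ?r = "\<lambda>n g x. indicator (E n) x * g x :: complex"
  have r: "?r n g \<in> X" if "g \<in> X" for n g by (rule restrict_bfs(1)[OF that meas])
  define p where "p g = lim (\<lambda>n. nrm (?r n g))" for g
  have p: "(\<lambda>n. nrm (?r n g)) \<longlonglongrightarrow> p g" if g: "g \<in> X" for g
  proof -
    have "nrm (?r (Suc n) g) \<le> nrm (?r n g)" for n
      using decseq_SucD[OF dec, of n]
      by (intro normX_mono(2) bfs_measurable[OF r[OF g]] r[OF g]) (auto simp: indicator_def)
    then have "decseq (\<lambda>n. nrm (?r n g))" by (rule decseq_SucI)
    then obtain L where "(\<lambda>n. nrm (?r n g)) \<longlonglongrightarrow> L"
      by (rule decseq_convergent[of _ 0]) simp_all
    then have "convergent (\<lambda>n. nrm (?r n g))" by (rule convergentI)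
    then show ?thesis by (simp add: p_def convergent_LIMSEQ_iff)
  qed
  have p_le: "p g \<le> nrm g" if "g \<in> X" for g
    using p[OF that] restrict_bfs(2)[OF that meas] by (intro LIMSEQ_le_const2) auto
  obtain \<phi> where \<phi>: "\<And>g h c. g \<in> X \<Longrightarrow> h \<in> X \<Longrightarrow> \<phi> (\<lambda>x. g x + c * h x) = \<phi> g + c * \<phi> h"
    "\<And>g. g \<in> X \<Longrightarrow> cmod (\<phi> g) \<le> p g" "cmod (\<phi> f) = p f"
  proof (rule X.hahn_banach[of p, OF _ _ f])
    fix g h assume gh: "g \<in> X" "h \<in> X"
    have "nrm (?r n (\<lambda>x. g x + h x)) \<le> nrm (?r n g) + nrm (?r n h)" for n
      using normX_triangle(2)[OF r[OF gh(1)] r[OF gh(2)], of n n] by (simp add: ring_distribs)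
    then show "p (\<lambda>x. g x + h x) \<le> p g + p h"
      by (intro LIMSEQ_le[OF p[OF normX_triangle(1)[OF gh]] tendsto_add[OF p p, OF gh]]) auto
  next
    fix g c assume g: "g \<in> X"
    have "nrm (?r n (\<lambda>x. c * g x)) = cmod c * nrm (?r n g)" for n
      using normX_scale[OF r[OF g], of c n] by (simp add: mult_ac)
    then show "p (\<lambda>x. c * g x) \<le> cmod c * p g"
      by (intro LIMSEQ_le[OF p[OF scale_bfs[OF g]] tendsto_mult_left[OF p[OF g]]]) auto
  qed blast
  have \<phi>_diff: "\<phi> (\<lambda>x. g x - h x) = \<phi> g - \<phi> h" if "g \<in> X" "h \<in> X" for g h
    using \<phi>(1)[OF that, of "-1"] by simp
  have \<phi>_dual: "\<phi> \<in> dual_space \<rho>"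
    unfolding dual_space_def
  proof (intro CollectI conjI ballI allI impI exI)
    fix g h c assume gh: "g \<in> X" "h \<in> X"
    show "\<phi> (\<lambda>x. g x + c * h x) = \<phi> g + c * \<phi> h" by (rule \<phi>(1)[OF gh])
  next
    fix g h assume gh: "g \<in> X" "h \<in> X" and eq: "AE x in lebesgue. g x = h x"
    have "nrm (\<lambda>x. g x - h x) = nrm (\<lambda>x. 0)"
      using eq by (intro normX_cong_AE(2)) (auto elim: eventually_mono)
    then have "cmod (\<phi> (\<lambda>x. g x - h x)) \<le> 0"
      using order_trans[OF \<phi>(2) p_le, OF diff_bfs diff_bfs, OF gh gh] by simp
    then show "\<phi> g = \<phi> h" using \<phi>_diff[OF gh] by simp
  next
    fix g assume "g \<in> X"
    then show "cmod (\<phi> g) \<le> 1 * nrm g" using order_trans[OF \<phi>(2) p_le] by simp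
  qed
  \<comment> \<open>The difference between f and its restriction to E n vanishes on E m for m >= n,
    so p is 0 there. Thus \<phi> sees no loss under restriction, and the limit functional takes the
    value \<phi> f at \<phi>.\<close>
  have \<phi>_r: "\<phi> (?r n f) = \<phi> f" for n
  proof -
    let ?g = "\<lambda>x. f x - ?r n f x"
    have g: "?g \<in> X" by (rule diff_bfs[OF f r[OF f]])
    have "?r m ?g = (\<lambda>x. 0)" if "m \<ge> n" for m
      using decseqD[OF dec that] by (auto simp: indicator_def fun_eq_iff)
    then have "(\<lambda>m. nrm (?r m ?g)) \<longlonglongrightarrow> 0"
      by (intro tendsto_eventually eventually_sequentiallyI[of n]) simp
    then have "p ?g = 0" using p[OF g] LIMSEQ_unique by blast
    then show ?thesis using \<phi>(2)[OF g] \<phi>_diff[OF f r[OF f]] by simp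
  qed
  define \<Phi> where "\<Phi> \<psi> = lim (\<lambda>n. \<psi> (?r n f))" for \<psi> :: "(real \<Rightarrow> complex) \<Rightarrow> complex"
  have \<Phi>: "(\<lambda>n. \<psi> (?r n f)) \<longlonglongrightarrow> \<Phi> \<psi>" if "\<psi> \<in> dual_space \<rho>" for \<psi>
    using restrictions_convergent[OF that] by (simp add: \<Phi>_def convergent_LIMSEQ_iff)
  obtain g where g: "g \<in> X" "\<And>\<psi>. \<psi> \<in> dual_space \<rho> \<Longrightarrow> \<Phi> \<psi> = \<psi> g"
  proof (rule reflexive_representation[of \<Phi> "nrm f"])
    fix \<psi> \<theta> c assume a: "\<psi> \<in> dual_space \<rho>" "\<theta> \<in> dual_space \<rho>"
    show "\<Phi> (\<lambda>f. \<psi> f + c * \<theta> f) = \<Phi> \<psi> + c * \<Phi> \<theta>"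
      using \<Phi>[OF X'.lin_mem[OF a, of c]] tendsto_add[OF \<Phi>[OF a(1)] tendsto_mult_left[OF \<Phi>[OF a(2)], of c]]
      by (rule LIMSEQ_unique)
  next
    fix \<psi> assume \<psi>: "\<psi> \<in> dual_space \<rho>"
    have "cmod (\<psi> (?r n f)) \<le> nrm f * dual_norm \<rho> \<psi>" for n
      using order_trans[OF dual_norm_bound[OF \<psi> r[OF f]] mult_left_mono[OF restrict_bfs(2)[OF f meas] dual_norm_nonneg[OF \<psi>]]]
      by (simp add: mult.commute)
    then show "cmod (\<Phi> \<psi>) \<le> nrm f * dual_norm \<rho> \<psi>"
      using tendsto_norm[OF \<Phi>[OF \<psi>]] by (intro LIMSEQ_le_const2) auto
  qed blast
  \<comment> \<open>Against a bounded kernel of bounded support the restrictions tend to 0 by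
    dominated convergence for integrals, since almost every point leaves the sets E n. So g
    annihilates all such kernels.\<close>
  have "AE x in lebesgue. g x = 0"
  proof (rule pairing_zero_imp_AE_zero[OF g(1)])
    fix h :: "real \<Rightarrow> complex" and R :: real
    assume h: "h \<in> borel_measurable lebesgue" "\<And>x. cmod (h x) \<le> indicator {-R..R} x"
    have dual: "pairing h \<in> dual_space \<rho>" using h by (intro pairing_dual[OF emeasure_segment, where c = 1]) auto
    have int: "integrable lebesgue (\<lambda>x. f x * h x)"
      by (rule integrable_pairing[OF f h(1), of 1 R]) (use h(2) in simp)
    have [measurable]: "f \<in> borel_measurable lebesgue" "h \<in> borel_measurable lebesgue" "E n \<in> sets lebesgue" for n
      using f h meas by (auto dest: bfs_measurable)
    have "(\<lambda>n. \<integral>x. ?r n f x * h x \<partial>lebesgue) \<longlonglongrightarrow> (\<integral>x. 0 \<partial>(lebesgue :: real measure))"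
    proof (rule integral_dominated_convergence[where w = "\<lambda>x. cmod (f x * h x)"])
      show "integrable lebesgue (\<lambda>x. cmod (f x * h x))" using int by (rule integrable_norm)
      show "AE x in lebesgue. (\<lambda>n. ?r n f x * h x) \<longlonglongrightarrow> 0"
        using null
      proof eventually_elim
        case (elim x)
        then obtain n where "x \<notin> E n" by blast
        then have "?r m f x * h x = 0" if "m \<ge> n" for m
          using decseqD[OF dec that] by (auto simp: indicator_def)
        then show ?case by (intro tendsto_eventually eventually_sequentiallyI[of n])
      qed
    qed (auto simp: indicator_def)
    then have "(\<lambda>n. pairing h (?r n f)) \<longlonglongrightarrow> 0" by (simp add: pairing_def)
    then have "\<Phi> (pairing h) = 0" using \<Phi>[OF dual] LIMSEQ_unique by blast
    then show "pairing h g = 0" using g(2)[OF dual] by simp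
  qed
  then have "\<phi> g = \<phi> (\<lambda>x. 0)" by (intro dual_cong[OF \<phi>_dual g(1)]) auto
  then have "\<Phi> \<phi> = 0" using g(2)[OF \<phi>_dual] dual_zero[OF \<phi>_dual] by simp
  moreover have "\<Phi> \<phi> = \<phi> f" unfolding \<Phi>_def \<phi>_r by (rule limI) simp
  ultimately have "p f = 0" using \<phi>(3) by simp
  then show ?thesis using p[OF f] by simp
qed

end

section \<open>Density of continuous functions of compact support\<close>

text \<open>An argument in the manner of Egorov: E n collects the points where some F m with m >= n
  exceeds \<eta>. Then |F n| is at most \<eta> on K, plus c on the part of K in E n, and absolute
  continuity of the norm disposes of the second term.\<close>

lemma dominated_convergence_X:
  assumes meas: "\<And>n. F n \<in> borel_measurable lebesgue" and c: "c \<ge> 0"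
    and bound: "\<And>n x. cmod (F n x) \<le> c * indicator {-R..R} x"
    and lim: "AE x in lebesgue. (\<lambda>n. F n x) \<longlonglongrightarrow> 0"
  shows "(\<lambda>n. nrm (F n)) \<longlonglongrightarrow> 0"
proof (rule LIMSEQ_I)
  fix \<epsilon> :: real assume \<epsilon>: "\<epsilon> > 0"
  let ?K = "{-R..R}"
  let ?k = "nrm (indicator ?K)"
  \<comment> \<open>One is added to \<open>?k\<close> because the norm of the indicator may be 0,
    for instance when the interval is empty.\<close>
  define \<eta> where "\<eta> = \<epsilon> / (2 * (?k + 1))"
  have k: "?k + 1 > 0" using normX_nonneg[of "indicator ?K"] by linarith
  have \<eta>: "\<eta> > 0" using \<epsilon> k by (simp add: \<eta>_def)
  define E where "E n = (\<Union>m\<in>{n..}. {x. cmod (F m x) > \<eta>})" for n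
  note meas[measurable]
  have E[measurable]: "E n \<in> sets lebesgue" for n
  proof -
    have "{x \<in> space lebesgue. cmod (F m x) > \<eta>} \<in> sets lebesgue" for m by measurable
    then show ?thesis unfolding E_def by (intro sets.countable_UN'') auto
  qed
  have dec: "decseq E" unfolding E_def by (intro decseq_SucI) (auto intro: Suc_leD)
  have "AE x in lebesgue. \<exists>n. x \<notin> E n"
    using lim
  proof eventually_elim
    case (elim x)
    then obtain N where "\<forall>n\<ge>N. cmod (F n x) < \<eta>" using LIMSEQ_D[OF elim \<eta>] by auto
    then have "x \<notin> E N" by (auto simp: E_def not_less intro: less_imp_le)
    then show ?case by blast
  qed
  note ac = absolutely_continuous_norm[OF dec E indicator_bfs[OF emeasure_segment, of R] this]
  have "\<epsilon> / (2 * (c + 1)) > 0" using \<epsilon> c by simp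
  from LIMSEQ_D[OF ac this] obtain N where
    N: "\<And>n. n \<ge> N \<Longrightarrow> nrm (\<lambda>x. indicator (E n) x * indicator ?K x) < \<epsilon> / (2 * (c + 1))"
    by auto
  have "nrm (F n) < \<epsilon>" if n: "n \<ge> N" for n
  proof -
    let ?g = "\<lambda>x. complex_of_real \<eta> * indicator ?K x + complex_of_real c * (indicator (E n) x * indicator ?K x)"
    have X: "indicator ?K \<in> X" "(\<lambda>x. indicator (E n) x * indicator ?K x) \<in> X"
      using indicator_bfs[OF emeasure_segment, of R] restrict_bfs(1)[OF _ E] by auto
    have "cmod (F n x) \<le> cmod (?g x)" for x
    proof (cases "x \<in> E n")
      case True
      then have "?g x = complex_of_real ((\<eta> + c) * indicator ?K x)" by (simp add: indicator_def algebra_simps)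
      then have "cmod (?g x) = \<bar>(\<eta> + c) * indicator ?K x\<bar>" by (simp only: norm_of_real)
      then have "cmod (?g x) = (\<eta> + c) * indicator ?K x" using \<eta> c by simp
      then show ?thesis using bound[of n x] \<eta> by (auto simp: indicator_def of_bool_def split: if_splits)
    next
      case False
      then have "cmod (F n x) \<le> \<eta>" using not_less by (fastforce simp: E_def)
      then show ?thesis using bound[of n x] \<eta> False by (auto simp: indicator_def of_bool_def split: if_splits)
    qed
    then have "nrm (F n) \<le> nrm ?g"
      by (intro normX_mono(2) meas normX_triangle(1) scale_bfs X) simp
    also have "\<dots> \<le> \<eta> * ?k + c * nrm (\<lambda>x. indicator (E n) x * indicator ?K x)"
      using normX_triangle(2)[OF scale_bfs[OF X(1)] scale_bfs[OF X(2)], of "complex_of_real \<eta>" "complex_of_real c"] \<eta> c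
      unfolding normX_scale[OF X(1)] normX_scale[OF X(2)] by simp
    also have "\<dots> < \<epsilon>"
    proof -
      have "\<eta> * ?k \<le> \<eta> * (?k + 1)" using \<eta> by simp
      also have "\<dots> = \<epsilon> / 2" using k by (simp add: \<eta>_def del: distrib_left_numeral)
      finally have 1: "\<eta> * ?k \<le> \<epsilon> / 2" .
      have "c * nrm (\<lambda>x. indicator (E n) x * indicator ?K x) \<le> c * (\<epsilon> / (2 * (c + 1)))"
        using N[OF n] c by (intro mult_left_mono) auto
      also have "\<dots> < (c + 1) * (\<epsilon> / (2 * (c + 1)))" using \<epsilon> c by (intro mult_strict_right_mono) auto
      also have "\<dots> = \<epsilon> / 2" using c by (simp add: field_simps)
      finally show ?thesis using 1 by simp
    qed
    finally show ?thesis .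
  qed
  then show "\<exists>N. \<forall>n\<ge>N. norm (nrm (F n) - 0) < \<epsilon>" by auto
qed

text \<open>Support and height are truncated together at level n: the discarded sets E n decrease to
  the empty set, so absolute continuity applies. The truncated function is an almost everywhere
  limit of continuous ones with a common bound, which \<open>dominated_convergence_X\<close>
  upgrades to the norm.\<close>

lemma C_comp_dense:
  assumes f: "f \<in> X" and \<epsilon>: "\<epsilon> > 0"
  obtains g where "g \<in> C_comp" "nrm (\<lambda>x. f x - g x) < \<epsilon>"
proof -
  have [measurable]: "f \<in> borel_measurable lebesgue" using f by (rule bfs_measurable)
  define E where "E n = {x. \<bar>x\<bar> > real n \<or> cmod (f x) > real n}" for n
  note lebesgue_measurable_ident[measurable]
  have E[measurable]: "E n \<in> sets lebesgue" for n
  proof -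
    have "{x \<in> space lebesgue. \<bar>x\<bar> > real n \<or> cmod (f x) > real n} \<in> sets lebesgue" by measurable
    then show ?thesis by (simp add: E_def)
  qed
  have dec: "decseq E" by (auto simp: E_def decseq_def)
  have "\<exists>n. x \<notin> E n" for x
  proof -
    obtain n where "max \<bar>x\<bar> (cmod (f x)) \<le> real n" using real_arch_simple by blast
    then show ?thesis by (auto simp: E_def not_less)
  qed
  then have "(\<lambda>n. nrm (\<lambda>x. indicator (E n) x * f x)) \<longlonglongrightarrow> 0"
    by (intro absolutely_continuous_norm dec E f) auto
  from LIMSEQ_D[OF this, of "\<epsilon> / 2"] \<epsilon> obtain n where n: "nrm (\<lambda>x. indicator (E n) x * f x) < \<epsilon> / 2"
    by auto
  define h where "h x = f x - indicator (E n) x * f x" for x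
  have hX: "h \<in> X" unfolding h_def by (intro diff_bfs f restrict_bfs E)
  have fh: "nrm (\<lambda>x. f x - h x) < \<epsilon> / 2" using n by (simp add: h_def)
  have h: "h \<in> borel_measurable lebesgue" using hX by (rule bfs_measurable)
  have hle: "cmod (h x) \<le> real n * indicator {-real n..real n} x" for x
    by (auto simp: h_def E_def indicator_def)
  obtain H where H: "\<And>m. continuous_on UNIV (H m)"
    "\<And>m x. cmod (H m x) \<le> real n * indicator {-(real n+1)..real n+1} x"
    "AE x in lebesgue. (\<lambda>m. H m x) \<longlonglongrightarrow> h x"
    using continuous_approximation[OF h _ hle] by auto
  have HC: "H m \<in> C_comp" for m by (rule C_compI[OF H(1) _ H(2)]) simp
  have "(\<lambda>m. nrm (\<lambda>x. h x - H m x)) \<longlonglongrightarrow> 0"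
  proof (rule dominated_convergence_X[of _ "2 * real n" "real n + 1"])
    show "(\<lambda>x. h x - H m x) \<in> borel_measurable lebesgue" for m
      using h continuous_imp_lebesgue_measurable[OF H(1)] by (intro borel_measurable_diff) auto
    fix m x
    have "cmod (h x - H m x) \<le> cmod (h x) + cmod (H m x)" by (rule norm_triangle_ineq4)
    also have "cmod (h x) \<le> real n * indicator {-(real n+1)..real n+1} x"
      using hle[of x] by (auto simp: indicator_def of_bool_def split: if_splits)
    finally show "cmod (h x - H m x) \<le> 2 * real n * indicator {-(real n+1)..real n+1} x"
      using H(2)[of m x] by simp
  next
    show "AE x in lebesgue. (\<lambda>m. h x - H m x) \<longlonglongrightarrow> 0"
      using H(3)
    proof eventually_elim
      case (elim x)
      then show ?case using tendsto_diff[OF tendsto_const[of "h x"] elim] by simp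
    qed
  qed simp
  from LIMSEQ_D[OF this, of "\<epsilon> / 2"] \<epsilon> obtain m where m: "nrm (\<lambda>x. h x - H m x) < \<epsilon> / 2"
    by auto
  have "nrm (\<lambda>x. f x - H m x) < \<epsilon>"
    using normX_triangle_diff[OF f hX C_comp_bfs[OF HC[of m]]] fh m by simp
  with HC show ?thesis using that by blast
qed

text \<open>A bounded test function of bounded support is an almost everywhere limit of functions in
  \<open>C_comp\<close> with the same bound on a slightly larger interval. As g is integrable on
  that interval, the pairings converge.\<close>

lemma pairing_C_comp_zero_imp_AE_zero:
  assumes g: "g \<in> X" and zero: "\<And>b. b \<in> C_comp \<Longrightarrow> pairing b g = 0"
  shows "AE x in lebesgue. g x = 0"
proof (rule pairing_zero_imp_AE_zero[OF g])
  fix h :: "real \<Rightarrow> complex" and R :: real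
  assume h: "h \<in> borel_measurable lebesgue" "\<And>x. cmod (h x) \<le> indicator {-R..R} x"
  obtain H where H: "\<And>m. continuous_on UNIV (H m)"
    "\<And>m x. cmod (H m x) \<le> 1 * indicator {-(R+1)..R+1} x"
    "AE x in lebesgue. (\<lambda>m. H m x) \<longlonglongrightarrow> h x"
    using continuous_approximation[of h 1 R] h by auto
  have HC: "H m \<in> C_comp" for m by (rule C_compI[OF H(1) _ H(2)]) simp
  let ?k = "indicator {-(R+1)..R+1} :: real \<Rightarrow> complex"
  have "integrable lebesgue (\<lambda>x. g x * ?k x)"
    by (rule integrable_pairing[OF g, of _ 1 "R+1"]) (auto split: split_indicator intro!: borel_measurable_indicator)
  have "(\<lambda>m. \<integral>x. g x * H m x \<partial>lebesgue) \<longlonglongrightarrow> (\<integral>x. g x * h x \<partial>lebesgue)"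
  proof (rule integral_dominated_convergence[where w = "\<lambda>x. cmod (g x * ?k x)"])
    show "(\<lambda>x. g x * h x) \<in> borel_measurable lebesgue"
      using g h by (intro borel_measurable_times) (auto dest: bfs_measurable)
    show "(\<lambda>x. g x * H m x) \<in> borel_measurable lebesgue" for m
      using g continuous_imp_lebesgue_measurable[OF H(1)]
      by (intro borel_measurable_times) (auto dest: bfs_measurable)
    show "AE x in lebesgue. (\<lambda>m. g x * H m x) \<longlonglongrightarrow> g x * h x"
      using H(3) by eventually_elim (rule tendsto_mult_left)
    show "AE x in lebesgue. norm (g x * H m x) \<le> cmod (g x * ?k x)" for m
    proof (rule AE_I2)
      fix x
      have "cmod (?k x) = indicator {-(R+1)..R+1} x" by (simp add: indicator_def)
      then show "norm (g x * H m x) \<le> cmod (g x * ?k x)"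
        using H(2)[of m x] by (simp add: norm_mult mult_left_mono)
    qed
  qed (use \<open>integrable lebesgue (\<lambda>x. g x * ?k x)\<close> in \<open>simp add: integrable_norm\<close>)
  then have "(\<lambda>m. pairing (H m) g) \<longlonglongrightarrow> pairing h g" by (simp add: pairing_def)
  then show "pairing h g = 0" using zero[OF HC] by (simp add: LIMSEQ_const_iff)
qed

text \<open>The seminorm p is the distance to the functionals \<open>pairing b\<close>, so it
  vanishes at each of them. A Hahn-Banach functional attaining p at \<phi> is evaluation at some f
  by reflexivity; this f is annihilated by all of \<open>C_comp\<close>, hence zero, and so is the
  distance of \<phi>.\<close>

lemma C_comp_dense_dual:
  assumes \<phi>: "\<phi> \<in> dual_space \<rho>" and \<epsilon>: "\<epsilon> > 0"
  obtains b where "b \<in> C_comp" "\<And>f. f \<in> X \<Longrightarrow> cmod (\<phi> f - pairing b f) \<le> \<epsilon> * nrm f"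
proof -
  define D where "D \<psi> b = dual_norm \<rho> (\<lambda>f. \<psi> f - pairing b f)" for \<psi> b
  have diff: "(\<lambda>f. \<psi> f - pairing b f) \<in> dual_space \<rho>" if "\<psi> \<in> dual_space \<rho>" "b \<in> C_comp" for \<psi> b
    using X'.lin_mem[OF that(1) C_comp_dual[OF that(2)], of "-1"] by simp
  have D0: "D \<psi> b \<ge> 0" if "\<psi> \<in> dual_space \<rho>" "b \<in> C_comp" for \<psi> b
    unfolding D_def using dual_norm_nonneg[OF diff[OF that]] .
  define p where "p \<psi> = (INF b\<in>C_comp. D \<psi> b)" for \<psi>
  have p_le: "p \<psi> \<le> D \<psi> b" if "\<psi> \<in> dual_space \<rho>" "b \<in> C_comp" for \<psi> b
    unfolding p_def using D0[OF that(1)] that(2) by (intro cINF_lower bdd_belowI2[of _ 0]) auto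
  have ne: "C_comp \<noteq> {}" using zero_C_comp by auto
  have pairing_lin: "pairing (\<lambda>x. b x + c * d x) f = pairing b f + c * pairing d f"
    if b: "b \<in> C_comp" and d: "d \<in> C_comp" and f: "f \<in> X" for b d f c
  proof -
    have int: "integrable lebesgue (\<lambda>x. f x * b x)" if bC: "b \<in> C_comp" for b
    proof -
      obtain c R where cR: "c \<ge> 0" "\<And>x. cmod (b x) \<le> c * indicator {-R..R} x" "continuous_on UNIV b"
        using bC by (auto simp: C_comp_def)
      show ?thesis
        by (rule integrable_pairing[OF f continuous_imp_lebesgue_measurable[OF cR(3)] cR(2)])
    qed
    show ?thesis using int[OF b] int[OF d] by (simp add: pairing_def ring_distribs mult.left_commute)
  qed
  have p0: "p \<phi> = 0"
  proof -
    obtain \<Phi> where \<Phi>: "\<And>\<psi> \<theta> c. \<psi> \<in> dual_space \<rho> \<Longrightarrow> \<theta> \<in> dual_space \<rho> \<Longrightarrow> \<Phi> (\<lambda>f. \<psi> f + c * \<theta> f) = \<Phi> \<psi> + c * \<Phi> \<theta>"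
      "\<And>\<psi>. \<psi> \<in> dual_space \<rho> \<Longrightarrow> cmod (\<Phi> \<psi>) \<le> p \<psi>" "cmod (\<Phi> \<phi>) = p \<phi>"
    proof (rule X'.hahn_banach[of p, OF _ _ \<phi>])
      fix \<psi> \<theta> assume a: "\<psi> \<in> dual_space \<rho>" "\<theta> \<in> dual_space \<rho>"
      have sum: "(\<lambda>f. \<psi> f + \<theta> f) \<in> dual_space \<rho>" by (rule X'.add_mem[OF a])
      have *: "p (\<lambda>f. \<psi> f + \<theta> f) \<le> D \<psi> b + D \<theta> d" if b: "b \<in> C_comp" and d: "d \<in> C_comp" for b d
      proof -
        have bd: "(\<lambda>x. b x + 1 * d x) \<in> C_comp" by (rule C_comp_lin[OF b d])
        have "D (\<lambda>f. \<psi> f + \<theta> f) (\<lambda>x. b x + 1 * d x) \<le> D \<psi> b + D \<theta> d"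
          unfolding D_def
        proof (rule dual_norm_le)
          fix f assume f: "f \<in> X"
          have "cmod (\<psi> f + \<theta> f - pairing (\<lambda>x. b x + 1 * d x) f)
             = cmod ((\<psi> f - pairing b f) + (\<theta> f - pairing d f))"
            using pairing_lin[OF b d f, of 1] by (simp add: algebra_simps)
          also have "\<dots> \<le> cmod (\<psi> f - pairing b f) + cmod (\<theta> f - pairing d f)" by (rule norm_triangle_ineq)
          also have "\<dots> \<le> dual_norm \<rho> (\<lambda>f. \<psi> f - pairing b f) * nrm f + dual_norm \<rho> (\<lambda>f. \<theta> f - pairing d f) * nrm f"
            using dual_norm_bound[OF diff[OF a(1) b] f] dual_norm_bound[OF diff[OF a(2) d] f] by (rule add_mono)
          finally show "cmod (\<psi> f + \<theta> f - pairing (\<lambda>x. b x + 1 * d x) f)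
            \<le> (dual_norm \<rho> (\<lambda>f. \<psi> f - pairing b f) + dual_norm \<rho> (\<lambda>f. \<theta> f - pairing d f)) * nrm f"
            by (simp add: algebra_simps)
        next
          show "0 \<le> dual_norm \<rho> (\<lambda>f. \<psi> f - pairing b f) + dual_norm \<rho> (\<lambda>f. \<theta> f - pairing d f)"
            using D0[OF a(1) b] D0[OF a(2) d] by (simp add: D_def)
        qed
        with p_le[OF sum bd] show ?thesis by simp
      qed
      have "p (\<lambda>f. \<psi> f + \<theta> f) - D \<psi> b \<le> p \<theta>" if "b \<in> C_comp" for b
        unfolding p_def[of \<theta>] using *[OF that] ne by (intro cINF_greatest) (auto simp: algebra_simps)
      then have "p (\<lambda>f. \<psi> f + \<theta> f) - p \<theta> \<le> p \<psi>"
        unfolding p_def[of \<psi>] using ne by (intro cINF_greatest) (auto simp: algebra_simps)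
      then show "p (\<lambda>f. \<psi> f + \<theta> f) \<le> p \<psi> + p \<theta>" by simp
    next
      fix \<psi> c assume a: "\<psi> \<in> dual_space \<rho>"
      have sc: "(\<lambda>f. c * \<psi> f) \<in> dual_space \<rho>" by (rule X'.scale_mem[OF a])
      have *: "p (\<lambda>f. c * \<psi> f) \<le> cmod c * D \<psi> b" if b: "b \<in> C_comp" for b
      proof -
        have cb: "(\<lambda>x. 0 + c * b x) \<in> C_comp" by (rule C_comp_lin[OF zero_C_comp b])
        have "D (\<lambda>f. c * \<psi> f) (\<lambda>x. 0 + c * b x) \<le> cmod c * D \<psi> b"
          unfolding D_def
        proof (rule dual_norm_le)
          fix f assume f: "f \<in> X"
          have "pairing (\<lambda>x. 0 + c * b x) f = c * pairing b f"
            using pairing_lin[OF zero_C_comp b f, of c] by (simp add: pairing_def)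
          then have "cmod (c * \<psi> f - pairing (\<lambda>x. 0 + c * b x) f) = cmod c * cmod (\<psi> f - pairing b f)"
            by (simp add: norm_mult[symmetric] right_diff_distrib)
          also have "\<dots> \<le> cmod c * (dual_norm \<rho> (\<lambda>f. \<psi> f - pairing b f) * nrm f)"
            by (intro mult_left_mono dual_norm_bound[OF diff[OF a b] f]) simp
          finally show "cmod (c * \<psi> f - pairing (\<lambda>x. 0 + c * b x) f)
            \<le> cmod c * dual_norm \<rho> (\<lambda>f. \<psi> f - pairing b f) * nrm f" by (simp add: mult.assoc)
        next
          show "0 \<le> cmod c * dual_norm \<rho> (\<lambda>f. \<psi> f - pairing b f)"
            using D0[OF a b] by (simp add: D_def)
        qed
        with p_le[OF sc cb] show ?thesis by simp
      qed
      show "p (\<lambda>f. c * \<psi> f) \<le> cmod c * p \<psi>"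
      proof (cases "c = 0")
        case True then show ?thesis using *[OF zero_C_comp] by simp
      next
        case False
        then have "p (\<lambda>f. c * \<psi> f) / cmod c \<le> p \<psi>"
          unfolding p_def[of \<psi>] using * ne by (intro cINF_greatest) (auto simp: field_simps)
        then show ?thesis using False by (simp add: field_simps)
      qed
    qed blast
    \<comment> \<open>The zero kernel competes in the infimum, so p lies below the dual norm and the
      functional is bounded on the dual.\<close>
    have pd: "p \<psi> \<le> 1 * dual_norm \<rho> \<psi>" if "\<psi> \<in> dual_space \<rho>" for \<psi>
      using p_le[OF that zero_C_comp] by (simp add: D_def pairing_def)
    obtain f where f: "f \<in> X" "\<And>\<psi>. \<psi> \<in> dual_space \<rho> \<Longrightarrow> \<Phi> \<psi> = \<psi> f"
      using reflexive_representation[of \<Phi> 1, OF \<Phi>(1) order_trans[OF \<Phi>(2) pd]] by blast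
    have "AE x in lebesgue. f x = 0"
    proof (rule pairing_C_comp_zero_imp_AE_zero[OF f(1)])
      fix b assume b: "b \<in> C_comp"
      have "D (pairing b) b = dual_norm \<rho> (\<lambda>f. 0)" by (simp add: D_def)
      also have "\<dots> \<le> 0" by (rule dual_norm_le) auto
      finally have "p (pairing b) \<le> 0" using p_le[OF C_comp_dual[OF b] b] by simp
      with \<Phi>(2)[OF C_comp_dual[OF b]] have "cmod (\<Phi> (pairing b)) \<le> 0" by (rule order_trans)
      then show "pairing b f = 0" using f(2)[OF C_comp_dual[OF b]] by simp
    qed
    then have "\<phi> f = \<phi> (\<lambda>x. 0)" by (intro dual_cong[OF \<phi> f(1)]) auto
    then show ?thesis using \<Phi>(3) f(2)[OF \<phi>] dual_zero[OF \<phi>] by simp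
  qed
  have "\<exists>b\<in>C_comp. D \<phi> b < \<epsilon>"
  proof (rule ccontr)
    assume "\<not> ?thesis"
    then have "\<epsilon> \<le> p \<phi>" unfolding p_def using ne by (intro cINF_greatest) (auto simp: not_less)
    then show False using p0 \<epsilon> by simp
  qed
  then obtain b where b: "b \<in> C_comp" "D \<phi> b < \<epsilon>" by blast
  show ?thesis
  proof (rule that[OF b(1)])
    fix f assume f: "f \<in> X"
    have "cmod (\<phi> f - pairing b f) \<le> D \<phi> b * nrm f"
      unfolding D_def by (rule dual_norm_bound[OF diff[OF \<phi> b(1)] f])
    also have "\<dots> \<le> \<epsilon> * nrm f" using b(2) by (intro mult_right_mono) auto
    finally show "cmod (\<phi> f - pairing b f) \<le> \<epsilon> * nrm f" .
  qed
qed

end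

section \<open>The Fourier transform\<close>

lemma sigma_finite_lebesgue: "sigma_finite_measure (lebesgue :: real measure)"
proof
  show "\<exists>A. countable A \<and> A \<subseteq> sets lebesgue \<and> \<Union>A = space (lebesgue :: real measure) \<and>
      (\<forall>a\<in>A. emeasure lebesgue a \<noteq> \<infinity>)"
  proof (intro exI[of _ "range (\<lambda>n. {- real n..real n})"] conjI)
    have "x \<in> (\<Union>n. {- real n..real n})" for x
    proof -
      obtain n where "\<bar>x\<bar> \<le> real n" using real_arch_simple by blast
      then show ?thesis by (auto simp: abs_le_iff intro!: exI[of _ n])
    qed
    then show "\<Union>(range (\<lambda>n. {- real n..real n})) = space (lebesgue :: real measure)" by auto
  qed (auto simp: emeasure_lborel_Icc_eq)
qed

interpretation lebesgue: sigma_finite_measure "lebesgue :: real measure"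
  by (rule sigma_finite_lebesgue)

text \<open>Both factors are completed, their product is not. Kernels of the form k(s - t) are
  therefore taken with k Borel, so that composition with the difference of the coordinates is
  measurable.\<close>

interpretation lebesgue_pair: pair_sigma_finite "lebesgue :: real measure" "lebesgue :: real measure" ..

lemma borel_imp_lebesgue_measurable: "f \<in> borel_measurable borel \<Longrightarrow> f \<in> borel_measurable lebesgue"
  by (rule measurable_completion) simp

lemma measurable_fst_lebesgue [measurable]: "fst \<in> borel_measurable ((lebesgue :: real measure) \<Otimes>\<^sub>M (lebesgue :: real measure))"
  by (rule measurable_compose[OF measurable_fst lebesgue_measurable_ident])

lemma measurable_snd_lebesgue [measurable]: "snd \<in> borel_measurable ((lebesgue :: real measure) \<Otimes>\<^sub>M (lebesgue :: real measure))"
  by (rule measurable_compose[OF measurable_snd lebesgue_measurable_ident])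

lemma measurable_cis_lebesgue [measurable (raw)]:
  assumes "g \<in> borel_measurable M"
  shows "(\<lambda>x. exp (\<i> * complex_of_real (g x))) \<in> borel_measurable M"
proof -
  have "(\<lambda>r. exp (\<i> * complex_of_real r)) \<in> borel_measurable borel"
    by (intro borel_measurable_continuous_onI continuous_intros)
  from measurable_compose[OF assms this] show ?thesis .
qed

section \<open>Gaussians and their transforms\<close>

definition gauss :: "real \<Rightarrow> real \<Rightarrow> real" where
  "gauss c x = exp (- (x / c)\<^sup>2 / 2)"

text \<open>This is c sqrt(2 pi) exp(-(c u)^2 / 2), the transform of \<open>gauss c\<close>. Written
  through the normal density, it inherits integrability and its own transform by an affine change of
  variable.\<close>

definition gauss_hat :: "real \<Rightarrow> real \<Rightarrow> real" where
  "gauss_hat c u = 2 * pi * c * std_normal_density (c * u)"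

lemma gauss_measurable [measurable]: "gauss c \<in> borel_measurable borel"
  unfolding gauss_def by measurable

lemma gauss_hat_measurable [measurable]: "gauss_hat c \<in> borel_measurable borel"
  unfolding gauss_hat_def by measurable

lemma gauss_nonneg [simp]: "0 \<le> gauss c x" by (simp add: gauss_def)
lemma gauss_le_1 [simp]: "gauss c x \<le> 1" by (simp add: gauss_def)
lemma gauss_minus [simp]: "gauss c (- x) = gauss c x" by (simp add: gauss_def)
lemma gauss_hat_nonneg [simp]: "c \<ge> 0 \<Longrightarrow> 0 \<le> gauss_hat c x" by (simp add: gauss_hat_def)
lemma gauss_hat_minus [simp]: "gauss_hat c (- x) = gauss_hat c x" by (simp add: gauss_hat_def std_normal_density_def)

text \<open>Up to a factor a Gaussian is the transform of the Gaussian at the reciprocal scale. So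
  integrability and the transform need to be computed for one of the two families only.\<close>

lemma gauss_eq: "c > 0 \<Longrightarrow> gauss c x = sqrt (2 * pi) / (2 * pi) * c * gauss_hat (1 / c) x"
  by (simp add: gauss_def gauss_hat_def std_normal_density_def field_simps)

lemma std_normal_transform:
  "(\<integral>x. complex_of_real (std_normal_density x) * exp (\<i> * complex_of_real (t * x)) \<partial>lborel)
     = complex_of_real (exp (- t\<^sup>2 / 2))"
proof -
  have "char std_normal_distribution t = complex_of_real (exp (- t\<^sup>2 / 2))"
    by (simp add: char_std_normal_distribution)
  moreover have "char std_normal_distribution t
    = (\<integral>x. std_normal_density x *\<^sub>R exp (\<i> * complex_of_real (t * x)) \<partial>lborel)"
    unfolding char_def by (subst integral_density) (auto simp: normal_density_nonneg)
  ultimately show ?thesis by (simp add: scaleR_conv_of_real)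
qed

lemma integrable_gauss_hat:
  assumes "c > 0" shows "integrable lebesgue (gauss_hat c)"
proof -
  have "integrable lborel (\<lambda>u. std_normal_density (0 + c * u))"
    using assms by (intro lborel_integrable_real_affine) auto
  then have "integrable lborel (gauss_hat c)" by (simp add: gauss_hat_def[abs_def])
  then show ?thesis by (subst integrable_completion) auto
qed

lemma integrable_gauss:
  assumes "c > 0" shows "integrable lebesgue (gauss c)"
proof -
  have "gauss c = (\<lambda>x. sqrt (2 * pi) / (2 * pi) * c * gauss_hat (1 / c) x)"
    using gauss_eq[OF assms] by auto
  then show ?thesis using integrable_gauss_hat[of "1 / c"] assms by simp
qed

lemma nn_integral_gauss_hat:
  assumes "c > 0" shows "(\<integral>\<^sup>+x. ennreal (gauss_hat c x) \<partial>lebesgue) = ennreal (2 * pi)"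
proof -
  have "(\<integral>x. gauss_hat c x \<partial>lebesgue) = (\<integral>x. gauss_hat c x \<partial>lborel)"
    by (rule integral_completion) simp
  also have "\<dots> = (2 * pi * c) * (\<integral>x. std_normal_density (0 + c * x) \<partial>lborel)"
    unfolding gauss_hat_def by simp
  also have "\<dots> = (2 * pi * c) * ((\<integral>x. std_normal_density x \<partial>lborel) / c)"
    using lborel_integral_real_affine[of c std_normal_density 0] assms by simp
  also have "\<dots> = 2 * pi" using assms by simp
  finally have "(\<integral>x. gauss_hat c x \<partial>lebesgue) = 2 * pi" .
  then show ?thesis
    using assms by (subst nn_integral_eq_integral[OF integrable_gauss_hat]) auto
qed

lemma gauss_hat_transform:
  assumes c: "c > 0"
  shows "(\<integral>t. complex_of_real (gauss_hat c t) * exp (\<i> * complex_of_real (t * x)) \<partial>lebesgue)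
    = complex_of_real (2 * pi * gauss c x)"
proof -
  let ?g = "\<lambda>s. complex_of_real (std_normal_density s) * exp (\<i> * complex_of_real (x / c * s))"
  have "(\<integral>t. complex_of_real (gauss_hat c t) * exp (\<i> * complex_of_real (t * x)) \<partial>lebesgue)
    = (\<integral>t. complex_of_real (gauss_hat c t) * exp (\<i> * complex_of_real (t * x)) \<partial>lborel)"
    by (rule integral_completion) measurable
  also have "\<dots> = (\<integral>t. complex_of_real (2 * pi * c) * ?g (0 + c * t) \<partial>lborel)"
    using c by (intro Bochner_Integration.integral_cong) (auto simp: gauss_hat_def mult_ac)
  also have "\<dots> = complex_of_real (2 * pi * c) * (\<integral>t. ?g (0 + c * t) \<partial>lborel)"
    by (rule integral_mult_right_zero)
  also have "(\<integral>t. ?g (0 + c * t) \<partial>lborel) = (\<integral>t. ?g t \<partial>lborel) / complex_of_real c"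
    using lborel_integral_real_affine[of c ?g 0] c by (simp add: scaleR_conv_of_real)
  also have "\<dots> = complex_of_real (gauss c x) / complex_of_real c"
    by (subst std_normal_transform) (simp add: gauss_def)
  finally show ?thesis using c by simp
qed

lemma gauss_transform:
  assumes c: "c > 0"
  shows "(\<integral>t. complex_of_real (gauss c t) * exp (\<i> * complex_of_real (t * x)) \<partial>lebesgue)
    = complex_of_real (gauss_hat c x)"
proof -
  let ?k = "sqrt (2 * pi) / (2 * pi) * c"
  have "(\<integral>t. complex_of_real (gauss c t) * exp (\<i> * complex_of_real (t * x)) \<partial>lebesgue)
    = (\<integral>t. complex_of_real ?k * (complex_of_real (gauss_hat (1 / c) t) * exp (\<i> * complex_of_real (t * x))) \<partial>lebesgue)"
    by (simp only: gauss_eq[OF c] of_real_mult mult.assoc)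
  also have "\<dots> = complex_of_real ?k * complex_of_real (2 * pi * gauss (1 / c) x)"
    using gauss_hat_transform[of "1 / c" x] c by simp
  also have "\<dots> = complex_of_real (gauss_hat c x)"
    using c by (simp add: gauss_hat_def gauss_def std_normal_density_def field_simps flip: of_real_mult)
  finally show ?thesis .
qed

section \<open>The transform of integrable functions\<close>

lemma FT1_measurable [measurable]:
  assumes [measurable]: "\<psi> \<in> borel_measurable lebesgue"
  shows "FT1 \<sigma> \<psi> \<in> borel_measurable lebesgue"
proof -
  have [measurable]: "(\<lambda>p. \<psi> (snd p)) \<in> borel_measurable (lebesgue \<Otimes>\<^sub>M lebesgue)"
    by (rule measurable_compose[OF measurable_snd assms])
  have "(\<lambda>(x, t). \<psi> t * exp (\<i> * complex_of_real (\<sigma> * t * x))) \<in> borel_measurable (lebesgue \<Otimes>\<^sub>M lebesgue)"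
    unfolding case_prod_beta by measurable
  then show ?thesis unfolding FT1_def by (rule lebesgue.borel_measurable_lebesgue_integral)
qed

lemma FT1_bound: "cmod (FT1 \<sigma> \<psi> x) \<le> (\<integral>t. cmod (\<psi> t) \<partial>lebesgue)"
  unfolding FT1_def by (rule order_trans[OF integral_norm_bound]) (simp add: norm_mult)

lemma integrable_mult_FT1:
  assumes u: "integrable lebesgue u" and v: "integrable lebesgue v"
  shows "integrable lebesgue (\<lambda>x. u x * FT1 \<sigma> v x)"
proof (rule Bochner_Integration.integrable_bound)
  show "integrable lebesgue (\<lambda>x. cmod (u x) * (\<integral>t. cmod (v t) \<partial>lebesgue))"
    using u by (intro integrable_mult_left integrable_norm)
  show "(\<lambda>x. u x * FT1 \<sigma> v x) \<in> borel_measurable lebesgue"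
    using u v by (intro borel_measurable_times FT1_measurable) auto
  show "AE x in lebesgue. norm (u x * FT1 \<sigma> v x) \<le> norm (cmod (u x) * (\<integral>t. cmod (v t) \<partial>lebesgue))"
    using FT1_bound by (auto simp: norm_mult intro!: mult_left_mono abs_ge_self order_trans[OF FT1_bound])
qed

text \<open>Fubini's theorem for the bounded kernel. \<open>FT2_rel\<close> turns this identity into
  a definition, which makes it the bridge from the integral transform to the one on L^2.\<close>

lemma FT1_swap:
  assumes u: "integrable lebesgue u" and v: "integrable lebesgue v"
  shows "(\<integral>x. u x * FT1 \<sigma> v x \<partial>lebesgue) = (\<integral>x. FT1 \<sigma> u x * v x \<partial>lebesgue)"
proof -
  have [measurable]: "u \<in> borel_measurable lebesgue" "v \<in> borel_measurable lebesgue" using u v by auto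
  have [measurable]: "(\<lambda>p. u (fst p)) \<in> borel_measurable (lebesgue \<Otimes>\<^sub>M lebesgue)"
     "(\<lambda>p. v (snd p)) \<in> borel_measurable (lebesgue \<Otimes>\<^sub>M lebesgue)"
    by (rule measurable_compose[OF measurable_fst], simp, rule measurable_compose[OF measurable_snd], simp)
  let ?f = "\<lambda>x t. u x * v t * exp (\<i> * complex_of_real (\<sigma> * t * x))"
  have int: "integrable (lebesgue \<Otimes>\<^sub>M lebesgue) (case_prod ?f)"
  proof (rule lebesgue_pair.Fubini_integrable)
    show "case_prod ?f \<in> borel_measurable (lebesgue \<Otimes>\<^sub>M lebesgue)" unfolding case_prod_beta by measurable
    show "integrable lebesgue (\<lambda>x. \<integral>y. norm (case (x, y) of (x, t) \<Rightarrow> ?f x t) \<partial>lebesgue)"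
      using u by (simp add: norm_mult)
    have "integrable lebesgue (\<lambda>y. u x * (v y * exp (\<i> * complex_of_real (\<sigma> * y * x))))" for x
    proof (rule integrable_mult_right)
      show "integrable lebesgue (\<lambda>y. v y * exp (\<i> * complex_of_real (\<sigma> * y * x)))"
      proof (rule Bochner_Integration.integrable_bound[OF v])
        have [measurable]: "(\<lambda>y. \<sigma> * y * x) \<in> borel_measurable lebesgue"
          by (rule borel_imp_lebesgue_measurable) measurable
        show "(\<lambda>y. v y * exp (\<i> * complex_of_real (\<sigma> * y * x))) \<in> borel_measurable lebesgue"
          by measurable
      qed (simp add: norm_mult)
    qed
    then show "AE x in lebesgue. integrable lebesgue (\<lambda>y. case (x, y) of (x, t) \<Rightarrow> ?f x t)"
      by (simp add: mult.assoc)
  qed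
  have "(\<integral>x. u x * FT1 \<sigma> v x \<partial>lebesgue) = (\<integral>x. (\<integral>t. ?f x t \<partial>lebesgue) \<partial>lebesgue)"
    unfolding FT1_def by (simp add: mult.assoc)
  also have "\<dots> = (\<integral>t. (\<integral>x. ?f x t \<partial>lebesgue) \<partial>lebesgue)"
    by (rule lebesgue_pair.Fubini_integral[OF int, symmetric])
  also have "\<dots> = (\<integral>t. FT1 \<sigma> u t * v t \<partial>lebesgue)"
    unfolding FT1_def
  proof (intro Bochner_Integration.integral_cong refl)
    fix t
    have "(\<integral>x. ?f x t \<partial>lebesgue) = (\<integral>x. u x * exp (\<i> * complex_of_real (\<sigma> * x * t)) * v t \<partial>lebesgue)"
      by (intro Bochner_Integration.integral_cong) (auto simp: mult_ac)
    then show "(\<integral>x. ?f x t \<partial>lebesgue) = (\<integral>x. u x * exp (\<i> * complex_of_real (\<sigma> * x * t)) \<partial>lebesgue) * v t"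
      by simp
  qed
  finally show ?thesis .
qed

lemma nn_integral_shift:
  fixes k :: "real \<Rightarrow> ennreal"
  assumes "k \<in> borel_measurable lebesgue"
  shows "(\<integral>\<^sup>+x. k (x - t) \<partial>lebesgue) = (\<integral>\<^sup>+x. k x \<partial>lebesgue)"
    "(\<integral>\<^sup>+x. k (t - x) \<partial>lebesgue) = (\<integral>\<^sup>+x. k x \<partial>lebesgue)"
  using nn_integral_real_affine_lebesgue[OF assms, of 1 "- t"] nn_integral_real_affine_lebesgue[OF assms, of "- 1" t]
  by (simp_all add: algebra_simps)

lemma nn_integral_convolution:
  fixes k g :: "real \<Rightarrow> ennreal"
  assumes k[measurable]: "k \<in> borel_measurable borel" and g[measurable]: "g \<in> borel_measurable lebesgue"
  shows "(\<integral>\<^sup>+s. (\<integral>\<^sup>+t. g t * k (s - t) \<partial>lebesgue) \<partial>lebesgue)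
    = (\<integral>\<^sup>+x. g x \<partial>lebesgue) * (\<integral>\<^sup>+x. k x \<partial>lebesgue)"
proof -
  have [measurable]: "(\<lambda>p. g (snd p)) \<in> borel_measurable (lebesgue \<Otimes>\<^sub>M lebesgue)"
    by (rule measurable_compose[OF measurable_snd]) simp
  have kl: "k \<in> borel_measurable lebesgue" by (rule borel_imp_lebesgue_measurable[OF k])
  have [measurable]: "(\<lambda>x. k (x - t)) \<in> borel_measurable lebesgue" for t
    by (rule borel_imp_lebesgue_measurable) measurable
  have "(\<integral>\<^sup>+s. (\<integral>\<^sup>+t. g t * k (s - t) \<partial>lebesgue) \<partial>lebesgue)
     = (\<integral>\<^sup>+t. (\<integral>\<^sup>+s. g t * k (s - t) \<partial>lebesgue) \<partial>lebesgue)"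
    by (rule lebesgue_pair.Fubini'[symmetric]) (unfold case_prod_beta, measurable)
  also have "\<dots> = (\<integral>\<^sup>+t. g t * (\<integral>\<^sup>+x. k x \<partial>lebesgue) \<partial>lebesgue)"
    by (simp add: nn_integral_cmult nn_integral_shift(1)[OF kl])
  finally show ?thesis by (simp add: nn_integral_multc)
qed

text \<open>Pointwise 2ab <= a^2 + b^2 and Tonelli, so no square roots appear. The sum of the two
  squared norms in place of the product suffices: the lemma is used once with f = g and once for
  mere finiteness.\<close>

lemma schur_bound:
  fixes f g k :: "real \<Rightarrow> ennreal"
  assumes k[measurable]: "k \<in> borel_measurable borel"
    and f[measurable]: "f \<in> borel_measurable lebesgue" and g[measurable]: "g \<in> borel_measurable lebesgue"
  shows "2 * (\<integral>\<^sup>+s. (\<integral>\<^sup>+t. f s * g t * k (s - t) \<partial>lebesgue) \<partial>lebesgue)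
     \<le> ((\<integral>\<^sup>+x. (f x)\<^sup>2 \<partial>lebesgue) + (\<integral>\<^sup>+x. (g x)\<^sup>2 \<partial>lebesgue)) * (\<integral>\<^sup>+x. k x \<partial>lebesgue)"
proof -
  have [measurable]: "(\<lambda>p. f (fst p)) \<in> borel_measurable (lebesgue \<Otimes>\<^sub>M lebesgue)"
     "(\<lambda>p. g (snd p)) \<in> borel_measurable (lebesgue \<Otimes>\<^sub>M lebesgue)"
    by (rule measurable_compose[OF measurable_fst], simp, rule measurable_compose[OF measurable_snd], simp)
  have kl[measurable]: "k \<in> borel_measurable lebesgue" by (rule borel_imp_lebesgue_measurable[OF k])
  have [measurable]: "(\<lambda>t. k (s - t)) \<in> borel_measurable lebesgue" for s
    by (rule borel_imp_lebesgue_measurable) measurable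
  have m: "(\<lambda>s. \<integral>\<^sup>+t. f s * g t * k (s - t) \<partial>lebesgue) \<in> borel_measurable lebesgue"
    "(\<lambda>s. \<integral>\<^sup>+t. (g t)\<^sup>2 * k (s - t) \<partial>lebesgue) \<in> borel_measurable lebesgue"
    by (rule lebesgue.borel_measurable_nn_integral, unfold case_prod_beta, measurable)+
  have "2 * (\<integral>\<^sup>+s. (\<integral>\<^sup>+t. f s * g t * k (s - t) \<partial>lebesgue) \<partial>lebesgue)
    = (\<integral>\<^sup>+s. (\<integral>\<^sup>+t. 2 * f s * g t * k (s - t) \<partial>lebesgue) \<partial>lebesgue)"
    using m by (simp add: nn_integral_cmult[symmetric] mult.assoc)
  also have "\<dots> \<le> (\<integral>\<^sup>+s. (\<integral>\<^sup>+t. (f s)\<^sup>2 * k (s - t) + (g t)\<^sup>2 * k (s - t) \<partial>lebesgue) \<partial>lebesgue)"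
    unfolding distrib_right[symmetric]
    by (intro nn_integral_mono mult_right_mono sum_of_squares_ge_ennreal) simp
  also have "\<dots> = (\<integral>\<^sup>+s. (f s)\<^sup>2 * (\<integral>\<^sup>+x. k x \<partial>lebesgue) + (\<integral>\<^sup>+t. (g t)\<^sup>2 * k (s - t) \<partial>lebesgue) \<partial>lebesgue)"
    by (simp add: nn_integral_add nn_integral_cmult nn_integral_shift(2)[OF kl])
  also have "\<dots> = (\<integral>\<^sup>+x. (f x)\<^sup>2 \<partial>lebesgue) * (\<integral>\<^sup>+x. k x \<partial>lebesgue)
      + (\<integral>\<^sup>+s. (\<integral>\<^sup>+t. (g t)\<^sup>2 * k (s - t) \<partial>lebesgue) \<partial>lebesgue)"
    using m by (simp add: nn_integral_add nn_integral_multc)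
  also have "(\<integral>\<^sup>+s. (\<integral>\<^sup>+t. (g t)\<^sup>2 * k (s - t) \<partial>lebesgue) \<partial>lebesgue) = (\<integral>\<^sup>+x. (g x)\<^sup>2 \<partial>lebesgue) * (\<integral>\<^sup>+x. k x \<partial>lebesgue)"
    by (rule nn_integral_convolution) measurable
  finally show ?thesis by (simp add: distrib_right)
qed

lemma cnj_measurable [measurable (raw)]:
  assumes "g \<in> borel_measurable M"
  shows "(\<lambda>x. cnj (g x)) \<in> borel_measurable M"
proof -
  have "cnj \<in> borel_measurable borel" by (intro borel_measurable_continuous_onI continuous_intros)
  from measurable_compose[OF assms this] show ?thesis .
qed

lemma complex_of_real_measurable [measurable (raw)]:
  assumes "g \<in> borel_measurable M"
  shows "(\<lambda>x. complex_of_real (g x)) \<in> borel_measurable M"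
proof -
  have "complex_of_real \<in> borel_measurable borel" by (intro borel_measurable_continuous_onI continuous_intros)
  from measurable_compose[OF assms this] show ?thesis .
qed

lemma cnj_FT1: "cnj (FT1 \<sigma> \<psi> x) = FT1 (- \<sigma>) (\<lambda>t. cnj (\<psi> t)) x"
  unfolding FT1_def
  by (rule trans[OF Bochner_Integration.integral_cnj[symmetric]], intro Bochner_Integration.integral_cong)
    (simp_all add: exp_cnj)

lemma FT1_modulated_gauss:
  assumes "c > 0"
  shows "FT1 (-1) (\<lambda>t. complex_of_real (gauss c t) * exp (\<i> * complex_of_real (1 * t * s))) y
    = complex_of_real (gauss_hat c (s - y))"
    "FT1 (-1) (\<lambda>t. complex_of_real (gauss_hat c t) * exp (\<i> * complex_of_real (1 * t * s))) y
    = complex_of_real (2 * pi * gauss c (s - y))"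
proof -
  have exps: "exp (\<i> * complex_of_real (1 * t * s)) * exp (\<i> * complex_of_real (-1 * t * y))
      = exp (\<i> * complex_of_real (t * (s - y)))" for t
    by (simp add: exp_add[symmetric] algebra_simps)
  show "FT1 (-1) (\<lambda>t. complex_of_real (gauss c t) * exp (\<i> * complex_of_real (1 * t * s))) y
    = complex_of_real (gauss_hat c (s - y))"
    unfolding FT1_def mult.assoc[of "complex_of_real (_ :: real)" "exp _" "exp _"] exps by (rule gauss_transform[OF assms])
  show "FT1 (-1) (\<lambda>t. complex_of_real (gauss_hat c t) * exp (\<i> * complex_of_real (1 * t * s))) y
    = complex_of_real (2 * pi * gauss c (s - y))"
    unfolding FT1_def mult.assoc[of "complex_of_real (_ :: real)" "exp _" "exp _"] exps by (rule gauss_hat_transform[OF assms])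
qed

lemma integrable_modulated:
  assumes "integrable lebesgue w" "w \<in> borel_measurable borel"
  shows "integrable lebesgue (\<lambda>t. complex_of_real (w t) * exp (\<i> * complex_of_real (1 * t * s)))"
proof (rule Bochner_Integration.integrable_bound[OF assms(1)])
  note assms(2)[measurable]
  show "(\<lambda>t. complex_of_real (w t) * exp (\<i> * complex_of_real (1 * t * s))) \<in> borel_measurable lebesgue"
    by (rule borel_imp_lebesgue_measurable) measurable
qed (simp add: norm_mult)

text \<open>A convolution theorem that avoids inversion: the outer exponential is absorbed into the
  window, and \<open>FT1_swap\<close> moves the inner transform from v onto the modulated window.
  For Gaussian w the right-hand side is an explicit convolution by
  \<open>FT1_modulated_gauss\<close>.\<close>

lemma FT1_windowed:
  assumes w: "integrable lebesgue w" "w \<in> borel_measurable borel" and v: "integrable lebesgue v"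
  shows "FT1 1 (\<lambda>t. complex_of_real (w t) * FT1 (-1) v t) s
    = (\<integral>y. FT1 (-1) (\<lambda>t. complex_of_real (w t) * exp (\<i> * complex_of_real (1 * t * s))) y * v y \<partial>lebesgue)"
proof -
  have "FT1 1 (\<lambda>t. complex_of_real (w t) * FT1 (-1) v t) s
    = (\<integral>t. complex_of_real (w t) * exp (\<i> * complex_of_real (1 * t * s)) * FT1 (-1) v t \<partial>lebesgue)"
    unfolding FT1_def[of 1] by (intro Bochner_Integration.integral_cong) (auto simp: mult_ac)
  also have "\<dots> = (\<integral>y. FT1 (-1) (\<lambda>t. complex_of_real (w t) * exp (\<i> * complex_of_real (1 * t * s))) y * v y \<partial>lebesgue)"
    by (rule FT1_swap[OF integrable_modulated[OF w] v])
  finally show ?thesis .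
qed

section \<open>The Plancherel inequality\<close>

lemma fatou_bound:
  fixes g :: "nat \<Rightarrow> 'a \<Rightarrow> ennreal"
  assumes "\<And>n. g n \<in> borel_measurable M" "AE x in M. (\<lambda>n. g n x) \<longlonglongrightarrow> g' x"
    and "\<forall>\<^sub>F n in sequentially. (\<integral>\<^sup>+x. g n x \<partial>M) \<le> C"
  shows "(\<integral>\<^sup>+x. g' x \<partial>M) \<le> C"
proof -
  have "(\<integral>\<^sup>+x. g' x \<partial>M) = (\<integral>\<^sup>+x. liminf (\<lambda>n. g n x) \<partial>M)"
    using assms(2) by (intro nn_integral_cong_AE) (auto dest!: lim_imp_Liminf[rotated])
  also have "\<dots> \<le> liminf (\<lambda>n. \<integral>\<^sup>+x. g n x \<partial>M)"
    by (rule nn_integral_liminf[OF assms(1)])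
  also have "\<dots> \<le> liminf (\<lambda>n. C)" by (rule Liminf_mono[OF assms(3)])
  also have "\<dots> = C" by (rule Liminf_const) simp
  finally show ?thesis .
qed

text \<open>The Gaussian window secures integrability before the transform is known to be square
  integrable. The function u is chosen so that its product with the transform of \<psi> is the
  windowed square; swapping transforms makes it a convolution form with kernel
  \<open>gauss_hat c\<close>, whose mass 2 pi does not depend on c.\<close>

lemma nn_integral_FT1_gauss_le:
  assumes \<psi>: "integrable lebesgue \<psi>" and c: "c > 0"
  shows "(\<integral>\<^sup>+x. ennreal ((cmod (FT1 1 \<psi> x))\<^sup>2 * gauss c x) \<partial>lebesgue)
    \<le> ennreal (2 * pi) * (\<integral>\<^sup>+x. (ennreal (cmod (\<psi> x)))\<^sup>2 \<partial>lebesgue)"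
proof -
  have [measurable]: "\<psi> \<in> borel_measurable lebesgue" "gauss c \<in> borel_measurable lebesgue"
    using \<psi> by (auto intro: borel_imp_lebesgue_measurable)
  define u where "u x = complex_of_real (gauss c x) * FT1 (-1) (\<lambda>t. cnj (\<psi> t)) x" for x
  have c\<psi>: "integrable lebesgue (\<lambda>t. cnj (\<psi> t))" using \<psi> by simp
  have u: "integrable lebesgue u"
    unfolding u_def by (rule integrable_mult_FT1[OF _ c\<psi>]) (use integrable_gauss[OF c] in simp)
  have FTu: "FT1 1 u s = (\<integral>t. complex_of_real (gauss_hat c (s - t)) * cnj (\<psi> t) \<partial>lebesgue)" for s
    unfolding u_def by (subst FT1_windowed[OF integrable_gauss[OF c] gauss_measurable c\<psi>])
      (simp only: FT1_modulated_gauss[OF c])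
  have eq: "u x * FT1 1 \<psi> x = complex_of_real ((cmod (FT1 1 \<psi> x))\<^sup>2 * gauss c x)" for x
    unfolding u_def using cnj_FT1[of 1 \<psi> x] complex_norm_square[of "FT1 1 \<psi> x"] by (simp add: mult_ac)
  have int: "integrable lebesgue (\<lambda>x. (cmod (FT1 1 \<psi> x))\<^sup>2 * gauss c x)"
    using integrable_mult_FT1[OF u \<psi>, of 1] unfolding eq complex_of_real_integrable_eq .
  let ?I = "\<integral>\<^sup>+s. (\<integral>\<^sup>+t. ennreal (cmod (\<psi> s)) * ennreal (cmod (\<psi> t)) * ennreal (gauss_hat c (s - t)) \<partial>lebesgue) \<partial>lebesgue"
  have "(\<integral>\<^sup>+x. ennreal ((cmod (FT1 1 \<psi> x))\<^sup>2 * gauss c x) \<partial>lebesgue)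
    = ennreal (\<integral>x. (cmod (FT1 1 \<psi> x))\<^sup>2 * gauss c x \<partial>lebesgue)"
    by (rule nn_integral_eq_integral[OF int]) simp
  also have "(\<integral>x. (cmod (FT1 1 \<psi> x))\<^sup>2 * gauss c x \<partial>lebesgue) = cmod (\<integral>x. u x * FT1 1 \<psi> x \<partial>lebesgue)"
    unfolding eq integral_complex_of_real norm_of_real by (intro abs_of_nonneg[symmetric] integral_nonneg) simp
  also have "\<dots> = cmod (\<integral>s. FT1 1 u s * \<psi> s \<partial>lebesgue)" by (simp only: FT1_swap[OF u \<psi>])
  also have "ennreal \<dots> \<le> (\<integral>\<^sup>+s. ennreal (cmod (FT1 1 u s * \<psi> s)) \<partial>lebesgue)"
  proof (rule integral_norm_bound_ennreal)
    show "integrable lebesgue (\<lambda>s. FT1 1 u s * \<psi> s)"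
      using integrable_mult_FT1[OF \<psi> u, of 1] by (simp add: mult.commute)
  qed
  also have "\<dots> \<le> ?I"
  proof (rule nn_integral_mono)
    fix s
    have [measurable]: "(\<lambda>t. gauss_hat c (s - t)) \<in> borel_measurable lebesgue"
      by (rule borel_imp_lebesgue_measurable) measurable
    have "ennreal (cmod (FT1 1 u s)) \<le> (\<integral>\<^sup>+t. ennreal (cmod (complex_of_real (gauss_hat c (s - t)) * cnj (\<psi> t))) \<partial>lebesgue)"
    \<comment> \<open>Without integrability the Bochner integral is 0 by convention and the bound is
      trivial.\<close>
    proof (cases "integrable lebesgue (\<lambda>t. complex_of_real (gauss_hat c (s - t)) * cnj (\<psi> t))")
      case True
      then show ?thesis unfolding FTu by (rule integral_norm_bound_ennreal)
    qed (simp add: FTu not_integrable_integral_eq)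
    then have "ennreal (cmod (FT1 1 u s * \<psi> s))
      \<le> ennreal (cmod (\<psi> s)) * (\<integral>\<^sup>+t. ennreal (cmod (complex_of_real (gauss_hat c (s - t)) * cnj (\<psi> t))) \<partial>lebesgue)"
      by (simp add: norm_mult ennreal_mult mult.commute mult_left_mono)
    also have "\<dots> = (\<integral>\<^sup>+t. ennreal (cmod (\<psi> s)) * ennreal (cmod (complex_of_real (gauss_hat c (s - t)) * cnj (\<psi> t))) \<partial>lebesgue)"
      by (rule nn_integral_cmult[symmetric]) measurable
    also have "\<dots> = (\<integral>\<^sup>+t. ennreal (cmod (\<psi> s)) * ennreal (cmod (\<psi> t)) * ennreal (gauss_hat c (s - t)) \<partial>lebesgue)"
      using c by (intro nn_integral_cong) (simp add: norm_mult ennreal_mult mult_ac)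
    finally show "ennreal (cmod (FT1 1 u s * \<psi> s))
      \<le> (\<integral>\<^sup>+t. ennreal (cmod (\<psi> s)) * ennreal (cmod (\<psi> t)) * ennreal (gauss_hat c (s - t)) \<partial>lebesgue)" .
  qed
  finally have "2 * (\<integral>\<^sup>+x. ennreal ((cmod (FT1 1 \<psi> x))\<^sup>2 * gauss c x) \<partial>lebesgue) \<le> 2 * ?I"
    by (rule mult_left_mono) simp
  also have "\<dots> \<le> ((\<integral>\<^sup>+x. (ennreal (cmod (\<psi> x)))\<^sup>2 \<partial>lebesgue) + (\<integral>\<^sup>+x. (ennreal (cmod (\<psi> x)))\<^sup>2 \<partial>lebesgue))
      * (\<integral>\<^sup>+x. ennreal (gauss_hat c x) \<partial>lebesgue)"
    by (rule schur_bound) measurable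
  also have "\<dots> = 2 * (ennreal (2 * pi) * (\<integral>\<^sup>+x. (ennreal (cmod (\<psi> x)))\<^sup>2 \<partial>lebesgue))"
    unfolding nn_integral_gauss_hat[OF c] mult_2[symmetric] by (simp only: mult_ac)
  finally show ?thesis by (subst (asm) ennreal_mult_le_mult_iff) auto
qed

text \<open>As c grows the windows tend to 1 and the bound stays the same, so Fatou's lemma removes
  the window.\<close>

lemma nn_integral_FT1_le:
  assumes \<psi>: "integrable lebesgue \<psi>"
  shows "(\<integral>\<^sup>+x. ennreal ((cmod (FT1 1 \<psi> x))\<^sup>2) \<partial>lebesgue)
    \<le> ennreal (2 * pi) * (\<integral>\<^sup>+x. (ennreal (cmod (\<psi> x)))\<^sup>2 \<partial>lebesgue)"
proof (rule fatou_bound)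
  have [measurable]: "\<psi> \<in> borel_measurable lebesgue" "gauss c \<in> borel_measurable lebesgue" for c
    using \<psi> by (auto intro: borel_imp_lebesgue_measurable)
  show "(\<lambda>x. ennreal ((cmod (FT1 1 \<psi> x))\<^sup>2 * gauss (real (Suc n)) x)) \<in> borel_measurable lebesgue" for n
    by measurable
  have "(\<lambda>n. gauss (real (Suc n)) x) \<longlonglongrightarrow> 1" for x
  proof -
    have "(\<lambda>n. exp (- (x * inverse (real (Suc n)))\<^sup>2 / 2)) \<longlonglongrightarrow> exp (- (x * 0)\<^sup>2 / 2)"
      by (intro tendsto_exp tendsto_divide tendsto_minus tendsto_power tendsto_const tendsto_mult
          LIMSEQ_inverse_real_of_nat) simp
    moreover have "exp (- (x * 0)\<^sup>2 / 2) = (1 :: real)" by simp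
    ultimately show ?thesis unfolding gauss_def divide_inverse[of x] by (simp only:)
  qed
  then have "(\<lambda>n. (cmod (FT1 1 \<psi> x))\<^sup>2 * gauss (real (Suc n)) x) \<longlonglongrightarrow> (cmod (FT1 1 \<psi> x))\<^sup>2 * 1" for x
    by (intro tendsto_intros)
  then show "AE x in lebesgue. (\<lambda>n. ennreal ((cmod (FT1 1 \<psi> x))\<^sup>2 * gauss (real (Suc n)) x)) \<longlonglongrightarrow> ennreal ((cmod (FT1 1 \<psi> x))\<^sup>2)"
    by (intro AE_I2 tendsto_ennrealI) simp
  show "\<forall>\<^sub>F n in sequentially. (\<integral>\<^sup>+x. ennreal ((cmod (FT1 1 \<psi> x))\<^sup>2 * gauss (real (Suc n)) x) \<partial>lebesgue)
    \<le> ennreal (2 * pi) * (\<integral>\<^sup>+x. (ennreal (cmod (\<psi> x)))\<^sup>2 \<partial>lebesgue)"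
    by (intro always_eventually allI nn_integral_FT1_gauss_le \<psi>) simp
qed

section \<open>Square integrable functions and the transform on L^2\<close>

lemma L2_iff: "f \<in> L2 \<longleftrightarrow> f \<in> borel_measurable lebesgue \<and> (\<integral>\<^sup>+x. ennreal ((cmod (f x))\<^sup>2) \<partial>lebesgue) < \<infinity>"
proof (cases "f \<in> borel_measurable lebesgue")
  case True
  note [measurable] = this
  show ?thesis unfolding L2_def integrable_iff_bounded using True by simp
qed (simp add: L2_def)

lemma L2_measurable: "f \<in> L2 \<Longrightarrow> f \<in> borel_measurable lebesgue"
  by (simp add: L2_def)

definition sqnorm :: "(real \<Rightarrow> complex) \<Rightarrow> real" where
  "sqnorm f = (\<integral>x. (cmod (f x))\<^sup>2 \<partial>lebesgue)"

lemma sqnorm_nonneg [simp]: "0 \<le> sqnorm f"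
  by (simp add: sqnorm_def)

lemma nn_integral_sqnorm:
  assumes "f \<in> L2" shows "(\<integral>\<^sup>+x. ennreal ((cmod (f x))\<^sup>2) \<partial>lebesgue) = ennreal (sqnorm f)"
  using assms unfolding sqnorm_def L2_def by (intro nn_integral_eq_integral) auto

lemma L2I:
  assumes "f \<in> borel_measurable lebesgue" "(\<integral>\<^sup>+x. ennreal ((cmod (f x))\<^sup>2) \<partial>lebesgue) \<le> ennreal C" "C \<ge> 0"
  shows "f \<in> L2" "sqnorm f \<le> C"
proof -
  have "(\<integral>\<^sup>+x. ennreal ((cmod (f x))\<^sup>2) \<partial>lebesgue) < \<infinity>" using assms(2) by (rule le_less_trans) simp
  then show f: "f \<in> L2" using assms(1) by (simp add: L2_iff)
  show "sqnorm f \<le> C" using assms(2,3) nn_integral_sqnorm[OF f] by (simp add: ennreal_le_iff)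
qed

lemma FT1_L2:
  assumes "\<psi> \<in> L2" "integrable lebesgue \<psi>"
  shows "FT1 1 \<psi> \<in> L2" "sqnorm (FT1 1 \<psi>) \<le> 2 * pi * sqnorm \<psi>"
proof -
  have "(\<integral>\<^sup>+x. ennreal ((cmod (FT1 1 \<psi> x))\<^sup>2) \<partial>lebesgue) \<le> ennreal (2 * pi * sqnorm \<psi>)"
    using nn_integral_FT1_le[OF assms(2)] nn_integral_sqnorm[OF assms(1)] by (simp add: ennreal_power ennreal_mult)
  from L2I[OF FT1_measurable[OF L2_measurable[OF assms(1)]] this]
  show "FT1 1 \<psi> \<in> L2" "sqnorm (FT1 1 \<psi>) \<le> 2 * pi * sqnorm \<psi>" by simp_all
qed

lemma L2_dominated:
  assumes "g \<in> borel_measurable lebesgue" "f \<in> L2" "\<And>x. cmod (g x) \<le> cmod (f x)"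
  shows "g \<in> L2"
proof -
  have "(\<integral>\<^sup>+x. ennreal ((cmod (g x))\<^sup>2) \<partial>lebesgue) \<le> (\<integral>\<^sup>+x. ennreal ((cmod (f x))\<^sup>2) \<partial>lebesgue)"
    using assms(3) by (intro nn_integral_mono ennreal_leI power_mono) auto
  then show ?thesis using assms by (auto simp: L2_iff intro: le_less_trans)
qed

lemma L2_scale: "f \<in> L2 \<Longrightarrow> (\<lambda>x. c * f x) \<in> L2"
  by (auto simp: L2_def norm_mult power_mult_distrib)

lemma L2_add:
  assumes "f \<in> L2" "g \<in> L2" shows "(\<lambda>x. f x + g x) \<in> L2"
proof -
  have [measurable]: "f \<in> borel_measurable lebesgue" "g \<in> borel_measurable lebesgue"
    using assms by (auto dest: L2_measurable)
  have int: "integrable lebesgue (\<lambda>x. 2 * (cmod (f x))\<^sup>2 + 2 * (cmod (g x))\<^sup>2)"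
    using assms by (auto simp: L2_def)
  have "(cmod (f x + g x))\<^sup>2 \<le> 2 * (cmod (f x))\<^sup>2 + 2 * (cmod (g x))\<^sup>2" for x
  proof -
    have "(cmod (f x + g x))\<^sup>2 \<le> (cmod (f x) + cmod (g x))\<^sup>2"
      by (intro power_mono norm_triangle_ineq) simp
    also have "\<dots> \<le> 2 * (cmod (f x))\<^sup>2 + 2 * (cmod (g x))\<^sup>2"
      using sum_squares_bound[of "cmod (f x)" "cmod (g x)"] by (simp add: power2_sum)
    finally show ?thesis .
  qed
  then have "integrable lebesgue (\<lambda>x. (cmod (f x + g x))\<^sup>2)"
    by (intro Bochner_Integration.integrable_bound[OF int] AE_I2) auto
  then show ?thesis by (simp add: L2_def)
qed

lemma L2_diff: "f \<in> L2 \<Longrightarrow> g \<in> L2 \<Longrightarrow> (\<lambda>x. f x - g x) \<in> L2"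
  using L2_add[of f "\<lambda>x. - 1 * g x"] L2_scale[of g "-1"] by simp

lemma L2_cauchy_schwarz:
  assumes f: "f \<in> L2" and g: "g \<in> L2"
  shows "integrable lebesgue (\<lambda>x. f x * g x)"
    "(cmod (\<integral>x. f x * g x \<partial>lebesgue))\<^sup>2 \<le> sqnorm f * sqnorm g"
proof -
  have [measurable]: "f \<in> borel_measurable lebesgue" "g \<in> borel_measurable lebesgue"
    using assms by (auto dest: L2_measurable)
  let ?I = "\<integral>\<^sup>+x. ennreal (cmod (f x * g x)) \<partial>lebesgue"
  have "?I\<^sup>2 = (\<integral>\<^sup>+x. ennreal (cmod (f x)) * ennreal (cmod (g x)) \<partial>lebesgue)\<^sup>2"
    by (simp add: norm_mult ennreal_mult)
  also have "\<dots> \<le> (\<integral>\<^sup>+x. (ennreal (cmod (f x)))\<^sup>2 \<partial>lebesgue) * (\<integral>\<^sup>+x. (ennreal (cmod (g x)))\<^sup>2 \<partial>lebesgue)"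
    by (rule Cauchy_Schwarz_nn_integral) measurable
  also have "\<dots> = ennreal (sqnorm f * sqnorm g)"
    using nn_integral_sqnorm[OF f] nn_integral_sqnorm[OF g] by (simp add: ennreal_power ennreal_mult)
  finally have I: "?I\<^sup>2 \<le> ennreal (sqnorm f * sqnorm g)" .
  then have "?I\<^sup>2 < \<infinity>" by (rule le_less_trans) simp
  then have "?I < \<infinity>" by (cases ?I) (auto simp: power2_eq_square ennreal_top_mult)
  then show int: "integrable lebesgue (\<lambda>x. f x * g x)" by (intro integrableI_bounded) auto
  have "ennreal ((cmod (\<integral>x. f x * g x \<partial>lebesgue))\<^sup>2) = (ennreal (cmod (\<integral>x. f x * g x \<partial>lebesgue)))\<^sup>2"
    by (simp add: ennreal_power)
  also have "\<dots> \<le> ?I\<^sup>2" by (intro power_mono integral_norm_bound_ennreal int) simp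
  also note I
  finally show "(cmod (\<integral>x. f x * g x \<partial>lebesgue))\<^sup>2 \<le> sqnorm f * sqnorm g"
    by (simp add: ennreal_le_iff)
qed

lemma L2_weak_limit:
  assumes v: "\<And>k. v k \<in> L2" and g: "g \<in> L2" and lim: "(\<lambda>k. sqnorm (v k)) \<longlonglongrightarrow> 0"
  shows "(\<lambda>k. \<integral>x. v k x * g x \<partial>lebesgue) \<longlonglongrightarrow> 0"
proof -
  let ?I = "\<lambda>k. \<integral>x. v k x * g x \<partial>lebesgue"
  have "(\<lambda>k. sqnorm (v k) * sqnorm g) \<longlonglongrightarrow> 0 * sqnorm g" by (intro tendsto_intros lim)
  then have up: "(\<lambda>k. sqnorm (v k) * sqnorm g) \<longlonglongrightarrow> 0" by simp
  have "(\<lambda>k. (cmod (?I k))\<^sup>2) \<longlonglongrightarrow> 0"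
    by (rule tendsto_sandwich[OF _ _ tendsto_const up]) (auto intro!: always_eventually L2_cauchy_schwarz(2)[OF v g])
  then have "(\<lambda>k. sqrt ((cmod (?I k))\<^sup>2)) \<longlonglongrightarrow> sqrt 0" by (rule tendsto_real_sqrt)
  then show ?thesis by (simp add: tendsto_norm_zero_iff)
qed

text \<open>The weights 2^k still leave a convergent sum C 2^(-k) of squared norms. So almost
  everywhere the weighted squares have a finite sum B, each increment is at most sqrt(B) times
  sqrt(1/2)^k, and the telescoping series converges.\<close>

lemma fast_L2_Cauchy_converges:
  assumes u[measurable]: "\<And>k. u k \<in> borel_measurable lebesgue"
    and bound: "\<And>k. (\<integral>\<^sup>+x. ennreal ((cmod (u (Suc k) x - u k x))\<^sup>2) \<partial>lebesgue) \<le> ennreal (C * (1/4)^k)"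
    and C: "C \<ge> 0"
  obtains h :: "real \<Rightarrow> complex" where "h \<in> borel_measurable lebesgue" "AE x in lebesgue. (\<lambda>k. u k x) \<longlonglongrightarrow> h x"
proof -
  define h where "h x = lim (\<lambda>k. u k x)" for x
  let ?d = "\<lambda>k x. u (Suc k) x - u k x"
  have "(\<integral>\<^sup>+x. (\<Sum>k. ennreal (2^k) * ennreal ((cmod (?d k x))\<^sup>2)) \<partial>lebesgue)
    = (\<Sum>k. ennreal (2^k) * (\<integral>\<^sup>+x. ennreal ((cmod (?d k x))\<^sup>2) \<partial>lebesgue))"
    by (subst nn_integral_suminf) (auto simp: nn_integral_cmult)
  also have "\<dots> \<le> (\<Sum>k. ennreal (C * (1/2)^k))"
  proof (intro suminf_le)
    fix k
    have "ennreal (2^k) * (\<integral>\<^sup>+x. ennreal ((cmod (?d k x))\<^sup>2) \<partial>lebesgue) \<le> ennreal (2^k) * ennreal (C * (1/4)^k)"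
      by (intro mult_left_mono bound) simp
    also have "\<dots> = ennreal (2^k * (C * (1/4)^k))" using C by (intro ennreal_mult[symmetric]) auto
    also have "2^k * (C * (1/4)^k) = C * (2 * (1/4))^k" by (simp only: power_mult_distrib mult_ac)
    finally show "ennreal (2^k) * (\<integral>\<^sup>+x. ennreal ((cmod (?d k x))\<^sup>2) \<partial>lebesgue) \<le> ennreal (C * (1/2)^k)"
      by simp
  qed auto
  also have "\<dots> = ennreal (\<Sum>k. C * (1/2)^k)"
    using C by (intro suminf_ennreal2 summable_mult summable_geometric) auto
  finally have "(\<integral>\<^sup>+x. (\<Sum>k. ennreal (2^k) * ennreal ((cmod (?d k x))\<^sup>2)) \<partial>lebesgue) \<noteq> \<infinity>"
    by (auto simp: top_unique)
  then have "AE x in lebesgue. (\<Sum>k. ennreal (2^k) * ennreal ((cmod (?d k x))\<^sup>2)) \<noteq> \<infinity>"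
    by (intro nn_integral_noteq_infinite) measurable
  then have "AE x in lebesgue. (\<lambda>k. u k x) \<longlonglongrightarrow> h x"
  proof eventually_elim
    case (elim x)
    let ?S = "\<Sum>k. ennreal (2^k) * ennreal ((cmod (?d k x))\<^sup>2)"
    obtain B where B: "B \<ge> 0" "?S = ennreal B" using elim by (cases ?S) auto
    have le: "cmod (?d k x) \<le> sqrt B * (sqrt (1/2))^k" for k
    proof -
      have "ennreal (2^k) * ennreal ((cmod (?d k x))\<^sup>2) \<le> ?S"
        using sum_le_suminf[of "\<lambda>k. ennreal (2^k) * ennreal ((cmod (?d k x))\<^sup>2)" "{k}"] by simp
      then have "ennreal (2^k * (cmod (?d k x))\<^sup>2) \<le> ennreal B" using B by (simp add: ennreal_mult)
      then have "2^k * (cmod (?d k x))\<^sup>2 \<le> B" using B by (simp add: ennreal_le_iff)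
      then have "(cmod (?d k x))\<^sup>2 \<le> B * (1/2)^k" by (simp add: field_simps power_divide)
      then have "sqrt ((cmod (?d k x))\<^sup>2) \<le> sqrt (B * (1/2)^k)" by (rule real_sqrt_le_mono)
      then show ?thesis by (simp add: real_sqrt_mult real_sqrt_power)
    qed
    have "summable (\<lambda>k. sqrt B * (sqrt (1/2))^k)"
      by (intro summable_mult summable_geometric) (simp add: real_sqrt_divide)
    then have "summable (\<lambda>k. ?d k x)" by (rule summable_comparison_test'[where N=0]) (use le in auto)
    then have "convergent (\<lambda>n. \<Sum>k<n. ?d k x)" by (simp add: summable_iff_convergent)
    then have "convergent (\<lambda>n. u n x - u 0 x)" using sum_lessThan_telescope[of "\<lambda>k. u k x"] by simp
    then have "convergent (\<lambda>n. (u n x - u 0 x) + u 0 x)" by (intro convergent_add convergent_const)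
    then show ?case by (simp add: h_def convergent_LIMSEQ_iff)
  qed
  moreover have "h \<in> borel_measurable lebesgue"
    unfolding h_def by (rule borel_measurable_lim_metric) (rule u)
  ultimately show ?thesis using that by blast
qed

lemma FT1_diff:
  assumes "integrable lebesgue f" "integrable lebesgue g"
  shows "FT1 \<sigma> (\<lambda>x. f x - g x) x = FT1 \<sigma> f x - FT1 \<sigma> g x"
proof -
  have *: "integrable lebesgue (\<lambda>t. f t * exp (\<i> * complex_of_real (\<sigma> * t * x)))"
    if "integrable lebesgue f" for f
  proof (rule Bochner_Integration.integrable_bound[OF that])
    have [measurable]: "f \<in> borel_measurable lebesgue" using that by simp
    have [measurable]: "(\<lambda>y. \<sigma> * y * x) \<in> borel_measurable lebesgue"
      by (rule borel_imp_lebesgue_measurable) measurable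
    show "(\<lambda>t. f t * exp (\<i> * complex_of_real (\<sigma> * t * x))) \<in> borel_measurable lebesgue" by measurable
  qed (simp add: norm_mult)
  show ?thesis unfolding FT1_def left_diff_distrib using *[OF assms(1)] *[OF assms(2)] by simp
qed

lemma bounded_support_L2:
  assumes "h \<in> borel_measurable lebesgue" "\<And>x. cmod (h x) \<le> c * indicator {-R..R::real} x"
  shows "h \<in> L2" "integrable lebesgue h"
proof -
  have [measurable]: "h \<in> borel_measurable lebesgue" by fact
  have ind: "integrable lebesgue (\<lambda>x. indicator {-R..R} x :: real)"
    by (rule integrable_real_indicator) (auto simp: emeasure_lborel_Icc_eq)
  show "integrable lebesgue h"
    using integrable_mult_right[OF ind, of c] assms(1)
    by (rule Bochner_Integration.integrable_bound) (use assms(2) in \<open>auto intro: order_trans[OF _ abs_ge_self]\<close>)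
  have "integrable lebesgue (\<lambda>x. (cmod (h x))\<^sup>2)"
  proof (rule Bochner_Integration.integrable_bound[OF integrable_mult_right[OF ind, of "c\<^sup>2"]])
    have *: "(cmod (h x))\<^sup>2 \<le> (c * indicator {-R..R} x)\<^sup>2" for x using assms(2) by (intro power_mono) auto
    have "norm ((cmod (h x))\<^sup>2) \<le> norm (c\<^sup>2 * indicator {-R..R} x)" for x
      using *[of x] by (cases "x \<in> {-R..R}") simp_all
    then show "AE x in lebesgue. norm ((cmod (h x))\<^sup>2) \<le> norm (c\<^sup>2 * indicator {-R..R} x)"
      by (rule AE_I2)
  qed measurable
  then show "h \<in> L2" using assms(1) by (simp add: L2_def)
qed

text \<open>Bounded functions of bounded support belong to the test class of \<open>FT2_rel\<close>,
  and they already separate elements of \<open>L2\<close>.\<close>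

lemma FT2_rel_unique:
  assumes "FT2_rel \<sigma> f h1" "FT2_rel \<sigma> f h2"
  shows "AE x in lebesgue. h1 x = h2 x"
proof -
  have L: "h1 \<in> L2" "h2 \<in> L2" using assms by (auto simp: FT2_rel_def)
  have D: "(\<lambda>x. h1 x - h2 x) \<in> L2" by (rule L2_diff[OF L])
  have "AE x in lebesgue. h1 x - h2 x = 0"
  proof (rule orthogonal_imp_AE_zero[OF L2_measurable[OF D]])
    fix h :: "real \<Rightarrow> complex" and R :: real
    assume h: "h \<in> borel_measurable lebesgue" "\<And>x. cmod (h x) \<le> indicator {-R..R} x"
    have hL: "h \<in> L2" "integrable lebesgue h"
      using bounded_support_L2[of h 1 R] h by simp_all
    have "(\<integral>x. h1 x * h x \<partial>lebesgue) = (\<integral>x. h2 x * h x \<partial>lebesgue)"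
      using assms hL by (simp add: FT2_rel_def)
    then have "(\<integral>x. (h1 x - h2 x) * h x \<partial>lebesgue) = 0"
      using L2_cauchy_schwarz(1)[OF L(1) hL(1)] L2_cauchy_schwarz(1)[OF L(2) hL(1)]
      by (simp add: left_diff_distrib)
    then show "integrable lebesgue (\<lambda>x. (h1 x - h2 x) * h x) \<and> (\<integral>x. (h1 x - h2 x) * h x \<partial>lebesgue) = 0"
      using L2_cauchy_schwarz(1)[OF D hL(1)] by simp
  qed
  then show ?thesis by simp
qed

lemma L2_truncation:
  assumes f: "f \<in> L2"
  shows "(\<lambda>n. sqnorm (\<lambda>x. f x - indicator {- real n..real n} x * f x)) \<longlonglongrightarrow> 0"
proof -
  have [measurable]: "f \<in> borel_measurable lebesgue" using f by (rule L2_measurable)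
  let ?g = "\<lambda>n x. f x - indicator {- real n..real n} x * f x"
  have "(\<lambda>n. \<integral>x. (cmod (?g n x))\<^sup>2 \<partial>lebesgue) \<longlonglongrightarrow> (\<integral>x. (0::real) \<partial>(lebesgue :: real measure))"
  proof (rule integral_dominated_convergence[where w = "\<lambda>x. (cmod (f x))\<^sup>2"])
    show "integrable lebesgue (\<lambda>x. (cmod (f x))\<^sup>2)" using f by (simp add: L2_def)
    show "AE x in lebesgue. (\<lambda>n. (cmod (?g n x))\<^sup>2) \<longlonglongrightarrow> 0"
    proof (rule AE_I2)
      fix x :: real
      obtain n where n: "\<bar>x\<bar> \<le> real n" using real_arch_simple by blast
      have "(cmod (?g m x))\<^sup>2 = 0" if "m \<ge> n" for m
      proof -
        have "x \<in> {- real m..real m}" using n that by (auto simp: abs_le_iff)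
        then show ?thesis by simp
      qed
      then show "(\<lambda>n. (cmod (?g n x))\<^sup>2) \<longlonglongrightarrow> 0"
        by (intro tendsto_eventually eventually_sequentiallyI[of n])
    qed
    show "(\<lambda>x. (cmod (?g n x))\<^sup>2) \<in> borel_measurable lebesgue" for n
    proof -
      have [measurable]: "(\<lambda>x. indicator {- real n..real n} x :: complex) \<in> borel_measurable lebesgue"
        by (rule borel_measurable_indicator) simp
      show ?thesis by measurable
    qed
    show "AE x in lebesgue. norm ((cmod (?g n x))\<^sup>2) \<le> (cmod (f x))\<^sup>2" for n
      by (auto simp: indicator_def)
  qed simp
  then show ?thesis by (simp add: sqnorm_def)
qed

text \<open>Truncations of f to bounded intervals are integrable and so have an integral transform.
  Along a subsequence with errors 4^(-k), the Plancherel inequality makes these transforms converge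
  almost everywhere and, through Fatou, in L^2; both sides of the defining identity then pass to the
  limit.\<close>

lemma FT2_exists:
  assumes f: "f \<in> L2"
  obtains h where "FT2_rel 1 f h"
proof -
  have [measurable]: "f \<in> borel_measurable lebesgue" using f by (rule L2_measurable)
  let ?T = "\<lambda>n x. indicator {- real n..real n} x * f x"
  have "\<exists>n. sqnorm (\<lambda>x. f x - ?T n x) \<le> (1/4)^k" for k
  proof -
    have "eventually (\<lambda>n. sqnorm (\<lambda>x. f x - ?T n x) < (1/4)^k) sequentially"
      using L2_truncation[OF f] by (rule order_tendstoD) simp
    then show ?thesis by (auto simp: eventually_sequentially intro: less_imp_le)
  qed
  then obtain N where N: "\<And>k. sqnorm (\<lambda>x. f x - ?T (N k) x) \<le> (1/4)^k" by metis
  define F where "F k = ?T (N k)" for k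
  have F_meas: "F k \<in> borel_measurable lebesgue" for k
    unfolding F_def by (intro borel_measurable_times borel_measurable_indicator) auto
  have F_L2: "F k \<in> L2" for k
    by (rule L2_dominated[OF F_meas f]) (simp add: F_def indicator_def)
  have F_int: "integrable lebesgue (F k)" for k
  proof -
    have ind: "(\<lambda>x. indicator {- real (N k)..real (N k)} x) \<in> L2"
      by (rule bounded_support_L2[where c = 1 and R = "real (N k)"]) (auto split: split_indicator intro!: borel_measurable_indicator)
    show ?thesis unfolding F_def by (rule L2_cauchy_schwarz(1)[OF ind f])
  qed
  have fF: "(\<lambda>x. f x - F k x) \<in> L2" for k by (rule L2_diff[OF f F_L2])
  have fF_le: "sqnorm (\<lambda>x. f x - F k x) \<le> (1/4)^k" for k using N by (simp add: F_def)
  \<comment> \<open>Where two truncations of f differ, one of them is 0 and the other equals f. So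
    the square of their difference is at most the sum of the squares of the two errors, without the
    usual factor 2.\<close>
  have FF: "(\<integral>\<^sup>+x. (ennreal (cmod (F m x - F k x)))\<^sup>2 \<partial>lebesgue) \<le> ennreal (2 * (1/4)^k)" if "m \<ge> k" for m k
  proof -
    have "(\<integral>\<^sup>+x. (ennreal (cmod (F m x - F k x)))\<^sup>2 \<partial>lebesgue)
      \<le> (\<integral>\<^sup>+x. ennreal ((cmod (f x - F m x))\<^sup>2) + ennreal ((cmod (f x - F k x))\<^sup>2) \<partial>lebesgue)"
      by (intro nn_integral_mono) (auto simp: F_def indicator_def ennreal_power)
    also have "\<dots> = ennreal (sqnorm (\<lambda>x. f x - F m x)) + ennreal (sqnorm (\<lambda>x. f x - F k x))"
      using L2_measurable[OF fF] by (subst nn_integral_add) (auto simp: nn_integral_sqnorm[OF fF])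
    also have "\<dots> = ennreal (sqnorm (\<lambda>x. f x - F m x) + sqnorm (\<lambda>x. f x - F k x))" by simp
    also have "\<dots> \<le> ennreal (2 * (1/4)^k)"
    proof (rule ennreal_leI)
      have "(1/4) ^ m \<le> (1/4 :: real) ^ k" by (rule power_decreasing[OF that]) auto
      with fF_le[of k] fF_le[of m]
      show "sqnorm (\<lambda>x. f x - F m x) + sqnorm (\<lambda>x. f x - F k x) \<le> 2 * (1/4)^k" by linarith
    qed
    finally show ?thesis .
  qed
  define u where "u k = FT1 1 (F k)" for k
  have u_meas: "u k \<in> borel_measurable lebesgue" for k unfolding u_def by (rule FT1_measurable[OF F_meas])
  have uu: "(\<integral>\<^sup>+x. ennreal ((cmod (u m x - u k x))\<^sup>2) \<partial>lebesgue) \<le> ennreal (4 * pi * (1/4)^k)" if "m \<ge> k" for m k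
  proof -
    have "(\<integral>\<^sup>+x. ennreal ((cmod (u m x - u k x))\<^sup>2) \<partial>lebesgue)
      = (\<integral>\<^sup>+x. ennreal ((cmod (FT1 1 (\<lambda>x. F m x - F k x) x))\<^sup>2) \<partial>lebesgue)"
      unfolding u_def FT1_diff[OF F_int F_int] ..
    also have "\<dots> \<le> ennreal (2 * pi) * (\<integral>\<^sup>+x. (ennreal (cmod (F m x - F k x)))\<^sup>2 \<partial>lebesgue)"
      by (rule nn_integral_FT1_le) (use F_int in auto)
    also have "\<dots> \<le> ennreal (2 * pi) * ennreal (2 * (1/4)^k)" by (intro mult_left_mono FF that) simp
    also have "\<dots> = ennreal (4 * pi * (1/4)^k)" by (simp flip: ennreal_mult)
    finally show ?thesis .
  qed
  obtain h where h: "h \<in> borel_measurable lebesgue" "AE x in lebesgue. (\<lambda>k. u k x) \<longlonglongrightarrow> h x"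
    by (rule fast_L2_Cauchy_converges[of u "4 * pi", OF u_meas uu]) auto
  note [measurable] = u_meas h(1)
  have uL2: "u k \<in> L2" for k unfolding u_def by (rule FT1_L2(1)[OF F_L2 F_int])
  have hu: "(\<lambda>x. h x - u k x) \<in> L2" "sqnorm (\<lambda>x. h x - u k x) \<le> 4 * pi * (1/4)^k" for k
  proof -
    have "(\<integral>\<^sup>+x. ennreal ((cmod (h x - u k x))\<^sup>2) \<partial>lebesgue) \<le> ennreal (4 * pi * (1/4)^k)"
    proof (rule fatou_bound[where g = "\<lambda>m x. ennreal ((cmod (u m x - u k x))\<^sup>2)"])
      show "AE x in lebesgue. (\<lambda>m. ennreal ((cmod (u m x - u k x))\<^sup>2)) \<longlonglongrightarrow> ennreal ((cmod (h x - u k x))\<^sup>2)"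
        using h(2) by eventually_elim (intro tendsto_ennrealI tendsto_intros)
      show "\<forall>\<^sub>F m in sequentially. (\<integral>\<^sup>+x. ennreal ((cmod (u m x - u k x))\<^sup>2) \<partial>lebesgue) \<le> ennreal (4 * pi * (1/4)^k)"
        using uu by (rule eventually_sequentiallyI)
    qed measurable
    from L2I[OF _ this] show "(\<lambda>x. h x - u k x) \<in> L2" "sqnorm (\<lambda>x. h x - u k x) \<le> 4 * pi * (1/4)^k"
      by simp_all
  qed
  have hL2: "h \<in> L2" using L2_add[OF hu(1) uL2, of 0 0] by simp
  have geo: "(\<lambda>k. c * (1/4)^k) \<longlonglongrightarrow> 0" for c :: real
    using tendsto_mult_left[OF LIMSEQ_realpow_zero[of "1/4 :: real"], of c] by simp
  have "FT2_rel 1 f h"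
    unfolding FT2_rel_def
  proof (intro conjI allI impI hL2)
    fix \<psi> assume \<psi>: "\<psi> \<in> L2" "integrable lebesgue \<psi>"
    have "(\<lambda>k. \<integral>x. (h x - u k x) * \<psi> x \<partial>lebesgue) \<longlonglongrightarrow> 0"
      by (rule L2_weak_limit[OF hu(1) \<psi>(1)], rule tendsto_sandwich[OF _ _ tendsto_const geo[of "4 * pi"]])
         (auto intro!: always_eventually hu(2))
    moreover have "(\<integral>x. (h x - u k x) * \<psi> x \<partial>lebesgue) = (\<integral>x. h x * \<psi> x \<partial>lebesgue) - (\<integral>x. u k x * \<psi> x \<partial>lebesgue)" for k
      using L2_cauchy_schwarz(1)[OF hL2 \<psi>(1)] L2_cauchy_schwarz(1)[OF uL2 \<psi>(1)] by (simp add: left_diff_distrib)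
    moreover have "(\<integral>x. u k x * \<psi> x \<partial>lebesgue) = (\<integral>x. F k x * FT1 1 \<psi> x \<partial>lebesgue)" for k
      unfolding u_def by (rule FT1_swap[OF F_int \<psi>(2), symmetric])
    ultimately have 1: "(\<lambda>k. (\<integral>x. h x * \<psi> x \<partial>lebesgue) - (\<integral>x. F k x * FT1 1 \<psi> x \<partial>lebesgue)) \<longlonglongrightarrow> 0" by simp
    have FT\<psi>: "FT1 1 \<psi> \<in> L2" by (rule FT1_L2(1)[OF \<psi>])
    have "(\<lambda>k. \<integral>x. (f x - F k x) * FT1 1 \<psi> x \<partial>lebesgue) \<longlonglongrightarrow> 0"
      by (rule L2_weak_limit[OF fF FT\<psi>], rule tendsto_sandwich[OF _ _ tendsto_const geo[of 1]])
         (use fF_le in auto)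
    moreover have "(\<integral>x. (f x - F k x) * FT1 1 \<psi> x \<partial>lebesgue)
       = (\<integral>x. f x * FT1 1 \<psi> x \<partial>lebesgue) - (\<integral>x. F k x * FT1 1 \<psi> x \<partial>lebesgue)" for k
      using L2_cauchy_schwarz(1)[OF f FT\<psi>] L2_cauchy_schwarz(1)[OF F_L2 FT\<psi>] by (simp add: left_diff_distrib)
    ultimately have 2: "(\<lambda>k. (\<integral>x. f x * FT1 1 \<psi> x \<partial>lebesgue) - (\<integral>x. F k x * FT1 1 \<psi> x \<partial>lebesgue)) \<longlonglongrightarrow> 0" by simp
    have "(\<lambda>k. (\<integral>x. h x * \<psi> x \<partial>lebesgue) - (\<integral>x. f x * FT1 1 \<psi> x \<partial>lebesgue)) \<longlonglongrightarrow> 0"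
      using tendsto_diff[OF 1 2] by simp
    then show "(\<integral>x. h x * \<psi> x \<partial>lebesgue) = (\<integral>x. f x * FT1 1 \<psi> x \<partial>lebesgue)"
      by (simp add: LIMSEQ_const_iff)
  qed
  then show ?thesis by (rule that)
qed

section \<open>Gaussian convolution operators\<close>

definition gauss_conv :: "real \<Rightarrow> (real \<Rightarrow> complex) \<Rightarrow> real \<Rightarrow> complex" where
  "gauss_conv c f x = (\<integral>y. complex_of_real (gauss c (x - y)) * f y \<partial>lebesgue)"

text \<open>Defined at every point, in contrast to the Bochner integral in
  \<open>gauss_conv\<close>. It dominates that integral even where the latter is 0 by convention,
  and its finiteness at x yields convergence there.\<close>

definition abs_gauss_conv :: "real \<Rightarrow> (real \<Rightarrow> complex) \<Rightarrow> real \<Rightarrow> ennreal" where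
  "abs_gauss_conv c f x = (\<integral>\<^sup>+y. ennreal (cmod (f y)) * ennreal (gauss c (x - y)) \<partial>lebesgue)"

lemma gauss_shift_measurable [measurable]: "(\<lambda>y. gauss c (x - y)) \<in> borel_measurable lebesgue"
  by (rule borel_imp_lebesgue_measurable) measurable

lemma gauss_conv_measurable [measurable]:
  assumes [measurable]: "f \<in> borel_measurable lebesgue"
  shows "gauss_conv c f \<in> borel_measurable lebesgue"
proof -
  have [measurable]: "(\<lambda>p. f (snd p)) \<in> borel_measurable (lebesgue \<Otimes>\<^sub>M lebesgue)"
    by (rule measurable_compose[OF measurable_snd assms])
  have "(\<lambda>(x, y). complex_of_real (gauss c (x - y)) * f y) \<in> borel_measurable (lebesgue \<Otimes>\<^sub>M lebesgue)"
    unfolding case_prod_beta by measurable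
  then show ?thesis unfolding gauss_conv_def by (rule lebesgue.borel_measurable_lebesgue_integral)
qed

lemma abs_gauss_conv_eq:
  "abs_gauss_conv c f x = (\<integral>\<^sup>+y. ennreal (cmod (complex_of_real (gauss c (x - y)) * f y)) \<partial>lebesgue)"
  unfolding abs_gauss_conv_def by (intro nn_integral_cong) (simp add: norm_mult ennreal_mult mult.commute)

lemma norm_gauss_conv_le: "ennreal (cmod (gauss_conv c f x)) \<le> abs_gauss_conv c f x"
proof (cases "integrable lebesgue (\<lambda>y. complex_of_real (gauss c (x - y)) * f y)")
  case True
  then show ?thesis unfolding abs_gauss_conv_eq gauss_conv_def by (rule integral_norm_bound_ennreal)
qed (simp add: gauss_conv_def not_integrable_integral_eq)

lemma nn_integral_gauss:
  assumes "c > 0"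
  obtains K where "K \<ge> 0" "(\<integral>\<^sup>+x. ennreal (gauss c x) \<partial>lebesgue) = ennreal K"
  by (rule that[of "\<integral>x. gauss c x \<partial>lebesgue"])
    (auto intro!: nn_integral_eq_integral integrable_gauss assms)

text \<open>Young's inequality for L^1 and L^2: Cauchy-Schwarz after splitting the kernel into two
  square roots, then Tonelli.\<close>

lemma gauss_conv_L2:
  assumes f: "f \<in> L2" and c: "c > 0"
  shows "gauss_conv c f \<in> L2"
proof -
  have [measurable]: "f \<in> borel_measurable lebesgue" using f by (rule L2_measurable)
  obtain K where K: "K \<ge> 0" "(\<integral>\<^sup>+x. ennreal (gauss c x) \<partial>lebesgue) = ennreal K"
    using nn_integral_gauss[OF c] by blast
  have gl: "(\<lambda>x. ennreal (gauss c x)) \<in> borel_measurable lebesgue"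
    by (rule borel_imp_lebesgue_measurable) measurable
  have le: "ennreal ((cmod (gauss_conv c f x))\<^sup>2)
    \<le> ennreal K * (\<integral>\<^sup>+y. ennreal ((cmod (f y))\<^sup>2) * ennreal (gauss c (x - y)) \<partial>lebesgue)" for x
  proof -
    have "ennreal ((cmod (gauss_conv c f x))\<^sup>2) = (ennreal (cmod (gauss_conv c f x)))\<^sup>2"
      by (simp add: ennreal_power)
    also have "\<dots> \<le> (abs_gauss_conv c f x)\<^sup>2" by (intro power_mono norm_gauss_conv_le) simp
    also have "abs_gauss_conv c f x
      = (\<integral>\<^sup>+y. ennreal (sqrt (gauss c (x - y))) * ennreal (cmod (f y) * sqrt (gauss c (x - y))) \<partial>lebesgue)"
      unfolding abs_gauss_conv_def by (intro nn_integral_cong) (simp flip: ennreal_mult)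
    also have "\<dots>\<^sup>2 \<le> (\<integral>\<^sup>+y. (ennreal (sqrt (gauss c (x - y))))\<^sup>2 \<partial>lebesgue)
       * (\<integral>\<^sup>+y. (ennreal (cmod (f y) * sqrt (gauss c (x - y))))\<^sup>2 \<partial>lebesgue)"
      by (rule Cauchy_Schwarz_nn_integral) measurable
    also have "(\<integral>\<^sup>+y. (ennreal (sqrt (gauss c (x - y))))\<^sup>2 \<partial>lebesgue) = (\<integral>\<^sup>+y. ennreal (gauss c (x - y)) \<partial>lebesgue)"
      by (intro nn_integral_cong) (simp add: ennreal_power)
    also have "\<dots> = ennreal K" using nn_integral_shift(2)[OF gl, of x] K(2) by simp
    also have "(\<integral>\<^sup>+y. (ennreal (cmod (f y) * sqrt (gauss c (x - y))))\<^sup>2 \<partial>lebesgue)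
      = (\<integral>\<^sup>+y. ennreal ((cmod (f y))\<^sup>2) * ennreal (gauss c (x - y)) \<partial>lebesgue)"
      by (intro nn_integral_cong) (simp add: ennreal_power power_mult_distrib flip: ennreal_mult)
    finally show ?thesis .
  qed
  have [measurable]: "(\<lambda>p. f (snd p)) \<in> borel_measurable (lebesgue \<Otimes>\<^sub>M lebesgue)"
    by (rule measurable_compose[OF measurable_snd]) simp
  have m: "(\<lambda>x. \<integral>\<^sup>+y. ennreal ((cmod (f y))\<^sup>2) * ennreal (gauss c (x - y)) \<partial>lebesgue) \<in> borel_measurable lebesgue"
    by (rule lebesgue.borel_measurable_nn_integral) (unfold case_prod_beta, measurable)
  have "(\<integral>\<^sup>+x. ennreal ((cmod (gauss_conv c f x))\<^sup>2) \<partial>lebesgue)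
    \<le> (\<integral>\<^sup>+x. ennreal K * (\<integral>\<^sup>+y. ennreal ((cmod (f y))\<^sup>2) * ennreal (gauss c (x - y)) \<partial>lebesgue) \<partial>lebesgue)"
    by (intro nn_integral_mono le)
  also have "\<dots> = ennreal K * (\<integral>\<^sup>+x. (\<integral>\<^sup>+y. ennreal ((cmod (f y))\<^sup>2) * ennreal (gauss c (x - y)) \<partial>lebesgue) \<partial>lebesgue)"
    by (rule nn_integral_cmult[OF m])
  also have "(\<integral>\<^sup>+x. (\<integral>\<^sup>+y. ennreal ((cmod (f y))\<^sup>2) * ennreal (gauss c (x - y)) \<partial>lebesgue) \<partial>lebesgue)
     = (\<integral>\<^sup>+x. ennreal ((cmod (f x))\<^sup>2) \<partial>lebesgue) * (\<integral>\<^sup>+x. ennreal (gauss c x) \<partial>lebesgue)"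
    by (rule nn_integral_convolution[where k = "\<lambda>x. ennreal (gauss c x)"]) measurable
  also have "ennreal K * \<dots> = ennreal (K * (sqnorm f * K))"
    using K by (simp add: nn_integral_sqnorm[OF f] ennreal_mult)
  finally show ?thesis using K(1) by (intro L2I(1)[of _ "K * (sqnorm f * K)"]) auto
qed

text \<open>In the identity to be tested with \<psi>, the symbol is moved onto the transform of
  \<psi>. The resulting \<theta> is again in L^1 and L^2, so the identity for the transform h of f
  applies to it; its own transform is 2 pi times the convolution of \<open>gauss c\<close> with
  \<psi>, and Fubini hands this convolution over to f.\<close>

lemma W0_rel_gauss:
  assumes f: "f \<in> L2" and c: "c > 0"
  shows "W0_rel (\<lambda>x. complex_of_real (gauss_hat c x)) f (gauss_conv c f)"
proof -
  let ?a = "\<lambda>x. complex_of_real (gauss_hat c x)"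
  have [measurable]: "f \<in> borel_measurable lebesgue" using f by (rule L2_measurable)
  obtain h where h: "FT2_rel 1 f h" using FT2_exists[OF f] by blast
  have a_int: "integrable lebesgue ?a" using integrable_gauss_hat[OF c] by simp
  have a_le: "gauss_hat c x \<le> gauss_hat c 0" for x
    using c by (auto simp: gauss_hat_def std_normal_density_def divide_right_mono)
  have "FT2_rel (-1) (\<lambda>x. ?a x * h x) (\<lambda>x. complex_of_real (2 * pi) * gauss_conv c f x)"
    unfolding FT2_rel_def
  proof (intro conjI allI impI L2_scale gauss_conv_L2[OF f c])
    fix \<psi> assume \<psi>: "\<psi> \<in> L2" "integrable lebesgue \<psi>"
    have [measurable]: "\<psi> \<in> borel_measurable lebesgue" using \<psi> by simp
    define \<theta> where "\<theta> t = ?a t * FT1 (-1) \<psi> t" for t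
    have \<theta>_int: "integrable lebesgue \<theta>" unfolding \<theta>_def by (rule integrable_mult_FT1[OF a_int \<psi>(2)])
    let ?I = "\<integral>t. cmod (\<psi> t) \<partial>lebesgue"
    have "\<theta> \<in> L2"
    proof -
      have "(cmod (\<theta> t))\<^sup>2 \<le> gauss_hat c 0 * ?I\<^sup>2 * gauss_hat c t" for t
      proof -
        have "(cmod (\<theta> t))\<^sup>2 = gauss_hat c t * gauss_hat c t * (cmod (FT1 (-1) \<psi> t))\<^sup>2"
          using c by (simp add: \<theta>_def norm_mult power_mult_distrib power2_eq_square)
        also have "\<dots> \<le> gauss_hat c 0 * gauss_hat c t * ?I\<^sup>2"
          using c by (intro mult_mono power_mono FT1_bound a_le) auto
        finally show ?thesis by (simp add: mult_ac)
      qed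
      then have "integrable lebesgue (\<lambda>t. (cmod (\<theta> t))\<^sup>2)"
        using \<theta>_int
        by (intro Bochner_Integration.integrable_bound[OF integrable_mult_right[OF integrable_gauss_hat[OF c], of "gauss_hat c 0 * ?I\<^sup>2"]])
           (auto intro: order_trans[OF _ abs_ge_self])
      then show ?thesis using \<theta>_int by (simp add: L2_def)
    qed
    then have h\<theta>: "(\<integral>x. h x * \<theta> x \<partial>lebesgue) = (\<integral>x. f x * FT1 1 \<theta> x \<partial>lebesgue)"
      using h \<theta>_int by (simp add: FT2_rel_def)
    have FT\<theta>: "FT1 1 \<theta> y = (\<integral>s. complex_of_real (2 * pi * gauss c (y - s)) * \<psi> s \<partial>lebesgue)" for y
      unfolding \<theta>_def by (subst FT1_windowed[OF integrable_gauss_hat[OF c] gauss_hat_measurable \<psi>(2)])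
        (simp only: FT1_modulated_gauss[OF c])
    have "(\<integral>x. ?a x * h x * FT1 (-1) \<psi> x \<partial>lebesgue) = (\<integral>x. h x * \<theta> x \<partial>lebesgue)"
      unfolding \<theta>_def by (intro Bochner_Integration.integral_cong) (simp_all only: mult_ac)
    also have "\<dots> = (\<integral>y. (\<integral>s. f y * (complex_of_real (2 * pi * gauss c (y - s)) * \<psi> s) \<partial>lebesgue) \<partial>lebesgue)"
      unfolding h\<theta> FT\<theta> integral_mult_right_zero ..
    finally have 1: "(\<integral>x. ?a x * h x * FT1 (-1) \<psi> x \<partial>lebesgue) = \<dots>" .
    have [measurable]: "(\<lambda>p. f (fst p)) \<in> borel_measurable (lebesgue \<Otimes>\<^sub>M lebesgue)"
       "(\<lambda>p. \<psi> (snd p)) \<in> borel_measurable (lebesgue \<Otimes>\<^sub>M lebesgue)"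
      by (rule measurable_compose[OF measurable_fst], simp, rule measurable_compose[OF measurable_snd], simp)
    let ?F = "\<lambda>y s. f y * (complex_of_real (2 * pi * gauss c (y - s)) * \<psi> s)"
    have F_meas: "case_prod ?F \<in> borel_measurable (lebesgue \<Otimes>\<^sub>M lebesgue)"
      unfolding case_prod_beta by measurable
    have "integrable (lebesgue \<Otimes>\<^sub>M lebesgue) (case_prod ?F)"
    proof (rule integrableI_bounded[OF F_meas])
      obtain K where K: "K \<ge> 0" "(\<integral>\<^sup>+x. ennreal (gauss c x) \<partial>lebesgue) = ennreal K"
        using nn_integral_gauss[OF c] by blast
      let ?k = "\<lambda>x. ennreal (2 * pi * gauss c x)"
      let ?S = "\<integral>\<^sup>+y. (\<integral>\<^sup>+s. ennreal (cmod (f y)) * ennreal (cmod (\<psi> s)) * ?k (y - s) \<partial>lebesgue) \<partial>lebesgue"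
      have "(\<integral>\<^sup>+x. ?k x \<partial>lebesgue) = ennreal (2 * pi) * ennreal K"
        by (subst K(2)[symmetric], subst nn_integral_cmult[symmetric])
           (auto simp: ennreal_mult intro!: borel_imp_lebesgue_measurable)
      then have k: "(\<integral>\<^sup>+x. ?k x \<partial>lebesgue) = ennreal (2 * pi * K)" using K by (simp add: ennreal_mult)
      have "2 * ?S \<le> ((\<integral>\<^sup>+x. (ennreal (cmod (f x)))\<^sup>2 \<partial>lebesgue) + (\<integral>\<^sup>+x. (ennreal (cmod (\<psi> x)))\<^sup>2 \<partial>lebesgue)) * (\<integral>\<^sup>+x. ?k x \<partial>lebesgue)"
        by (rule schur_bound) measurable
      also have "\<dots> < \<infinity>"
        using nn_integral_sqnorm[OF f] nn_integral_sqnorm[OF \<psi>(1)]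
        by (simp add: k ennreal_power ennreal_mult_less_top)
      finally have S: "?S < \<infinity>" by (auto simp: ennreal_mult_less_top)
      have "(\<integral>\<^sup>+p. ennreal (norm (case_prod ?F p)) \<partial>(lebesgue \<Otimes>\<^sub>M lebesgue))
        = (\<integral>\<^sup>+y. (\<integral>\<^sup>+s. ennreal (norm (case_prod ?F (y, s))) \<partial>lebesgue) \<partial>lebesgue)"
        using F_meas by (intro lebesgue.nn_integral_fst[symmetric]) measurable
      also have "\<dots> = ?S"
        by (intro nn_integral_cong) (simp add: norm_mult ennreal_mult mult_ac)
      finally show "(\<integral>\<^sup>+p. ennreal (norm (case_prod ?F p)) \<partial>(lebesgue \<Otimes>\<^sub>M lebesgue)) < \<infinity>" using S by simp
    qed
    from lebesgue_pair.Fubini_integral[OF this]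
    have 2: "(\<integral>y. (\<integral>s. ?F y s \<partial>lebesgue) \<partial>lebesgue) = (\<integral>s. (\<integral>y. ?F y s \<partial>lebesgue) \<partial>lebesgue)" by simp
    have "(\<integral>y. ?F y s \<partial>lebesgue) = complex_of_real (2 * pi) * gauss_conv c f s * \<psi> s" for s
    proof -
      have "(\<integral>y. ?F y s \<partial>lebesgue) = (\<integral>y. complex_of_real (2 * pi) * (complex_of_real (gauss c (s - y)) * f y) * \<psi> s \<partial>lebesgue)"
      proof (intro Bochner_Integration.integral_cong refl)
        fix y have "gauss c (y - s) = gauss c (s - y)" using gauss_minus[of c "s - y"] by simp
        then show "?F y s = complex_of_real (2 * pi) * (complex_of_real (gauss c (s - y)) * f y) * \<psi> s"
          by (simp add: mult_ac)
      qed
      then show ?thesis unfolding gauss_conv_def by simp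
    qed
    then show "(\<integral>x. complex_of_real (2 * pi) * gauss_conv c f x * \<psi> x \<partial>lebesgue)
      = (\<integral>x. ?a x * h x * FT1 (-1) \<psi> x \<partial>lebesgue)"
      using 1 2 by simp
  qed
  then show ?thesis unfolding W0_rel_def using h by blast
qed

section \<open>Uniqueness of Fourier convolution values\<close>

text \<open>Lebesgue measure is complete, so almost everywhere equality transports measurability; if
  both functions fail to be measurable, both integrals are 0 by convention. Products with an
  arbitrary symbol a are thereby covered.\<close>

lemma lebesgue_integral_cong_AE:
  fixes f g :: "real \<Rightarrow> complex"
  assumes fg: "AE x in lebesgue. f x = g x"
  shows "(\<integral>x. f x \<partial>lebesgue) = (\<integral>x. g x \<partial>lebesgue)"
proof (cases "f \<in> borel_measurable lebesgue")
  case True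
  then show ?thesis using fg borel_measurable_AE[OF True fg] by (intro integral_cong_AE)
next
  case False
  have gf: "AE x in lebesgue. g x = f x" using fg by eventually_elim simp
  have "g \<notin> borel_measurable lebesgue" using False borel_measurable_AE[OF _ gf] by blast
  then have "\<not> integrable lebesgue f" "\<not> integrable lebesgue g"
    using False borel_measurable_integrable by blast+
  then show ?thesis by (simp add: not_integrable_integral_eq)
qed

lemma W0_rel_unique:
  assumes "W0_rel a f g1" "W0_rel a f g2"
  shows "AE x in lebesgue. g1 x = g2 x"
proof -
  obtain h1 where h1: "FT2_rel 1 f h1" "FT2_rel (-1) (\<lambda>x. a x * h1 x) (\<lambda>x. complex_of_real (2 * pi) * g1 x)"
    using assms(1) unfolding W0_rel_def by blast
  obtain h2 where h2: "FT2_rel 1 f h2" "FT2_rel (-1) (\<lambda>x. a x * h2 x) (\<lambda>x. complex_of_real (2 * pi) * g2 x)"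
    using assms(2) unfolding W0_rel_def by blast
  have ae: "AE x in lebesgue. h1 x = h2 x" by (rule FT2_rel_unique[OF h1(1) h2(1)])
  have "FT2_rel (-1) (\<lambda>x. a x * h1 x) (\<lambda>x. complex_of_real (2 * pi) * g2 x)"
    unfolding FT2_rel_def
  proof (intro conjI allI impI)
    show "(\<lambda>x. complex_of_real (2 * pi) * g2 x) \<in> L2" using h2(2) by (simp add: FT2_rel_def)
    fix \<psi> assume \<psi>: "\<psi> \<in> L2" "integrable lebesgue \<psi>"
    have "(\<integral>x. complex_of_real (2 * pi) * g2 x * \<psi> x \<partial>lebesgue) = (\<integral>x. a x * h2 x * FT1 (-1) \<psi> x \<partial>lebesgue)"
      using h2(2) \<psi> unfolding FT2_rel_def by blast
    also have "\<dots> = (\<integral>x. a x * h1 x * FT1 (-1) \<psi> x \<partial>lebesgue)"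
      using ae by (intro lebesgue_integral_cong_AE) (auto elim: eventually_mono)
    finally show "(\<integral>x. complex_of_real (2 * pi) * g2 x * \<psi> x \<partial>lebesgue) = (\<integral>x. a x * h1 x * FT1 (-1) \<psi> x \<partial>lebesgue)" .
  qed
  from FT2_rel_unique[OF h1(2) this] show ?thesis by simp
qed

text \<open>One witness shows that the choice in \<open>W0\<close> satisfies the relation, and
  uniqueness identifies the chosen value up to a null set.\<close>

lemma W0_eqI:
  assumes "W0_rel a f g"
  shows "AE x in lebesgue. W0 a f x = g x"
proof (rule W0_rel_unique[OF _ assms])
  show "W0_rel a f (W0 a f)"
    unfolding W0_def using assms by (rule someI[where P = "W0_rel a f"])
qed

lemma W0_gauss:
  "f \<in> L2 \<Longrightarrow> c > 0 \<Longrightarrow> AE x in lebesgue. W0 (\<lambda>x. complex_of_real (gauss_hat c x)) f x = gauss_conv c f x"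
  by (intro W0_eqI W0_rel_gauss)

lemma W0_zero:
  assumes "f \<in> L2"
  shows "AE x in lebesgue. W0 (\<lambda>x. 0) f x = 0"
proof (rule W0_eqI)
  obtain h where "FT2_rel 1 f h" using FT2_exists[OF assms] by blast
  moreover have "FT2_rel (-1) (\<lambda>x. 0 * h x) (\<lambda>x. complex_of_real (2 * pi) * 0)"
    by (simp add: FT2_rel_def L2_def)
  ultimately show "W0_rel (\<lambda>x. 0) f (\<lambda>x. 0)" unfolding W0_rel_def by blast
qed

section \<open>The maximal operator\<close>

definition local_mass :: "(real \<Rightarrow> complex) \<Rightarrow> real \<Rightarrow> real \<Rightarrow> ennreal" where
  "local_mass f a b = (\<integral>\<^sup>+y. ennreal (cmod (f y)) * indicator {a..b} y \<partial>lebesgue)"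

lemma maximal_fun_eq:
  "maximal_fun f x = (SUP Q\<in>{(a, b). a \<le> x \<and> x \<le> b \<and> a < b}. ennreal (1 / (snd Q - fst Q)) * local_mass f (fst Q) (snd Q))"
  by (simp add: maximal_fun_def local_mass_def)

lemma local_mass_average_le:
  assumes "a \<le> x" "x \<le> b" "a < b"
  shows "ennreal (1 / (b - a)) * local_mass f a b \<le> maximal_fun f x"
  unfolding maximal_fun_eq using assms by (intro SUP_upper2[of "(a, b)"]) auto

lemma local_mass_le:
  assumes "a \<le> x" "x \<le> b" "a < b"
  shows "local_mass f a b \<le> ennreal (b - a) * maximal_fun f x"
proof -
  have "local_mass f a b = ennreal (b - a) * (ennreal (1 / (b - a)) * local_mass f a b)"
    using assms by (simp add: mult.assoc[symmetric] ennreal_mult[symmetric])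
  also have "\<dots> \<le> ennreal (b - a) * maximal_fun f x"
    by (intro mult_left_mono local_mass_average_le assms) simp
  finally show ?thesis .
qed

lemma local_mass_mono: "a' \<le> a \<Longrightarrow> b \<le> b' \<Longrightarrow> local_mass f a b \<le> local_mass f a' b'"
  unfolding local_mass_def by (intro nn_integral_mono mult_left_mono) (auto simp: indicator_def)

text \<open>Slightly enlarged intervals with rational endpoints contain \<open>x\<close> in their interior,
  so that the supremum becomes countable.\<close>

lemma maximal_fun_countable:
  "maximal_fun f x = (SUP Q\<in>{q \<in> \<rat> \<times> \<rat>. fst q < snd q}.
     ennreal (1 / (snd Q - fst Q)) * local_mass f (fst Q) (snd Q) * indicator {fst Q<..<snd Q} x)"
  (is "_ = ?R")
proof (rule antisym)
  show "?R \<le> maximal_fun f x"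
  proof (rule SUP_least)
    fix Q assume "Q \<in> {q \<in> \<rat> \<times> \<rat>. fst q < (snd q :: real)}"
    then show "ennreal (1 / (snd Q - fst Q)) * local_mass f (fst Q) (snd Q) * indicator {fst Q<..<snd Q} x \<le> maximal_fun f x"
      using local_mass_average_le[of "fst Q" x "snd Q" f] by (cases "x \<in> {fst Q<..<snd Q}") auto
  qed
next
  show "maximal_fun f x \<le> ?R"
    unfolding maximal_fun_eq
  proof (rule SUP_least)
    fix Q assume "Q \<in> {(a, b). a \<le> x \<and> x \<le> b \<and> a < b}"
    then obtain a b where Q: "Q = (a, b)" "a \<le> x" "x \<le> b" "a < b" by auto
    \<comment> \<open>Each endpoint moves outwards by less than 1/(n + 1), which explains the length
      b - a + 2/(n + 1). The limit in n recovers the original average.\<close>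
    have "ennreal (1 / (b - a + 2 * inverse (real (Suc n)))) * local_mass f a b \<le> ?R" for n
    proof -
      let ?e = "inverse (real (Suc n))"
      have e: "?e > 0" by simp
      obtain a' where a': "a' \<in> \<rat>" "a - ?e < a'" "a' < a" using Rats_dense_in_real[of "a - ?e" a] e by auto
      obtain b' where b': "b' \<in> \<rat>" "b < b'" "b' < b + ?e" using Rats_dense_in_real[of b "b + ?e"] e by auto
      have "ennreal (1 / (b - a + 2 * ?e)) * local_mass f a b \<le> ennreal (1 / (b' - a')) * local_mass f a' b'"
        using a' b' Q e by (intro mult_mono ennreal_leI local_mass_mono) (auto intro!: divide_left_mono)
      also have "\<dots> = ennreal (1 / (b' - a')) * local_mass f a' b' * indicator {a'<..<b'} x"
        using a' b' Q by simp
      also have "\<dots> \<le> ?R" using a' b' Q by (intro SUP_upper2[of "(a', b')"]) auto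
      finally show ?thesis .
    qed
    moreover have "(\<lambda>n. ennreal (1 / (b - a + 2 * inverse (real (Suc n)))) * local_mass f a b)
      \<longlonglongrightarrow> ennreal (1 / (b - a + 2 * 0)) * local_mass f a b"
    proof (rule tendsto_mult_ennreal[OF _ tendsto_const])
      show "(\<lambda>n. ennreal (1 / (b - a + 2 * inverse (real (Suc n))))) \<longlonglongrightarrow> ennreal (1 / (b - a + 2 * 0))"
        using Q by (intro tendsto_ennrealI tendsto_divide tendsto_add tendsto_mult tendsto_const LIMSEQ_inverse_real_of_nat) simp
    qed (use Q in auto)
    ultimately show "ennreal (1 / (snd Q - fst Q)) * local_mass f (fst Q) (snd Q) \<le> ?R"
      using Q by (intro LIMSEQ_le_const2) auto
  qed
qed

lemma maximal_fun_measurable [measurable]: "maximal_fun f \<in> borel_measurable lebesgue"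
  unfolding maximal_fun_countable[abs_def]
proof (rule borel_measurable_SUP)
  show "countable {q \<in> \<rat> \<times> \<rat>. fst q < (snd q :: real)}"
    by (rule countable_subset[OF _ countable_SIGMA[OF countable_rat countable_rat]]) auto
qed (intro borel_measurable_times_ennreal borel_measurable_indicator borel_measurable_const, simp)

lemma ennreal_le_suminf: "f j \<le> (\<Sum>j. f j :: ennreal)"
  using sum_le_suminf[of f "{j}"] by simp

text \<open>Steps with exponential decay on intervals centred at x. With u = |x - y| / c, the
  inequality (u - 1)^2 >= 0 gives -u^2/2 <= 1/2 - u, whence the constant 1/2; j is the integer part
  of u.\<close>

lemma gauss_le_layers:
  assumes c: "c > 0"
  shows "ennreal (gauss c (x - y)) \<le> (\<Sum>j. ennreal (exp (1/2 - real j)) * indicator {x - c * (real j + 1)..x + c * (real j + 1)} y)"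
proof -
  define u where "u = \<bar>x - y\<bar> / c"
  define j where "j = nat \<lfloor>u\<rfloor>"
  have u: "u \<ge> 0" "real j \<le> u" "u \<le> real j + 1" using c by (auto simp: u_def j_def)
  have "gauss c (x - y) = exp (- u\<^sup>2 / 2)" by (simp add: gauss_def u_def power_divide)
  also have "\<dots> \<le> exp (1/2 - u)"
    using zero_le_power2[of "u - 1"] by (simp add: power2_diff)
  also have "\<dots> \<le> exp (1/2 - real j)" using u by simp
  finally have *: "gauss c (x - y) \<le> exp (1/2 - real j)" .
  have "\<bar>x - y\<bar> \<le> c * (real j + 1)" using u(3) c by (simp add: u_def divide_le_eq mult.commute)
  then have "indicator {x - c * (real j + 1)..x + c * (real j + 1)} y = (1 :: ennreal)" by (auto simp: indicator_def abs_le_iff)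
  then have "ennreal (gauss c (x - y)) \<le> ennreal (exp (1/2 - real j)) * indicator {x - c * (real j + 1)..x + c * (real j + 1)} y"
    using * by (simp add: ennreal_leI)
  also have "\<dots> \<le> (\<Sum>j. ennreal (exp (1/2 - real j)) * indicator {x - c * (real j + 1)..x + c * (real j + 1)} y)"
    by (rule ennreal_le_suminf)
  finally show ?thesis .
qed

text \<open>Every layer contributes an integral over an interval of length 2c(j + 1) around x, hence
  at most that length times the maximal function. The coefficients \<alpha> are multiples of (j + 1)
  e^(-j), summable as a differentiated geometric series.\<close>

lemma abs_gauss_conv_le_maximal:
  assumes c: "c > 0"
  obtains K where "K \<ge> 0"
    "\<And>f x. f \<in> borel_measurable lebesgue \<Longrightarrow> abs_gauss_conv c f x \<le> ennreal K * maximal_fun f x"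
proof -
  define \<alpha> where "\<alpha> j = exp (1/2 - real j) * (2 * c * (real j + 1))" for j
  have \<alpha>0: "\<alpha> j \<ge> 0" for j using c by (simp add: \<alpha>_def)
  have "summable (\<lambda>j. of_nat (Suc j) * (exp (-1)) ^ j :: real)"
    using geometric_deriv_sums[of "exp (-1) :: real"] by (auto simp: sums_iff)
  then have "summable (\<lambda>j. exp (1/2) * (2 * c) * (of_nat (Suc j) * (exp (-1)) ^ j))"
    by (rule summable_mult)
  moreover have "exp (1/2) * (2 * c) * (of_nat (Suc j) * (exp (-1)) ^ j) = \<alpha> j" for j
  proof -
    have "1/2 - real j = 1/2 + real j * (-1)" by simp
    then have "exp (1/2 - real j) = exp (1/2) * (exp (-1)) ^ j" by (simp only: exp_add exp_of_nat_mult)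
    then show ?thesis by (simp add: \<alpha>_def mult_ac)
  qed
  ultimately have \<alpha>_sum: "summable \<alpha>" by (simp only:)
  show ?thesis
  proof (rule that[of "suminf \<alpha>"])
    show "suminf \<alpha> \<ge> 0" by (rule suminf_nonneg[OF \<alpha>_sum \<alpha>0])
    fix f :: "real \<Rightarrow> complex" and x :: real
    assume [measurable]: "f \<in> borel_measurable lebesgue"
    let ?A = "\<lambda>j. {x - c * (real j + 1)..x + c * (real j + 1)}"
    have [measurable]: "(\<lambda>y. indicator (?A j) y :: ennreal) \<in> borel_measurable lebesgue" for j
      by (rule borel_measurable_indicator) simp
    have "abs_gauss_conv c f x \<le> (\<integral>\<^sup>+y. ennreal (cmod (f y)) * (\<Sum>j. ennreal (exp (1/2 - real j)) * indicator (?A j) y) \<partial>lebesgue)"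
      unfolding abs_gauss_conv_def by (intro nn_integral_mono mult_left_mono gauss_le_layers c) simp
    also have "\<dots> = (\<integral>\<^sup>+y. (\<Sum>j. ennreal (exp (1/2 - real j)) * (ennreal (cmod (f y)) * indicator (?A j) y)) \<partial>lebesgue)"
      by (intro nn_integral_cong) (simp only: ennreal_suminf_cmult[symmetric] mult.left_commute)
    also have "\<dots> = (\<Sum>j. ennreal (exp (1/2 - real j)) * local_mass f (x - c * (real j + 1)) (x + c * (real j + 1)))"
      unfolding local_mass_def by (subst nn_integral_suminf) (auto simp: nn_integral_cmult)
    also have "\<dots> \<le> (\<Sum>j. ennreal (\<alpha> j) * maximal_fun f x)"
    proof (intro suminf_le)
      fix j
      have pos: "c * (real j + 1) > 0" using c by simp
      have "local_mass f (x - c * (real j + 1)) (x + c * (real j + 1)) \<le> ennreal (2 * c * (real j + 1)) * maximal_fun f x"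
        using local_mass_le[of "x - c * (real j + 1)" x "x + c * (real j + 1)" f] pos by (simp add: mult.assoc)
      then have "ennreal (exp (1/2 - real j)) * local_mass f (x - c * (real j + 1)) (x + c * (real j + 1))
        \<le> ennreal (exp (1/2 - real j)) * (ennreal (2 * c * (real j + 1)) * maximal_fun f x)"
        by (rule mult_left_mono) simp
      also have "\<dots> = ennreal (\<alpha> j) * maximal_fun f x"
        using c by (simp add: \<alpha>_def ennreal_mult mult.assoc)
      finally show "ennreal (exp (1/2 - real j)) * local_mass f (x - c * (real j + 1)) (x + c * (real j + 1))
        \<le> ennreal (\<alpha> j) * maximal_fun f x" .
    qed auto
    also have "\<dots> = ennreal (suminf \<alpha>) * maximal_fun f x"
      using suminf_ennreal2[OF \<alpha>0 \<alpha>_sum] by simp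
    finally show "abs_gauss_conv c f x \<le> ennreal (suminf \<alpha>) * maximal_fun f x" .
  qed
qed

context banach_function_space
begin

text \<open>Finite norm implies a finite integral over each [-n, n], by the local integrability
  axiom.\<close>

lemma rho_finite_imp_AE_finite:
  assumes g: "g \<in> borel_measurable lebesgue" and fin: "\<rho> g < \<infinity>"
  shows "AE x in lebesgue. g x < \<infinity>"
proof -
  have "AE x in lebesgue. x \<in> {-real n..real n} \<longrightarrow> g x < \<infinity>" for n
  proof -
    obtain C where C: "C \<ge> 0" "\<And>f. f \<in> borel_measurable lebesgue \<Longrightarrow>
        (\<integral>\<^sup>+x. f x * indicator {-real n..real n} x \<partial>lebesgue) \<le> ennreal C * \<rho> f"
      using rho_local_integral[OF emeasure_segment, of "real n"] by blast
    have m: "(\<lambda>x. g x * indicator {-real n..real n} x) \<in> borel_measurable lebesgue"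
      using g by (intro borel_measurable_times_ennreal borel_measurable_indicator) auto
    have "(\<integral>\<^sup>+x. g x * indicator {-real n..real n} x \<partial>lebesgue) < \<infinity>"
      using C(2)[OF g] by (rule le_less_trans) (use fin in \<open>simp add: ennreal_mult_less_top\<close>)
    then have "AE x in lebesgue. g x * indicator {-real n..real n} x \<noteq> \<infinity>"
      by (intro nn_integral_noteq_infinite[OF m]) auto
    then show ?thesis by eventually_elim (auto simp: less_top)
  qed
  then have "AE x in lebesgue. \<forall>n. x \<in> {-real n..real n} \<longrightarrow> g x < \<infinity>"
    unfolding AE_all_countable by blast
  then show ?thesis
  proof eventually_elim
    case (elim x)
    obtain n where "\<bar>x\<bar> \<le> real n" using real_arch_simple by blast
    then show ?case using elim by (auto simp: abs_le_iff)
  qed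
qed

end

locale maximal_banach_function_space = reflexive_banach_function_space +
  assumes maximal: "maximal_bounded \<rho>"
begin

lemma maximal_rho_bound:
  obtains C where "C \<ge> 0" "\<And>f. f \<in> X \<Longrightarrow> \<rho> (maximal_fun f) \<le> ennreal (C * nrm f)"
proof -
  obtain C where C: "\<And>f. f \<in> X \<Longrightarrow> \<rho> (maximal_fun f) \<le> ennreal C * \<rho> (\<lambda>x. ennreal (cmod (f x)))"
    using maximal unfolding maximal_bounded_def by blast
  have "\<rho> (maximal_fun f) \<le> ennreal (max C 0 * nrm f)" if f: "f \<in> X" for f
  proof -
    have "\<rho> (maximal_fun f) \<le> ennreal C * ennreal (nrm f)" using C[OF f] by (simp add: ennreal_normX[OF f])
    also have "\<dots> \<le> ennreal (max C 0) * ennreal (nrm f)" by (intro mult_right_mono ennreal_leI) auto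
    finally show ?thesis by (simp add: ennreal_mult)
  qed
  then show ?thesis by (rule that[OF max.cobounded2])
qed

text \<open>The maximal function is \<open>ennreal\<close>-valued and so not itself an element of
  the space; domination has to pass through \<rho>. One C serves all f, g and K, which makes the
  bound for averages, where K = 1, uniform in n.\<close>

lemma maximal_domination:
  "\<exists>C\<ge>0. \<forall>f\<in>X. \<forall>g\<in>borel_measurable lebesgue. \<forall>K\<ge>0.
    (\<forall>x. ennreal (cmod (g x)) \<le> ennreal K * maximal_fun f x) \<longrightarrow> g \<in> X \<and> nrm g \<le> K * C * nrm f"
proof -
  obtain C where C: "C \<ge> 0" "\<And>f. f \<in> X \<Longrightarrow> \<rho> (maximal_fun f) \<le> ennreal (C * nrm f)"
    by (rule maximal_rho_bound) (rule that)
  show ?thesis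
  proof (intro exI[of _ C] conjI C(1) ballI allI impI)
    fix f g :: "real \<Rightarrow> complex" and K :: real
    assume f: "f \<in> X" and g[measurable]: "g \<in> borel_measurable lebesgue" and K: "0 \<le> K"
      and gle: "\<forall>x. ennreal (cmod (g x)) \<le> ennreal K * maximal_fun f x"
    have "\<rho> (\<lambda>x. ennreal (cmod (g x))) \<le> \<rho> (\<lambda>x. ennreal K * maximal_fun f x)"
      using gle by (intro rho_mono) auto
    also have "\<dots> = ennreal K * \<rho> (maximal_fun f)" using K by (intro rho_scale) auto
    also have "\<dots> \<le> ennreal K * ennreal (C * nrm f)" by (intro mult_left_mono C f) simp
    also have "\<dots> = ennreal (K * C * nrm f)" using K C by (simp add: ennreal_mult mult.assoc)
    finally have *: "\<rho> (\<lambda>x. ennreal (cmod (g x))) \<le> ennreal (K * C * nrm f)" .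
    show "g \<in> X" "nrm g \<le> K * C * nrm f"
      using bfsI_rho[OF g *] K C(1) by simp_all
  qed
qed

lemma maximal_AE_finite:
  assumes "f \<in> X" shows "AE x in lebesgue. maximal_fun f x < \<infinity>"
proof (rule rho_finite_imp_AE_finite[OF maximal_fun_measurable])
  obtain C where "C \<ge> 0" and C: "\<And>f. f \<in> X \<Longrightarrow> \<rho> (maximal_fun f) \<le> ennreal (C * nrm f)"
    by (rule maximal_rho_bound) (rule that)
  show "\<rho> (maximal_fun f) < \<infinity>" using C[OF assms] by (rule le_less_trans) simp
qed

lemma gauss_conv_bounded_op:
  assumes c: "c > 0"
  shows "bounded_op \<rho> (gauss_conv c)"
proof -
  obtain K where K: "K \<ge> 0"
    "\<And>f x. f \<in> borel_measurable lebesgue \<Longrightarrow> abs_gauss_conv c f x \<le> ennreal K * maximal_fun f x"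
    using abs_gauss_conv_le_maximal[OF c] by blast
  obtain C where C: "\<forall>f\<in>X. \<forall>g\<in>borel_measurable lebesgue. \<forall>K\<ge>0.
      (\<forall>x. ennreal (cmod (g x)) \<le> ennreal K * maximal_fun f x) \<longrightarrow> g \<in> X \<and> nrm g \<le> K * C * nrm f"
    using maximal_domination by blast
  have bd: "gauss_conv c f \<in> X \<and> nrm (gauss_conv c f) \<le> K * C * nrm f" if f: "f \<in> X" for f
    using order_trans[OF norm_gauss_conv_le K(2)[OF bfs_measurable[OF f]]]
    by (intro C[rule_format, OF f gauss_conv_measurable[OF bfs_measurable[OF f]] K(1)])
  \<comment> \<open>Additivity of the Bochner integral requires convergence of both integrals,
    available where the maximal functions are finite. Hence the convolution is linear almost
    everywhere.\<close>
  have int: "AE x in lebesgue. integrable lebesgue (\<lambda>y. complex_of_real (gauss c (x - y)) * f y)" if f: "f \<in> X" for f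
    using maximal_AE_finite[OF f]
  proof eventually_elim
    case (elim x)
    have [measurable]: "f \<in> borel_measurable lebesgue" using f by (rule bfs_measurable)
    have "abs_gauss_conv c f x < \<infinity>"
      using K(2)[OF bfs_measurable[OF f], of x] by (rule le_less_trans) (use elim in \<open>simp add: ennreal_mult_less_top\<close>)
    then show ?case
      unfolding abs_gauss_conv_eq
      by (intro integrableI_bounded borel_measurable_times complex_of_real_measurable
          gauss_shift_measurable bfs_measurable[OF f]) simp
  qed
  show ?thesis
    unfolding bounded_op_def
  proof (intro conjI ballI allI impI exI)
    fix f g d assume f: "f \<in> X" and g: "g \<in> X"
    show "AE x in lebesgue. gauss_conv c (\<lambda>y. f y + d * g y) x = gauss_conv c f x + d * gauss_conv c g x"
      using int[OF f] int[OF g]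
    proof eventually_elim
      case (elim x)
      then show ?case by (simp add: gauss_conv_def ring_distribs mult.left_commute[of _ d])
    qed
  next
    fix f g :: "real \<Rightarrow> complex" assume eq: "AE x in lebesgue. f x = g x"
    have "gauss_conv c f x = gauss_conv c g x" for x
      unfolding gauss_conv_def by (rule lebesgue_integral_cong_AE) (use eq in \<open>auto elim: eventually_mono\<close>)
    then show "AE x in lebesgue. gauss_conv c f x = gauss_conv c g x" by simp
  qed (use bd in auto)
qed

end

section \<open>Approximation of compact operators\<close>

lemma C_comp_C_dot:
  assumes "a \<in> C_comp" shows "a \<in> C_dot"
proof -
  obtain c R where a: "continuous_on UNIV a" "\<And>x. cmod (a x) \<le> c * indicator {-R..R} x"
    using assms by (auto simp: C_comp_def)
  have zero: "a x = 0" if "x \<notin> {-R..R}" for x using a(2)[of x] that by simp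
  have "(a \<longlongrightarrow> 0) at_top"
    by (rule tendsto_eventually, rule eventually_at_top_linorderI[of "R + 1"]) (rule zero, simp)
  moreover have "(a \<longlongrightarrow> 0) at_bot"
    by (rule tendsto_eventually, rule eventually_at_bot_linorderI[of "- R - 1"]) (rule zero, simp)
  ultimately show ?thesis using a(1) by (auto simp: C_dot_def)
qed

lemma C_comp_L2: "a \<in> C_comp \<Longrightarrow> a \<in> L2"
  by (auto simp: C_comp_def intro!: bounded_support_L2(1) continuous_imp_lebesgue_measurable)

lemma gauss_hat_mono:
  assumes "c > 0" "\<bar>y\<bar> \<le> \<bar>x\<bar>" shows "gauss_hat c x \<le> gauss_hat c y"
proof -
  have "(c * y)\<^sup>2 \<le> (c * x)\<^sup>2" using assms by (simp add: power_mult_distrib abs_le_square_iff)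
  then show ?thesis using assms by (simp add: gauss_hat_def std_normal_density_def divide_right_mono)
qed

lemma gauss_hat_continuous: "continuous_on UNIV (gauss_hat c)"
  unfolding gauss_hat_def std_normal_density_def by (intro continuous_intros) auto

lemma gauss_hat_tendsto:
  assumes "c > 0"
  shows "(gauss_hat c \<longlongrightarrow> 0) at_top" "(gauss_hat c \<longlongrightarrow> 0) at_bot"
proof -
  show top: "(gauss_hat c \<longlongrightarrow> 0) at_top"
    unfolding gauss_hat_def std_normal_density_def using assms by real_asymp
  have "((\<lambda>x. gauss_hat c (- x)) \<longlongrightarrow> 0) at_bot"
    using top by (rule filterlim_compose) (rule filterlim_uminus_at_top_at_bot)
  then show "(gauss_hat c \<longlongrightarrow> 0) at_bot" by simp
qed

text \<open>The Gaussian is a difference of two bounded increasing functions,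
  \<open>x \<mapsto> a (min x 0)\<close> and \<open>x \<mapsto> a 0 - a (max x 0)\<close>.\<close>

lemma gauss_hat_BV:
  assumes c: "c > 0"
  shows "(\<lambda>x. complex_of_real (gauss_hat c x)) \<in> BV"
  unfolding BV_def
proof (intro CollectI exI allI impI)
  fix n :: nat and x :: "nat \<Rightarrow> real"
  assume inc: "\<forall>i<n. x i \<le> x (Suc i)"
  let ?a = "gauss_hat c"
  define u where "u t = ?a (min t 0) - ?a (max t 0)" for t
  have u: "\<bar>?a (x (Suc i)) - ?a (x i)\<bar> \<le> u (x (Suc i)) - u (x i)" if "i < n" for i
  proof -
    let ?s = "x i" and ?t = "x (Suc i)"
    have st: "?s \<le> ?t" using inc that by blast
    have eq: "?a t = ?a (min t 0) + ?a (max t 0) - ?a 0" for t by (auto simp: min_def max_def)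
    have "?a (min ?s 0) \<le> ?a (min ?t 0)" "?a (max ?t 0) \<le> ?a (max ?s 0)"
      using st by (auto intro!: gauss_hat_mono[OF c])
    then show ?thesis using eq[of ?s] eq[of ?t] unfolding u_def by linarith
  qed
  have "(\<Sum>i<n. cmod (complex_of_real (?a (x (Suc i))) - complex_of_real (?a (x i))))
    = (\<Sum>i<n. \<bar>?a (x (Suc i)) - ?a (x i)\<bar>)"
    by (simp only: of_real_diff[symmetric] norm_of_real)
  also have "\<dots> \<le> (\<Sum>i<n. u (x (Suc i)) - u (x i))" using u by (intro sum_mono) auto
  also have "\<dots> = u (x n) - u (x 0)" by (rule sum_lessThan_telescope)
  also have "\<dots> \<le> 2 * ?a 0"
  proof -
    have "0 \<le> ?a t" "?a t \<le> ?a 0" for t using c gauss_hat_mono[OF c, of 0 t] by auto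
    then show ?thesis unfolding u_def by (smt (verit))
  qed
  finally show "(\<Sum>i<n. cmod (complex_of_real (?a (x (Suc i))) - complex_of_real (?a (x i)))) \<le> 2 * ?a 0" .
qed

lemma gauss_hat_C_dot:
  assumes "c > 0" shows "(\<lambda>x. complex_of_real (gauss_hat c x)) \<in> C_dot"
proof -
  have "((\<lambda>x. complex_of_real (gauss_hat c x)) \<longlongrightarrow> complex_of_real 0) at_top"
    "((\<lambda>x. complex_of_real (gauss_hat c x)) \<longlongrightarrow> complex_of_real 0) at_bot"
    by (intro tendsto_of_real gauss_hat_tendsto assms)+
  moreover have "continuous_on UNIV (\<lambda>x. complex_of_real (gauss_hat c x))"
    by (intro continuous_on_of_real gauss_hat_continuous)
  ultimately show ?thesis unfolding C_dot_def by blast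
qed

section \<open>Bounded operators and closure of the algebra\<close>

context banach_function_space
begin

lemma bounded_op_mem: "bounded_op \<rho> T \<Longrightarrow> f \<in> X \<Longrightarrow> T f \<in> X"
  unfolding bounded_op_def by blast

lemma bounded_op_lin:
  "bounded_op \<rho> T \<Longrightarrow> f \<in> X \<Longrightarrow> g \<in> X \<Longrightarrow> AE x in lebesgue. T (\<lambda>y. f y + c * g y) x = T f x + c * T g x"
  unfolding bounded_op_def by blast

lemma bounded_op_cong:
  "bounded_op \<rho> T \<Longrightarrow> f \<in> X \<Longrightarrow> g \<in> X \<Longrightarrow> AE x in lebesgue. f x = g x \<Longrightarrow> AE x in lebesgue. T f x = T g x"
  unfolding bounded_op_def by blast

lemma bounded_op_bound:
  assumes "bounded_op \<rho> T"
  shows "\<exists>C\<ge>0. \<forall>f\<in>X. nrm (T f) \<le> C * nrm f"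
proof -
  obtain C where C: "\<forall>f\<in>X. nrm (T f) \<le> C * nrm f" using assms unfolding bounded_op_def by blast
  have "nrm (T f) \<le> max C 0 * nrm f" if "f \<in> X" for f
    using C that mult_right_mono[OF max.cobounded1[of C 0] normX_nonneg[of f]] by fastforce
  then show ?thesis by (intro exI[of _ "max C 0"]) auto
qed

lemma bounded_op_diff:
  assumes T: "bounded_op \<rho> T" and f: "f \<in> X" and g: "g \<in> X"
  shows "nrm (\<lambda>x. T f x - T g x) = nrm (T (\<lambda>x. f x - g x))"
proof -
  have "AE x in lebesgue. T (\<lambda>x. f x - g x) x = T f x - T g x"
    using bounded_op_lin[OF T f g, of "-1"] by simp
  then show ?thesis by (rule normX_cong_AE(2)[OF bounded_op_mem[OF T diff_bfs[OF f g]]])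
qed

text \<open>The bound \<epsilon> also makes the set bounded above, so that its supremum is a true
  one; evaluating at the zero function then gives nonnegativity.\<close>

lemma opdist_le:
  assumes le: "\<And>f. f \<in> X \<Longrightarrow> nrm f \<le> 1 \<Longrightarrow> nrm (\<lambda>x. T f x - S f x) \<le> \<epsilon>"
  shows "opdist \<rho> T S \<le> \<epsilon>" "0 \<le> opdist \<rho> T S"
proof -
  let ?A = "{nrm (\<lambda>x. T f x - S f x) | f. f \<in> X \<and> nrm f \<le> 1}"
  have mem: "nrm (\<lambda>x. T (\<lambda>x. 0) x - S (\<lambda>x. 0) x) \<in> ?A"
    by (rule CollectI, rule exI[of _ "\<lambda>x. 0"]) simp
  show "opdist \<rho> T S \<le> \<epsilon>"
    unfolding opdist_def by (rule cSup_least) (use mem le in auto)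
  have "nrm (\<lambda>x. T (\<lambda>x. 0) x - S (\<lambda>x. 0) x) \<le> opdist \<rho> T S"
    unfolding opdist_def by (rule cSup_upper[OF mem]) (use le in \<open>auto simp: bdd_above_def\<close>)
  then show "0 \<le> opdist \<rho> T S" using normX_nonneg by (rule order_trans[rotated])
qed

lemma alg_A_closed:
  assumes S: "bounded_op \<rho> S"
    and approx: "\<And>\<epsilon>. \<epsilon> > 0 \<Longrightarrow> \<exists>T\<in>alg_A \<rho>. \<forall>f\<in>X. nrm f \<le> 1 \<longrightarrow> nrm (\<lambda>x. T f x - S f x) \<le> \<epsilon>"
  shows "S \<in> alg_A \<rho>"
proof -
  have "\<exists>T\<in>alg_A \<rho>. \<forall>f\<in>X. nrm f \<le> 1 \<longrightarrow> nrm (\<lambda>x. T f x - S f x) \<le> inverse (real (Suc n))" for n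
    by (rule approx) simp
  then obtain T where T: "\<And>n. T n \<in> alg_A \<rho>"
    "\<And>n f. f \<in> X \<Longrightarrow> nrm f \<le> 1 \<Longrightarrow> nrm (\<lambda>x. T n f x - S f x) \<le> inverse (real (Suc n))"
    by metis
  show ?thesis
  proof (rule alg_A.lim[OF T(1) S])
    show "(\<lambda>n. opdist \<rho> (T n) S) \<longlonglongrightarrow> 0"
      by (rule tendsto_sandwich[OF _ _ tendsto_const LIMSEQ_inverse_real_of_nat])
         (intro always_eventually allI opdist_le(1)[OF T(2)] opdist_le(2)[OF T(2)]; assumption)+
  qed
qed

lemma rank_one_bounded_op:
  assumes e: "e \<in> X" and \<phi>: "\<phi> \<in> dual_space \<rho>"
  shows "bounded_op \<rho> (\<lambda>f x. e x * \<phi> f)"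
  unfolding bounded_op_def
proof (intro conjI ballI allI impI exI)
  fix f assume f: "f \<in> X"
  have eq: "(\<lambda>x. e x * \<phi> f) = (\<lambda>x. \<phi> f * e x)" by (simp add: mult.commute)
  show "(\<lambda>x. e x * \<phi> f) \<in> X" unfolding eq by (rule scale_bfs[OF e])
  have "nrm (\<lambda>x. e x * \<phi> f) = cmod (\<phi> f) * nrm e" unfolding eq by (rule normX_scale[OF e])
  also have "\<dots> \<le> (dual_norm \<rho> \<phi> * nrm f) * nrm e" by (intro mult_right_mono dual_norm_bound \<phi> f) simp
  finally show "nrm (\<lambda>x. e x * \<phi> f) \<le> (dual_norm \<rho> \<phi> * nrm e) * nrm f" by (simp add: mult_ac)
next
  fix f g c assume "f \<in> X" "g \<in> X"
  then show "AE x in lebesgue. e x * \<phi> (\<lambda>y. f y + c * g y) = e x * \<phi> f + c * (e x * \<phi> g)"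
    by (simp add: dual_lin[OF \<phi>] algebra_simps)
next
  fix f g assume "f \<in> X" "g \<in> X" "AE x in lebesgue. f x = g x"
  then have "\<phi> f = \<phi> g" by (rule dual_cong[OF \<phi>])
  then show "AE x in lebesgue. e x * \<phi> f = e x * \<phi> g" by simp
qed

lemma zero_op_alg_A: "(\<lambda>f x. 0) \<in> alg_A \<rho>"
proof -
  have "(\<lambda>x. 0) \<in> C_dot" by (auto simp: C_dot_def)
  from alg_A.gen_mult[OF this, of \<rho>] show ?thesis by simp
qed

lemma sum_alg_A:
  assumes "finite I" "\<And>i. i \<in> I \<Longrightarrow> T i \<in> alg_A \<rho>"
  shows "(\<lambda>f x. \<Sum>i\<in>I. T i f x) \<in> alg_A \<rho>"
  using assms
proof (induction I rule: finite_induct)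
  case (insert i I)
  then show ?case using alg_A.add[of "T i" \<rho> "\<lambda>f x. \<Sum>i\<in>I. T i f x"] by simp
qed (simp add: zero_op_alg_A)

end

context maximal_banach_function_space
begin

text \<open>\<open>C_comp\<close> is contained in \<open>L2\<close> and dense in the space, so two
  bounded operators that agree on the intersection agree everywhere. This is what makes the
  extension of \<open>W0\<close> unique.\<close>

lemma bounded_op_eq_AE:
  assumes T: "bounded_op \<rho> T" and S: "bounded_op \<rho> S"
    and eq: "\<And>f. f \<in> L2 \<inter> X \<Longrightarrow> AE x in lebesgue. T f x = S f x" and f: "f \<in> X"
  shows "AE x in lebesgue. T f x = S f x"
proof -
  obtain C where C: "C \<ge> 0" "\<And>f. f \<in> X \<Longrightarrow> nrm (T f) \<le> C * nrm f" using bounded_op_bound[OF T] by blast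
  obtain D where D: "D \<ge> 0" "\<And>f. f \<in> X \<Longrightarrow> nrm (S f) \<le> D * nrm f" using bounded_op_bound[OF S] by blast
  note TX = bounded_op_mem[OF T] and SX = bounded_op_mem[OF S]
  have "nrm (\<lambda>x. T f x - S f x) \<le> 0 + \<epsilon>" if \<epsilon>: "\<epsilon> > 0" for \<epsilon>
  proof -
    have "\<epsilon> / (C + D + 1) > 0" using \<epsilon> C D by simp
    from C_comp_dense[OF f this] obtain g where g: "g \<in> C_comp" "nrm (\<lambda>x. f x - g x) < \<epsilon> / (C + D + 1)" .
    have gX: "g \<in> X" by (rule C_comp_bfs[OF g(1)])
    have "AE x in lebesgue. S g x = T g x" using eq[of g] gX C_comp_L2[OF g(1)] by auto
    then have "nrm (\<lambda>x. S f x - S g x) = nrm (\<lambda>x. S f x - T g x)"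
      by (intro normX_cong_AE(2)[symmetric] diff_bfs SX TX f gX) (auto elim: eventually_mono)
    moreover have "nrm (\<lambda>x. S f x - T g x) = nrm (\<lambda>x. T g x - S f x)"
      by (rule normX_minus_commute[OF SX[OF f] TX[OF gX]])
    ultimately have "nrm (\<lambda>x. T f x - S f x) \<le> nrm (\<lambda>x. T f x - T g x) + nrm (\<lambda>x. S f x - S g x)"
      using normX_triangle_diff[OF TX[OF f] TX[OF gX] SX[OF f]] by simp
    also have "\<dots> \<le> C * nrm (\<lambda>x. f x - g x) + D * nrm (\<lambda>x. f x - g x)"
      unfolding bounded_op_diff[OF T f gX] bounded_op_diff[OF S f gX]
      by (intro add_mono C(2) D(2) diff_bfs f gX)
    also have "\<dots> \<le> (C + D + 1) * nrm (\<lambda>x. f x - g x)" by (simp add: algebra_simps)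
    also have "\<dots> \<le> (C + D + 1) * (\<epsilon> / (C + D + 1))" using g(2) C(1) D(1) by (intro mult_left_mono) auto
    also have "\<dots> = \<epsilon>" using C(1) D(1) by simp
    finally show ?thesis by simp
  qed
  then have "nrm (\<lambda>x. T f x - S f x) \<le> 0" by (rule field_le_epsilon)
  then have "nrm (\<lambda>x. T f x - S f x) = 0" using normX_nonneg by (rule antisym)
  then show ?thesis using normX_eq_0_AE[OF diff_bfs[OF TX[OF f] SX[OF f]]] by simp
qed

text \<open>Any bounded extension T shows that the choice in \<open>W0X\<close> succeeds, and
  uniqueness of the extension identifies the chosen operator with T.\<close>

lemma W0X_eq:
  assumes T: "bounded_op \<rho> T" and eq: "\<And>f. f \<in> L2 \<inter> X \<Longrightarrow> AE x in lebesgue. T f x = W0 a f x"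
  shows "bounded_op \<rho> (W0X \<rho> a)" "f \<in> X \<Longrightarrow> AE x in lebesgue. W0X \<rho> a f x = T f x"
proof -
  let ?P = "\<lambda>T. bounded_op \<rho> T \<and> (\<forall>f \<in> L2 \<inter> X. AE x in lebesgue. T f x = W0 a f x)"
  have "?P T" using assms by blast
  then have *: "?P (W0X \<rho> a)" unfolding W0X_def by (rule someI[where P = ?P])
  then show W: "bounded_op \<rho> (W0X \<rho> a)" by blast
  assume f: "f \<in> X"
  show "AE x in lebesgue. W0X \<rho> a f x = T f x"
  proof (rule bounded_op_eq_AE[OF W T _ f])
    fix f assume f: "f \<in> L2 \<inter> X"
    have "AE x in lebesgue. W0X \<rho> a f x = W0 a f x" using * f by blast
    with eq[OF f] show "AE x in lebesgue. W0X \<rho> a f x = T f x" by eventually_elim simp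
  qed
qed

text \<open>Needed because membership in \<open>C_X\<close> is tested through the multiplier norm of
  a difference of symbols, here the difference of the Gaussian with itself.\<close>

lemma mult_norm_zero: "mult_norm \<rho> (\<lambda>x. 0) = 0"
proof -
  have "bounded_op \<rho> (\<lambda>f x. 0)" by (auto simp: bounded_op_def intro!: exI[of _ 0])
  moreover have "AE x in lebesgue. 0 = W0 (\<lambda>x. 0) f x" if "f \<in> L2 \<inter> X" for f
  proof -
    have "AE x in lebesgue. W0 (\<lambda>x. 0) f x = 0" using that by (intro W0_zero) blast
    then show ?thesis by eventually_elim simp
  qed
  ultimately have W: "AE x in lebesgue. W0X \<rho> (\<lambda>x. 0) f x = 0" if "f \<in> X" for f
    using that by (rule W0X_eq(2))
  have "nrm (\<lambda>x. W0X \<rho> (\<lambda>x. 0) f x - 0) \<le> 0" if f: "f \<in> X" for f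
  proof -
    have "AE x in lebesgue. 0 = W0X \<rho> (\<lambda>x. 0) f x - 0" using W[OF f] by eventually_elim simp
    from normX_cong_AE(2)[OF zero_bfs this] show ?thesis by simp
  qed
  from opdist_le[of "W0X \<rho> (\<lambda>x. 0)" "\<lambda>f x. 0", OF this] show ?thesis
    unfolding mult_norm_def opnorm_def by (rule antisym)
qed

text \<open>The Gaussian is continuous with equal limits at both ends and has bounded variation, so
  it is its own approximant in the definition of \<open>C_X\<close>.\<close>

lemma gauss_hat_C_X:
  assumes c: "c > 0"
  shows "(\<lambda>x. complex_of_real (gauss_hat c x)) \<in> C_X \<rho>"
proof -
  let ?a = "\<lambda>x. complex_of_real (gauss_hat c x)"
  have W: "AE x in lebesgue. W0 ?a f x = gauss_conv c f x" if "f \<in> L2 \<inter> X" for f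
    using W0_gauss[OF _ c] that by blast
  have W': "AE x in lebesgue. gauss_conv c f x = W0 ?a f x" if "f \<in> L2 \<inter> X" for f
    using W[OF that] by eventually_elim simp
  have "?a \<in> borel_measurable lebesgue"
    by (intro complex_of_real_measurable borel_imp_lebesgue_measurable gauss_hat_measurable)
  moreover have "cmod (?a x) \<le> gauss_hat c 0" for x
    using c gauss_hat_mono[OF c, of 0 x] by simp
  ultimately have Linf: "?a \<in> Linf" by (auto simp: Linf_def)
  have mult: "is_multiplier \<rho> ?a"
    unfolding is_multiplier_def
  proof (intro conjI Linf ballI exI[of _ "gauss_conv c"] gauss_conv_bounded_op c W')
    fix f assume f: "f \<in> L2 \<inter> X"
    then have "gauss_conv c f \<in> X" using bounded_op_mem[OF gauss_conv_bounded_op[OF c]] by blast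
    then show "W0 ?a f \<in> X" using W'[OF f] by (rule normX_cong_AE(1))
  qed
  have "\<exists>d \<in> C_dot \<inter> BV. is_multiplier \<rho> d \<and> mult_norm \<rho> (\<lambda>x. ?a x - d x) < \<epsilon>" if "\<epsilon> > 0" for \<epsilon>
    by (rule bexI[of _ ?a]) (use that mult mult_norm_zero gauss_hat_C_dot[OF c] gauss_hat_BV[OF c] in auto)
  then show ?thesis using mult unfolding C_X_def by blast
qed

lemma W0X_gauss:
  assumes "c > 0" "f \<in> X"
  shows "AE x in lebesgue. W0X \<rho> (\<lambda>x. complex_of_real (gauss_hat c x)) f x = gauss_conv c f x"
proof (rule W0X_eq(2)[OF gauss_conv_bounded_op[OF assms(1)] _ assms(2)])
  fix f assume "f \<in> L2 \<inter> X"
  then have "AE x in lebesgue. W0 (\<lambda>x. complex_of_real (gauss_hat c x)) f x = gauss_conv c f x"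
    using W0_gauss[OF _ assms(1)] by blast
  then show "AE x in lebesgue. gauss_conv c f x = W0 (\<lambda>x. complex_of_real (gauss_hat c x)) f x"
    by eventually_elim simp
qed

text \<open>\<open>a W\<^sup>0(g\<^sub>n) b\<close> has the kernel \<open>a(x) exp(-(x-y)\<^sup>2/(2n\<^sup>2)) b(y)\<close>, which tends to \<open>a(x) b(y)\<close>
  uniformly on the compact support.\<close>

lemma rank_one_C_comp_alg_A:
  assumes a: "a \<in> C_comp" and b: "b \<in> C_comp"
  shows "(\<lambda>f x. a x * pairing b f) \<in> alg_A \<rho>"
proof (rule alg_A_closed[OF rank_one_bounded_op[OF C_comp_bfs[OF a] C_comp_dual[OF b]]])
  fix \<epsilon> :: real assume \<epsilon>: "\<epsilon> > 0"
  obtain ca Ra where a': "ca \<ge> 0" "\<And>x. cmod (a x) \<le> ca * indicator {-Ra..Ra} x" "continuous_on UNIV a"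
    using a by (auto simp: C_comp_def)
  obtain cb Rb where b': "cb \<ge> 0" "\<And>x. cmod (b x) \<le> cb * indicator {-Rb..Rb} x" "continuous_on UNIV b"
    using b by (auto simp: C_comp_def)
  define R where "R = max (max Ra Rb) 0"
  have R: "R \<ge> 0" "Ra \<le> R" "Rb \<le> R" by (auto simp: R_def)
  have aR: "cmod (a x) \<le> ca * indicator {-R..R} x" for x
    using a'(2)[of x] a'(1) R by (cases "x \<in> {-Ra..Ra}") (auto simp: indicator_def)
  have bR: "cmod (b x) \<le> cb * indicator {-R..R} x" for x
    using b'(2)[of x] b'(1) R by (cases "x \<in> {-Rb..Rb}") (auto simp: indicator_def)
  have a_meas: "a \<in> borel_measurable lebesgue" and b_meas: "b \<in> borel_measurable lebesgue"
    using a'(3) b'(3) by (auto intro: continuous_imp_lebesgue_measurable)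
  obtain C where C: "C \<ge> 0" and C_bound: "\<And>f h c. f \<in> X \<Longrightarrow> h \<in> borel_measurable lebesgue \<Longrightarrow> c \<ge> 0 \<Longrightarrow>
       (\<And>x. cmod (h x) \<le> c * indicator {-R..R} x) \<Longrightarrow>
       integrable lebesgue (\<lambda>x. f x * h x) \<and> cmod (pairing h f) \<le> c * C * nrm f"
    using pairing_bound[OF emeasure_segment, of R] by blast
  \<comment> \<open>K gathers the bounds of a and b, the pairing constant, the norm of the
    indicator, and the factor 2 R^2 of the kernel error 2 R^2 / n^2. The final error is K / n^2,
    which is at most K / n since n >= 1.\<close>
  define K where "K = ca * (cb * C) * nrm (indicator {-R..R}) * (2 * R\<^sup>2)"
  have K: "K \<ge> 0" using a'(1) b'(1) C by (simp add: K_def)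
  obtain n :: nat where n: "K / \<epsilon> < real n" using reals_Archimedean2 by blast
  have n0: "real n > 0" using n K \<epsilon> by (smt (verit) divide_nonneg_pos)
  then have n1: "real n \<ge> 1" by simp
  let ?g = "\<lambda>x. complex_of_real (gauss_hat (real n) x)"
  let ?T = "\<lambda>f x. a x * W0X \<rho> ?g (\<lambda>y. b y * f y) x"
  have "?T \<in> alg_A \<rho>"
    using alg_A.comp[OF alg_A.gen_mult[OF C_comp_C_dot[OF a], of \<rho>]
        alg_A.comp[OF alg_A.gen_conv[OF gauss_hat_C_X[OF n0]] alg_A.gen_mult[OF C_comp_C_dot[OF b], of \<rho>]]]
    by simp
  moreover have "nrm (\<lambda>x. ?T f x - a x * pairing b f) \<le> \<epsilon>" if f: "f \<in> X" "nrm f \<le> 1" for f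
  proof -
    have fm: "f \<in> borel_measurable lebesgue" using f(1) by (rule bfs_measurable)
    have bf_meas: "(\<lambda>y. b y * f y) \<in> borel_measurable lebesgue" using b_meas fm by (rule borel_measurable_times)
    have bf: "(\<lambda>y. b y * f y) \<in> X"
    proof (rule bfs_dominated(1)[OF bf_meas f(1) b'(1)])
      have "cmod (b y) \<le> cb" for y using bR[of y] b'(1) by (cases "y \<in> {-R..R}") auto
      then show "AE y in lebesgue. cmod (b y * f y) \<le> cb * cmod (f y)"
        by (auto simp: norm_mult intro!: mult_right_mono)
    qed
    let ?\<delta> = "2 * R\<^sup>2 / (real n)\<^sup>2"
    let ?h = "\<lambda>x y. complex_of_real (gauss (real n) (x - y) - 1) * b y"
    have h_meas: "?h x \<in> borel_measurable lebesgue" for x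
      by (intro borel_measurable_times complex_of_real_measurable borel_measurable_diff gauss_shift_measurable b_meas) simp
    have h_bound: "cmod (?h x y) \<le> ?\<delta> * cb * indicator {-R..R} y" if x: "x \<in> {-R..R}" for x y
    proof (cases "y \<in> {-R..R}")
      case True
      \<comment> \<open>Two points of [-R, R] are at distance at most 2R, and exp(-s) >= 1 - s with
        s = ((x - y)/n)^2 / 2 bounds the deviation from 1 by 2 R^2 / n^2.\<close>
      have "(x - y)\<^sup>2 \<le> (2 * R)\<^sup>2"
        using True x by (intro power2_le_iff_abs_le[THEN iffD2]) auto
      then have "((x - y) / real n)\<^sup>2 / 2 \<le> ?\<delta>"
        using divide_right_mono[of "(x - y)\<^sup>2" "(2 * R)\<^sup>2" "(real n)\<^sup>2"]
        by (simp add: power_divide power_mult_distrib)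
      moreover have "1 - ((x - y) / real n)\<^sup>2 / 2 \<le> gauss (real n) (x - y)"
        using exp_ge_add_one_self[of "- ((x - y) / real n)\<^sup>2 / 2"] by (simp add: gauss_def)
      ultimately have "\<bar>gauss (real n) (x - y) - 1\<bar> \<le> ?\<delta>" using gauss_le_1[of "real n" "x - y"] by linarith
      then have "cmod (?h x y) \<le> ?\<delta> * (cb * indicator {-R..R} y)"
        unfolding norm_mult norm_of_real by (intro mult_mono bR) auto
      then show ?thesis by (simp add: mult.assoc)
    next
      case False
      then show ?thesis using bR[of y] by simp
    qed
    have diff: "gauss_conv (real n) (\<lambda>y. b y * f y) x - pairing b f = pairing (?h x) f" if x: "x \<in> {-R..R}" for x
    proof -
      have 1: "integrable lebesgue (\<lambda>y. f y * ?h x y)"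
        using C_bound[OF f(1) h_meas _ h_bound[OF x]] b'(1) by simp
      have 2: "integrable lebesgue (\<lambda>y. f y * b y)" using C_bound[OF f(1) b_meas b'(1) bR] by simp
      have "gauss_conv (real n) (\<lambda>y. b y * f y) x = (\<integral>y. f y * ?h x y + f y * b y \<partial>lebesgue)"
        unfolding gauss_conv_def by (intro Bochner_Integration.integral_cong) (auto simp: algebra_simps)
      also have "\<dots> = pairing (?h x) f + pairing b f"
        unfolding pairing_def by (rule Bochner_Integration.integral_add[OF 1 2])
      finally show ?thesis by simp
    qed
    let ?D = "\<lambda>x. a x * (gauss_conv (real n) (\<lambda>y. b y * f y) x - pairing b f)"
    have D_meas: "?D \<in> borel_measurable lebesgue"
      by (intro borel_measurable_times borel_measurable_diff a_meas gauss_conv_measurable bf_meas) simp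
    have D_bound: "cmod (?D x) \<le> (ca * (?\<delta> * cb * C * nrm f)) * indicator {-R..R} x" for x
    proof (cases "x \<in> {-R..R}")
      case True
      have "cmod (pairing (?h x) f) \<le> ?\<delta> * cb * C * nrm f"
        using C_bound[OF f(1) h_meas _ h_bound[OF True]] b'(1) by simp
      moreover have "cmod (a x) \<le> ca" using aR[of x] True by simp
      ultimately have "cmod (a x) * cmod (pairing (?h x) f) \<le> ca * (?\<delta> * cb * C * nrm f)"
        using a'(1) by (intro mult_mono) auto
      then show ?thesis using True unfolding diff[OF True] norm_mult by simp
    next
      case False
      then show ?thesis using aR[of x] by simp
    qed
    have "AE x in lebesgue. ?D x = ?T f x - a x * pairing b f"
      using W0X_gauss[OF n0 bf] by eventually_elim (simp add: right_diff_distrib)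
    moreover have DX: "?D \<in> X" "nrm ?D \<le> (ca * (?\<delta> * cb * C * nrm f)) * nrm (indicator {-R..R})"
      using bounded_support_bfs[OF emeasure_segment D_meas _ AE_I2[OF D_bound]] a'(1) b'(1) C by simp_all
    ultimately have "nrm (\<lambda>x. ?T f x - a x * pairing b f) = nrm ?D" by (intro normX_cong_AE(2))
    also have "\<dots> \<le> (ca * (?\<delta> * cb * C * nrm f)) * nrm (indicator {-R..R})" by (rule DX(2))
    also have "\<dots> = K / (real n)\<^sup>2 * nrm f" by (simp add: K_def field_simps)
    also have "\<dots> \<le> K / (real n)\<^sup>2 * 1" using f(2) K by (intro mult_left_mono) auto
    also have "\<dots> \<le> K / real n"
      using K n0 n1 by (simp add: power2_eq_square divide_left_mono)
    also have "\<dots> \<le> \<epsilon>" using n n0 \<epsilon> by (simp add: field_simps)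
    finally show ?thesis .
  qed
  ultimately show "\<exists>T\<in>alg_A \<rho>. \<forall>f\<in>X. nrm f \<le> 1 \<longrightarrow> nrm (\<lambda>x. T f x - a x * pairing b f) \<le> \<epsilon>"
    by (intro bexI[of _ ?T] ballI impI)
qed

lemma rank_one_alg_A:
  assumes e: "e \<in> X" and \<phi>: "\<phi> \<in> dual_space \<rho>"
  shows "(\<lambda>f x. e x * \<phi> f) \<in> alg_A \<rho>"
proof (rule alg_A_closed[OF rank_one_bounded_op[OF e \<phi>]])
  fix \<epsilon> :: real assume \<epsilon>: "\<epsilon> > 0"
  let ?m = "nrm e + dual_norm \<rho> \<phi> + 1"
  have m: "?m > 0" using normX_nonneg[of e] dual_norm_nonneg[OF \<phi>] by linarith
  \<comment> \<open>The cap at 1 bounds the approximating functional by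
    \<open>dual_norm \<rho> \<phi> + 1\<close> on the unit ball, and \<open>?m\<close> is the total
    coefficient of \<delta> in the final estimate.\<close>
  define \<delta> where "\<delta> = min 1 (\<epsilon> / ?m)"
  have \<delta>: "\<delta> > 0" "\<delta> \<le> 1" "\<delta> * ?m \<le> \<epsilon>" using \<epsilon> m by (simp_all add: \<delta>_def min_less_iff_disj pos_le_divide_eq[symmetric])
  obtain a where a: "a \<in> C_comp" "nrm (\<lambda>x. e x - a x) < \<delta>" using C_comp_dense[OF e \<delta>(1)] .
  obtain b where b: "b \<in> C_comp" "\<And>f. f \<in> X \<Longrightarrow> cmod (\<phi> f - pairing b f) \<le> \<delta> * nrm f"
    by (rule C_comp_dense_dual[OF \<phi> \<delta>(1)]) (rule that)
  have "nrm (\<lambda>x. a x * pairing b f - e x * \<phi> f) \<le> \<epsilon>" if f: "f \<in> X" "nrm f \<le> 1" for f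
  proof -
    have aX: "a \<in> X" by (rule C_comp_bfs[OF a(1)])
    have "cmod (\<phi> f - pairing b f) \<le> \<delta> * nrm f" by (rule b(2)[OF f(1)])
    also have "\<dots> \<le> \<delta> * 1" using f \<delta> by (intro mult_left_mono) auto
    finally have 1: "cmod (\<phi> f - pairing b f) \<le> \<delta>" by simp
    have "cmod (\<phi> f) \<le> dual_norm \<rho> \<phi> * nrm f" by (rule dual_norm_bound[OF \<phi> f(1)])
    also have "\<dots> \<le> dual_norm \<rho> \<phi> * 1" using f dual_norm_nonneg[OF \<phi>] by (intro mult_left_mono) auto
    finally have 2: "cmod (pairing b f) \<le> dual_norm \<rho> \<phi> + 1"
      using 1 \<delta>(2) norm_triangle_sub[of "pairing b f" "\<phi> f"] by (simp add: norm_minus_commute)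
    have "(\<lambda>x. a x * pairing b f - e x * \<phi> f)
      = (\<lambda>x. (- (\<phi> f - pairing b f)) * e x + (- pairing b f) * (e x - a x))"
      by (auto simp: algebra_simps)
    then have "nrm (\<lambda>x. a x * pairing b f - e x * \<phi> f)
      \<le> nrm (\<lambda>x. (- (\<phi> f - pairing b f)) * e x) + nrm (\<lambda>x. (- pairing b f) * (e x - a x))"
      by (simp only:) (rule normX_triangle(2)[OF scale_bfs[OF e] scale_bfs[OF diff_bfs[OF e aX]]])
    also have "\<dots> = cmod (\<phi> f - pairing b f) * nrm e + cmod (pairing b f) * nrm (\<lambda>x. e x - a x)"
      unfolding normX_scale[OF e] normX_scale[OF diff_bfs[OF e aX]] norm_minus_cancel ..
    also have "\<dots> \<le> \<delta> * nrm e + (dual_norm \<rho> \<phi> + 1) * \<delta>"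
      using 1 2 a(2) \<delta>(1) dual_norm_nonneg[OF \<phi>] by (intro add_mono mult_mono) auto
    also have "\<dots> = \<delta> * ?m" by (simp add: algebra_simps)
    finally show ?thesis using \<delta>(3) by simp
  qed
  then show "\<exists>T\<in>alg_A \<rho>. \<forall>f\<in>X. nrm f \<le> 1 \<longrightarrow> nrm (\<lambda>x. T f x - e x * \<phi> f) \<le> \<epsilon>"
    by (intro bexI[OF _ rank_one_C_comp_alg_A[OF a(1) b(1)]] ballI impI)
qed

section \<open>Averaging operators\<close>

definition cell :: "nat \<Rightarrow> int \<Rightarrow> real set" where
  "cell n j = {real_of_int j / real n..<(real_of_int j + 1) / real n}"

text \<open>Half-open cells are disjoint; 2 n^2 of them, each of length 1/n, tile [-n, n), and the
  factor n is the reciprocal of that length. Finitely many cells give finite rank, while the range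
  still exhausts the line.\<close>

definition averaging :: "nat \<Rightarrow> (real \<Rightarrow> complex) \<Rightarrow> real \<Rightarrow> complex" where
  "averaging n f x = (\<Sum>j\<in>{- int (n\<^sup>2)..<int (n\<^sup>2)}.
     indicator (cell n j) x * (of_nat n * pairing (indicator (cell n j)) f))"

lemma cell_sets: "cell n j \<in> sets lebesgue" "emeasure lebesgue (cell n j) < \<infinity>"
proof -
  show "cell n j \<in> sets lebesgue" by (simp add: cell_def)
  have "bounded (cell n j)" by (simp add: cell_def)
  from emeasure_bounded_finite[OF this] show "emeasure lebesgue (cell n j) < \<infinity>" by (simp add: cell_def)
qed

lemma indicator_cell_measurable: "(indicator (cell n j) :: real \<Rightarrow> complex) \<in> borel_measurable lebesgue"
  by (rule borel_measurable_indicator[OF cell_sets(1)])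

lemma mem_cell_iff: "n > 0 \<Longrightarrow> x \<in> cell n j \<longleftrightarrow> \<lfloor>real n * x\<rfloor> = j"
  by (auto simp: cell_def pos_divide_le_eq pos_less_divide_eq mult.commute floor_eq_iff)

lemma averaging_eq:
  assumes "n > 0"
  shows "averaging n f x = (if \<lfloor>real n * x\<rfloor> \<in> {- int (n\<^sup>2)..<int (n\<^sup>2)}
    then of_nat n * pairing (indicator (cell n \<lfloor>real n * x\<rfloor>)) f else 0)"
proof -
  have "averaging n f x = (\<Sum>j\<in>{- int (n\<^sup>2)..<int (n\<^sup>2)}.
     if j = \<lfloor>real n * x\<rfloor> then of_nat n * pairing (indicator (cell n \<lfloor>real n * x\<rfloor>)) f else 0)"
    unfolding averaging_def by (intro sum.cong refl) (auto simp: indicator_def mem_cell_iff[OF assms])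
  then show ?thesis by (simp add: sum.delta)
qed

lemma pairing_cell_dual: "pairing (indicator (cell n j)) \<in> dual_space \<rho>"
  by (rule pairing_dual[OF cell_sets indicator_cell_measurable, where c = 1]) (auto simp: indicator_def)

lemma averaging_measurable: "averaging n f \<in> borel_measurable lebesgue"
  unfolding averaging_def
  by (intro borel_measurable_sum borel_measurable_times borel_measurable_const indicator_cell_measurable)

text \<open>At x the sum reduces to the mean over the cell of x, an interval that competes in the
  supremum of the maximal function. The factor \<open>ennreal 1\<close> matches the shape of
  \<open>maximal_domination\<close>.\<close>

lemma averaging_le_maximal:
  assumes n: "n > 0"
  shows "ennreal (cmod (averaging n f x)) \<le> ennreal 1 * maximal_fun f x"
proof (cases "\<lfloor>real n * x\<rfloor> \<in> {- int (n\<^sup>2)..<int (n\<^sup>2)}")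
  case True
  define j where "j = \<lfloor>real n * x\<rfloor>"
  let ?a = "real_of_int j / real n" and ?b = "(real_of_int j + 1) / real n"
  have x: "x \<in> cell n j" using mem_cell_iff[OF n] by (simp add: j_def)
  have len: "?b - ?a = 1 / real n" by (simp add: diff_divide_distrib[symmetric])
  have le: "ennreal (cmod (pairing (indicator (cell n j)) f)) \<le> local_mass f ?a ?b"
  \<comment> \<open>Nothing is assumed of f: if the integral over the cell diverges, the pairing is
    0 by convention.\<close>
  proof (cases "integrable lebesgue (\<lambda>y. f y * indicator (cell n j) y)")
    case True
    have "ennreal (cmod (pairing (indicator (cell n j)) f)) \<le> (\<integral>\<^sup>+y. ennreal (cmod (f y * indicator (cell n j) y)) \<partial>lebesgue)"
      unfolding pairing_def by (rule integral_norm_bound_ennreal[OF True])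
    also have "\<dots> \<le> local_mass f ?a ?b"
      unfolding local_mass_def by (intro nn_integral_mono) (auto simp: indicator_def cell_def)
    finally show ?thesis .
  qed (simp add: pairing_def not_integrable_integral_eq)
  have "ennreal (cmod (averaging n f x)) = ennreal (real n) * ennreal (cmod (pairing (indicator (cell n j)) f))"
    using True averaging_eq[OF n, of f x] by (simp add: j_def norm_mult ennreal_mult)
  also have "\<dots> \<le> ennreal (1 / (?b - ?a)) * local_mass f ?a ?b"
    unfolding len using le by (intro mult_mono) auto
  also have "\<dots> \<le> maximal_fun f x"
    using x n by (intro local_mass_average_le) (auto simp: cell_def divide_strict_right_mono)
  finally show ?thesis by simp
next
  case False
  have "averaging n f x = 0" by (simp only: averaging_eq[OF n] False if_False)
  then show ?thesis by simp
qed

lemma averaging_bound: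
  "\<exists>C\<ge>0. \<forall>n>0. \<forall>f\<in>X. averaging n f \<in> X \<and> nrm (averaging n f) \<le> C * nrm f"
proof -
  obtain C where C: "C \<ge> 0" "\<forall>f\<in>X. \<forall>g\<in>borel_measurable lebesgue. \<forall>K\<ge>0.
      (\<forall>x. ennreal (cmod (g x)) \<le> ennreal K * maximal_fun f x) \<longrightarrow> g \<in> X \<and> nrm g \<le> K * C * nrm f"
    using maximal_domination by blast
  have "averaging n f \<in> X \<and> nrm (averaging n f) \<le> 1 * C * nrm f" if "n > 0" "f \<in> X" for n f
    using that by (intro C(2)[rule_format] averaging_measurable averaging_le_maximal) auto
  then show ?thesis using C(1) by (intro exI[of _ C]) auto
qed

lemma averaging_diff:
  assumes "f \<in> X" "g \<in> X"
  shows "averaging n (\<lambda>y. f y - g y) x = averaging n f x - averaging n g x"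
  unfolding averaging_def
  by (simp add: dual_diff[OF pairing_cell_dual assms] algebra_simps sum_subtractf)

text \<open>A mean is as close to z as the function is on the cell. It is applied with z = g x for
  convergence, with z = 0 for a uniform bound, and with z = 0 and \<epsilon> = 0 for
  vanishing.\<close>

lemma average_dist_le:
  assumes n: "n > 0" and g: "g \<in> X" and le: "\<And>y. y \<in> cell n j \<Longrightarrow> cmod (g y - z) \<le> \<epsilon>"
  shows "cmod (of_nat n * pairing (indicator (cell n j)) g - z) \<le> \<epsilon>"
proof -
  let ?I = "indicator (cell n j)"
  have meas: "measure lebesgue (cell n j) = 1 / real n"
    using n by (simp add: cell_def divide_right_mono diff_divide_distrib[symmetric])
  have intI: "integrable lebesgue (?I :: real \<Rightarrow> real)" by (rule integrable_real_indicator[OF cell_sets])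
  have intIc: "integrable lebesgue (\<lambda>y. z * ?I y)"
  proof (rule Bochner_Integration.integrable_bound[OF integrable_mult_right[OF intI, of "cmod z"]])
    show "(\<lambda>y. z * ?I y) \<in> borel_measurable lebesgue"
      by (rule borel_measurable_times[OF borel_measurable_const indicator_cell_measurable])
  qed (auto simp: norm_mult indicator_def)
  have intg: "integrable lebesgue (\<lambda>y. g y * ?I y)"
  proof -
    obtain m where "\<bar>real_of_int j\<bar> / real n + 1 \<le> real m" using real_arch_simple by blast
    then have "cell n j \<subseteq> {- real m..real m}"
    proof -
      have "1 / real n \<le> 1" using n by simp
      then show ?thesis
        using \<open>\<bar>real_of_int j\<bar> / real n + 1 \<le> real m\<close> abs_ge_self[of "real_of_int j / real n"] abs_ge_minus_self[of "real_of_int j / real n"]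
        by (auto simp: cell_def add_divide_distrib)
    qed
    then show ?thesis
      by (intro integrable_pairing[OF g indicator_cell_measurable, of n j 1 "real m"]) (auto simp: indicator_def)
  qed
  have "(\<integral>y. z * ?I y \<partial>lebesgue) = z * complex_of_real (1 / real n)"
  proof -
    have "(\<integral>y. z * ?I y \<partial>lebesgue) = z * (\<integral>y. complex_of_real (?I y) \<partial>lebesgue)"
      by (simp only: integral_mult_right_zero of_real_indicator)
    also have "(\<integral>y. complex_of_real (?I y) \<partial>lebesgue) = complex_of_real (\<integral>y. ?I y \<partial>lebesgue)"
      by (rule integral_complex_of_real)
    also have "(\<integral>y. ?I y \<partial>lebesgue) = 1 / real n"
      using cell_sets[of n j] by (simp add: meas)
    finally show ?thesis .
  qed
  then have eq: "pairing ?I g - z * complex_of_real (1 / real n) = (\<integral>y. g y * ?I y - z * ?I y \<partial>lebesgue)"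
    unfolding pairing_def using intg intIc by simp
  have "cmod (\<integral>y. g y * ?I y - z * ?I y \<partial>lebesgue) \<le> (\<integral>y. \<epsilon> * ?I y \<partial>lebesgue)"
  proof (rule order_trans[OF integral_norm_bound], rule integral_mono)
    show "integrable lebesgue (\<lambda>y. cmod (g y * ?I y - z * ?I y))"
      by (intro integrable_norm Bochner_Integration.integrable_diff intg intIc)
    show "integrable lebesgue (\<lambda>y. \<epsilon> * ?I y)" by (rule integrable_mult_right[OF intI])
    show "cmod (g y * ?I y - z * ?I y) \<le> \<epsilon> * ?I y" for y
      using le[of y] by (cases "y \<in> cell n j") auto
  qed
  also have "\<dots> = \<epsilon> * (1 / real n)" using cell_sets[of n j] by (simp add: meas)
  finally have *: "cmod (pairing ?I g - z * complex_of_real (1 / real n)) \<le> \<epsilon> / real n" unfolding eq by simp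
  have "of_nat n * pairing ?I g - z = of_nat n * (pairing ?I g - z * complex_of_real (1 / real n))"
    using n by (simp add: right_diff_distrib)
  then have "cmod (of_nat n * pairing ?I g - z) = real n * cmod (pairing ?I g - z * complex_of_real (1 / real n))"
    by (simp add: norm_mult)
  also have "\<dots> \<le> real n * (\<epsilon> / real n)" using * by (intro mult_left_mono) auto
  finally show ?thesis using n by simp
qed

lemma floor_mult_mem:
  assumes "\<bar>x\<bar> < real n"
  shows "\<lfloor>real n * x\<rfloor> \<in> {- int (n\<^sup>2)..<int (n\<^sup>2)}"
proof -
  have "real n * - real n \<le> real n * x" by (rule mult_left_mono) (use assms in auto)
  moreover have "real n * x < real n * real n" by (rule mult_strict_left_mono) (use assms in auto)
  ultimately show ?thesis by (simp add: le_floor_iff floor_less_iff power2_eq_square)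
qed

lemma averaging_tendsto_pointwise:
  assumes g: "g \<in> C_comp"
  shows "(\<lambda>n. averaging (Suc n) g x) \<longlonglongrightarrow> g x"
proof (rule LIMSEQ_I)
  fix \<epsilon> :: real assume \<epsilon>: "\<epsilon> > 0"
  have g_cont: "continuous_on UNIV g" using g by (simp add: C_comp_def)
  have "\<exists>\<delta>>0. \<forall>y\<in>UNIV. dist y x < \<delta> \<longrightarrow> dist (g y) (g x) < \<epsilon> / 2"
    by (rule g_cont[unfolded continuous_on_iff, rule_format]) (use \<epsilon> in auto)
  then obtain \<delta> where \<delta>: "\<delta> > 0" "\<And>y. \<bar>y - x\<bar> < \<delta> \<Longrightarrow> cmod (g y - g x) < \<epsilon> / 2"
    unfolding dist_norm real_norm_def by blast
  \<comment> \<open>The maximum serves two purposes: cells become shorter than \<delta>, and x lies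
    inside the range that the cells cover.\<close>
  obtain N :: nat where N: "max (1 / \<delta>) \<bar>x\<bar> < real N" using reals_Archimedean2 by blast
  have "cmod (averaging (Suc n) g x - g x) < \<epsilon>" if n: "n \<ge> N" for n
  proof -
    let ?m = "Suc n" and ?j = "\<lfloor>real (Suc n) * x\<rfloor>"
    have m: "1 / \<delta> < real ?m" "\<bar>x\<bar> < real ?m" "?m > 0" using N n by auto
    have "1 / real ?m < \<delta>" using m(1) \<delta>(1) by (simp add: field_simps)
    moreover have "\<bar>y - x\<bar> \<le> 1 / real ?m" if "y \<in> cell ?m ?j" for y
    proof -
      have "x \<in> cell ?m ?j" using mem_cell_iff[of ?m x ?j] by simp
      then show ?thesis using that by (auto simp: cell_def add_divide_distrib abs_le_iff)
    qed
    ultimately have le: "cmod (g y - g x) \<le> \<epsilon> / 2" if "y \<in> cell ?m ?j" for y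
      using \<delta>(2)[of y] that by fastforce
    have "?j \<in> {- int (?m\<^sup>2)..<int (?m\<^sup>2)}" by (rule floor_mult_mem[OF m(2)])
    then have "averaging ?m g x = of_nat ?m * pairing (indicator (cell ?m ?j)) g"
      using averaging_eq[of ?m g x] by simp
    then have "cmod (averaging ?m g x - g x) \<le> \<epsilon> / 2"
      using average_dist_le[OF m(3) C_comp_bfs[OF g] le] by simp
    then show ?thesis using \<epsilon> by simp
  qed
  then show "\<exists>N. \<forall>n\<ge>N. norm (averaging (Suc n) g x - g x) < \<epsilon>" by blast
qed

text \<open>Averages of g stay below the bound c of g and, as cells have length at most 1, vanish
  outside [-(R + 1), R + 1]. So pointwise convergence is dominated and passes to the norm.\<close>

lemma averaging_tendsto_C_comp:
  assumes g: "g \<in> C_comp"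
  shows "(\<lambda>n. nrm (\<lambda>x. averaging (Suc n) g x - g x)) \<longlonglongrightarrow> 0"
proof -
  obtain c R where cR: "c \<ge> 0" "\<And>x. cmod (g x) \<le> c * indicator {-R..R} x" "continuous_on UNIV g"
    using g by (auto simp: C_comp_def)
  have gc: "cmod (g x) \<le> c" for x using cR(2)[of x] cR(1) by (cases "x \<in> {-R..R}") auto
  have g0: "g x = 0" if "\<bar>x\<bar> > R" for x
  proof -
    have "x \<notin> {-R..R}" using that by (auto simp: abs_le_iff not_le)
    then show ?thesis using cR(2)[of x] by simp
  qed
  show ?thesis
  proof (rule dominated_convergence_X[of _ "2 * c" "R + 1"])
    show "(\<lambda>x. averaging (Suc n) g x - g x) \<in> borel_measurable lebesgue" for n
      by (intro borel_measurable_diff averaging_measurable continuous_imp_lebesgue_measurable cR(3))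
    show "0 \<le> 2 * c" using cR(1) by simp
    show "AE x in lebesgue. (\<lambda>n. averaging (Suc n) g x - g x) \<longlonglongrightarrow> 0"
      using averaging_tendsto_pointwise[OF g] by (intro AE_I2) (simp add: LIM_zero)
    fix n x
    let ?m = "Suc n" and ?j = "\<lfloor>real (Suc n) * x\<rfloor>"
    show "cmod (averaging (Suc n) g x - g x) \<le> 2 * c * indicator {-(R+1)..R+1} x"
    proof (cases "x \<in> {-(R+1)..R+1}")
      case True
      have "cmod (of_nat ?m * pairing (indicator (cell ?m ?j)) g - 0) \<le> c"
        using gc by (intro average_dist_le C_comp_bfs g) auto
      then have "cmod (averaging ?m g x) \<le> c" using cR(1) averaging_eq[of ?m g x] by auto
      then show ?thesis using True gc[of x] norm_triangle_ineq4[of "averaging ?m g x" "g x"] by simp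
    next
      case False
      have x: "x \<in> cell ?m ?j" using mem_cell_iff[of ?m x ?j] by simp
      have "g y = 0" if "y \<in> cell ?m ?j" for y
      proof (rule g0)
        have "\<bar>y - x\<bar> \<le> 1 / real ?m" using x that by (auto simp: cell_def add_divide_distrib abs_le_iff)
        also have "\<dots> \<le> 1" by simp
        finally show "\<bar>y\<bar> > R" using False by auto
      qed
      then have "cmod (of_nat ?m * pairing (indicator (cell ?m ?j)) g - 0) \<le> 0"
        by (intro average_dist_le C_comp_bfs g) auto
      then have "averaging ?m g x = 0" using averaging_eq[of ?m g x] by auto
      moreover have "g x = 0" using False by (intro g0) auto
      ultimately show ?thesis using cR(1) by simp
    qed
  qed
qed

text \<open>Convergence on a dense set together with a bound uniform in n extends to the whole
  space. Replacing f by g costs the factor C in the average and 1 in the function itself, hence the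
  C + 1.\<close>

lemma averaging_tendsto:
  assumes f: "f \<in> X"
  shows "(\<lambda>n. nrm (\<lambda>x. averaging (Suc n) f x - f x)) \<longlonglongrightarrow> 0"
proof (rule LIMSEQ_I)
  fix \<epsilon> :: real assume \<epsilon>: "\<epsilon> > 0"
  obtain C where C: "C \<ge> 0" "\<forall>n>0. \<forall>f\<in>X. averaging n f \<in> X \<and> nrm (averaging n f) \<le> C * nrm f"
    using averaging_bound by blast
  have "\<epsilon> / (2 * (C + 1)) > 0" using \<epsilon> C by simp
  from C_comp_dense[OF f this] obtain g where g: "g \<in> C_comp" "nrm (\<lambda>x. f x - g x) < \<epsilon> / (2 * (C + 1))" .
  have gX: "g \<in> X" by (rule C_comp_bfs[OF g(1)])
  obtain N where N: "\<And>n. n \<ge> N \<Longrightarrow> nrm (\<lambda>x. averaging (Suc n) g x - g x) < \<epsilon> / 2"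
    using LIMSEQ_D[OF averaging_tendsto_C_comp[OF g(1)], of "\<epsilon> / 2"] \<epsilon> by auto
  have "nrm (\<lambda>x. averaging (Suc n) f x - f x) < \<epsilon>" if n: "n \<ge> N" for n
  proof -
    let ?A = "averaging (Suc n)"
    have A: "?A h \<in> X" "nrm (?A h) \<le> C * nrm h" if "h \<in> X" for h using C(2) that by auto
    have "?A (\<lambda>x. f x - g x) = (\<lambda>x. ?A f x - ?A g x)" using averaging_diff[OF f gX] by auto
    then have 1: "nrm (\<lambda>x. ?A f x - ?A g x) \<le> C * nrm (\<lambda>x. f x - g x)" using A(2)[OF diff_bfs[OF f gX]] by simp
    have "nrm (\<lambda>x. ?A f x - f x) \<le> nrm (\<lambda>x. ?A f x - ?A g x) + nrm (\<lambda>x. ?A g x - f x)"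
      by (rule normX_triangle_diff[OF A(1)[OF f] A(1)[OF gX] f])
    also have "nrm (\<lambda>x. ?A g x - f x) \<le> nrm (\<lambda>x. ?A g x - g x) + nrm (\<lambda>x. g x - f x)"
      by (rule normX_triangle_diff[OF A(1)[OF gX] gX f])
    also have "nrm (\<lambda>x. g x - f x) = nrm (\<lambda>x. f x - g x)" by (rule normX_minus_commute[OF gX f])
    finally have "nrm (\<lambda>x. ?A f x - f x) \<le> (C + 1) * nrm (\<lambda>x. f x - g x) + nrm (\<lambda>x. ?A g x - g x)"
      using 1 by (simp add: algebra_simps)
    also have "(C + 1) * nrm (\<lambda>x. f x - g x) \<le> (C + 1) * (\<epsilon> / (2 * (C + 1)))"
      using g(2) C(1) by (intro mult_left_mono) auto
    also have "\<dots> = \<epsilon> / 2" using C(1) by (simp add: field_simps)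
    finally show ?thesis using N[OF n] by simp
  qed
  then show "\<exists>N. \<forall>n\<ge>N. norm (nrm (\<lambda>x. averaging (Suc n) f x - f x) - 0) < \<epsilon>" by auto
qed

section \<open>Compact operators as limits of finite rank operators\<close>

lemma compose_dual:
  assumes T: "bounded_op \<rho> T" and \<phi>: "\<phi> \<in> dual_space \<rho>"
  shows "(\<lambda>f. \<phi> (T f)) \<in> dual_space \<rho>"
proof -
  obtain C where C: "C \<ge> 0" "\<And>f. f \<in> X \<Longrightarrow> nrm (T f) \<le> C * nrm f" using bounded_op_bound[OF T] by blast
  note TX = bounded_op_mem[OF T]
  show ?thesis
    unfolding dual_space_def
  proof (intro CollectI conjI ballI allI impI exI)
    fix f g c assume fg: "f \<in> X" "g \<in> X"
    have "\<phi> (T (\<lambda>x. f x + c * g x)) = \<phi> (\<lambda>x. T f x + c * T g x)"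
      by (rule dual_cong[OF \<phi> _ _ bounded_op_lin[OF T fg]]) (intro TX X.lin_mem fg)+
    then show "\<phi> (T (\<lambda>x. f x + c * g x)) = \<phi> (T f) + c * \<phi> (T g)"
      using dual_lin[OF \<phi> TX[OF fg(1)] TX[OF fg(2)]] by simp
  next
    fix f g assume fg: "f \<in> X" "g \<in> X" "AE x in lebesgue. f x = g x"
    show "\<phi> (T f) = \<phi> (T g)"
      by (rule dual_cong[OF \<phi> TX[OF fg(1)] TX[OF fg(2)] bounded_op_cong[OF T fg]])
  next
    fix f assume f: "f \<in> X"
    have "cmod (\<phi> (T f)) \<le> dual_norm \<rho> \<phi> * nrm (T f)" by (rule dual_norm_bound[OF \<phi> TX[OF f]])
    also have "\<dots> \<le> dual_norm \<rho> \<phi> * (C * nrm f)"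
      using C(2)[OF f] dual_norm_nonneg[OF \<phi>] by (rule mult_left_mono)
    finally show "cmod (\<phi> (T f)) \<le> (dual_norm \<rho> \<phi> * C) * nrm f" by (simp add: mult.assoc)
  qed
qed

text \<open>Averaging after T is a finite sum of rank one operators: indicators of cells as vectors,
  and cell means pulled back along T as functionals.\<close>

lemma averaging_compose_alg_A:
  assumes T: "bounded_op \<rho> T"
  shows "(\<lambda>f. averaging n (T f)) \<in> alg_A \<rho>"
proof -
  let ?\<phi> = "\<lambda>j f. of_nat n * pairing (indicator (cell n j)) (T f)"
  have "(\<lambda>f x. \<Sum>j\<in>{- int (n\<^sup>2)..<int (n\<^sup>2)}. indicator (cell n j) x * ?\<phi> j f) \<in> alg_A \<rho>"
    by (intro sum_alg_A rank_one_alg_A indicator_bfs cell_sets X'.scale_mem compose_dual[OF T] pairing_cell_dual) simp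
  then show ?thesis by (simp add: averaging_def[abs_def])
qed

text \<open>Uniformly bounded operators that converge strongly converge uniformly on relatively
  compact sets. Otherwise unit vectors F n exist whose images stay \<epsilon> away from their
  averages, and compactness supplies a Cauchy subsequence of images to contradict this.\<close>

lemma compact_op_averaging:
  assumes T: "compact_op \<rho> T" and \<epsilon>: "\<epsilon> > 0"
  shows "\<exists>n. \<forall>f\<in>X. nrm f \<le> 1 \<longrightarrow> nrm (\<lambda>x. averaging (Suc n) (T f) x - T f x) \<le> \<epsilon>"
proof (rule ccontr)
  assume "\<not> ?thesis"
  then have "\<forall>n. \<exists>f. f \<in> X \<and> nrm f \<le> 1 \<and> \<epsilon> < nrm (\<lambda>x. averaging (Suc n) (T f) x - T f x)"
    by (auto simp: not_le)
  then obtain F where F: "\<And>n. F n \<in> X" "\<And>n. nrm (F n) \<le> 1"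
    and big: "\<And>n. \<epsilon> < nrm (\<lambda>x. averaging (Suc n) (T (F n)) x - T (F n) x)"
    by metis
  have bT: "bounded_op \<rho> T" using T by (simp add: compact_op_def)
  have TF: "T (F n) \<in> X" for n by (rule bounded_op_mem[OF bT F(1)])
  have "\<exists>r::nat \<Rightarrow> nat. strict_mono r \<and> (\<forall>\<epsilon>>0. \<exists>N. \<forall>m\<ge>N. \<forall>n\<ge>N.
      nrm (\<lambda>x. T (F (r m)) x - T (F (r n)) x) < \<epsilon>)"
    using T F unfolding compact_op_def by blast
  then obtain r :: "nat \<Rightarrow> nat" where r: "strict_mono r"
    "\<forall>\<epsilon>>0. \<exists>N. \<forall>m\<ge>N. \<forall>n\<ge>N. nrm (\<lambda>x. T (F (r m)) x - T (F (r n)) x) < \<epsilon>"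
    by blast
  obtain C where C: "C \<ge> 0" "\<forall>n>0. \<forall>f\<in>X. averaging n f \<in> X \<and> nrm (averaging n f) \<le> C * nrm f"
    using averaging_bound by blast
  have "\<epsilon> / (2 * (C + 1)) > 0" using \<epsilon> C by simp
  from r(2)[rule_format, OF this] obtain N where
    N: "\<And>m n. m \<ge> N \<Longrightarrow> n \<ge> N \<Longrightarrow> nrm (\<lambda>x. T (F (r m)) x - T (F (r n)) x) < \<epsilon> / (2 * (C + 1))" by blast
  \<comment> \<open>A fixed member of the Cauchy subsequence stands in for its limit: the averages
    converge at this one function, and all later images lie close to it.\<close>
  let ?g = "T (F (r N))"
  have "(\<lambda>m. nrm (\<lambda>x. averaging (Suc (r m)) ?g x - ?g x)) \<longlonglongrightarrow> 0"
    using LIMSEQ_subseq_LIMSEQ[OF averaging_tendsto[OF TF] r(1)] by (simp add: o_def)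
  from LIMSEQ_D[OF this, of "\<epsilon> / 2"] \<epsilon> obtain M where
    M: "\<And>m. m \<ge> M \<Longrightarrow> nrm (\<lambda>x. averaging (Suc (r m)) ?g x - ?g x) < \<epsilon> / 2" by auto
  define m where "m = max M N"
  let ?A = "averaging (Suc (r m))" and ?f = "T (F (r m))"
  have A: "?A h \<in> X" "nrm (?A h) \<le> C * nrm h" if "h \<in> X" for h using C(2) that by auto
  have "?A (\<lambda>x. ?f x - ?g x) = (\<lambda>x. ?A ?f x - ?A ?g x)" using averaging_diff[OF TF TF] by auto
  then have 1: "nrm (\<lambda>x. ?A ?f x - ?A ?g x) \<le> C * nrm (\<lambda>x. ?f x - ?g x)"
    using A(2)[OF diff_bfs[OF TF[of "r m"] TF[of "r N"]]] by simp
  have "nrm (\<lambda>x. ?A ?f x - ?f x) \<le> nrm (\<lambda>x. ?A ?f x - ?A ?g x) + nrm (\<lambda>x. ?A ?g x - ?f x)"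
    by (rule normX_triangle_diff[OF A(1)[OF TF] A(1)[OF TF] TF])
  also have "nrm (\<lambda>x. ?A ?g x - ?f x) \<le> nrm (\<lambda>x. ?A ?g x - ?g x) + nrm (\<lambda>x. ?g x - ?f x)"
    by (rule normX_triangle_diff[OF A(1)[OF TF] TF TF])
  also have "nrm (\<lambda>x. ?g x - ?f x) = nrm (\<lambda>x. ?f x - ?g x)" by (rule normX_minus_commute[OF TF TF])
  finally have "nrm (\<lambda>x. ?A ?f x - ?f x) \<le> (C + 1) * nrm (\<lambda>x. ?f x - ?g x) + nrm (\<lambda>x. ?A ?g x - ?g x)"
    using 1 by (simp add: algebra_simps)
  also have "(C + 1) * nrm (\<lambda>x. ?f x - ?g x) \<le> (C + 1) * (\<epsilon> / (2 * (C + 1)))"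
    using N[of m N] C(1) by (intro mult_left_mono) (auto simp: m_def)
  also have "\<dots> = \<epsilon> / 2" using C(1) by (simp add: field_simps)
  finally show False using M[of m] big[of "r m"] by (simp add: m_def)
qed

lemma compact_op_alg_A:
  assumes T: "compact_op \<rho> T"
  shows "T \<in> alg_A \<rho>"
proof -
  have bT: "bounded_op \<rho> T" using T by (simp add: compact_op_def)
  show ?thesis
  proof (rule alg_A_closed[OF bT])
    fix \<epsilon> :: real assume "\<epsilon> > 0"
    then obtain n where "\<forall>f\<in>X. nrm f \<le> 1 \<longrightarrow> nrm (\<lambda>x. averaging (Suc n) (T f) x - T f x) \<le> \<epsilon>"
      using compact_op_averaging[OF T] by blast
    then show "\<exists>S\<in>alg_A \<rho>. \<forall>f\<in>X. nrm f \<le> 1 \<longrightarrow> nrm (\<lambda>x. S f x - T f x) \<le> \<epsilon>"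
      by (rule bexI[OF _ averaging_compose_alg_A[OF bT]])
  qed
qed

end

theorem theorem1p1:
  fixes \<rho> :: "(real \<Rightarrow> ennreal) \<Rightarrow> ennreal"
  assumes "banach_function_norm \<rho>"
    and "reflexive_bfs \<rho>"
    and "maximal_bounded \<rho>"
    and "maximal_bounded (assoc_norm \<rho>)"
  shows "\<forall>T. compact_op \<rho> T \<longrightarrow> T \<in> alg_A \<rho>"
proof -
  interpret maximal_banach_function_space \<rho> using assms(1-3) by unfold_locales
  show ?thesis using compact_op_alg_A by blast
qed

end
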